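(* Let $\Gamma$ be a finite group acting on an affine scheme $X$ and on a finite-dimensional Lie algebra $\mathfrak{g}$, and let $\mathfrak{M}=M(X,\mathfrak{g})^\Gamma$. The map $\mathcal{E}\to\mathcal{S}$, $\Psi\mapsto\mathrm{ev}_\Psi$, is injective.
   Context: $k$ is an algebraically closed field of characteristic zero; all tensor products are over $k$. $X=\operatorname{Spec}A$ is an affine $k$-scheme ($A$ a commutative associative unital $k$-algebra, not assumed finitely generated or reduced). The finite group $\Gamma$ acts on $X$ by scheme automorphisms (over $k$), hence on $A$ by $g\cdot f=f\circ g^{-1}$, and on the finite-dimensional $k$-Lie algebra $\mathfrak{g}$ by Lie algebra automorphisms. $\mathfrak{M}=M(X,\mathfrak{g})^\Gamma$ is the Lie algebra of $\Gamma$-equivariant regular maps $X\to\mathfrak{g}$ with pointwise operations; equivalently $\mathfrak{M}=(\mathfrak{g}\otimes A)^\Gamma$ for the diagonal action, with bracket $[u\otimes f,v\otimes h]=[u,v]\otimes fh$. $X_{\rm rat}$ is the set of $k$-rational points of $X$. For $x\in X_{\rm rat}$ and $\alpha=\sum_i u_i\otimes f_i$, put $\alpha(x)=\sum_i f_i(x)u_i$. Let $\Gamma_x=\{g\in\Gamma:g\cdot x=x\}$ and $\mathfrak{g}^x=\{u\in\mathfrak{g}:g\cdot u=u\ \forall g\in\Gamma_x\}$; one has $\alpha(x)\in\mathfrak{g}^x$ for $\alpha\in\mathfrak{M}$. For a finite subset $\mathbf{x}\subseteq X_{\rm rat}$ let $\mathrm{ev}_{\mathbf x}:\mathfrak{M}\to\bigoplus_{x\in\mathbf{x}}\mathfrak{g}^x$,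 $\alpha\mapsto(\alpha(x))_{x\in\mathbf{x}}$. Given representations $\rho_x:\mathfrak{g}^x\to\operatorname{End}_kV_x$ ($x\in\mathbf{x}$), the evaluation representation $\mathrm{ev}_{\mathbf x}(\rho_x)_{x\in\mathbf{x}}$ of $\mathfrak{M}$ on $\bigotimes_{x\in\mathbf x}V_x$ is the composition of $\mathrm{ev}_{\mathbf x}$ with the tensor product representation of $\bigoplus_{x\in\mathbf{x}}\mathfrak{g}^x$. $\mathcal{R}_x$ is the set of isomorphism classes of irreducible finite-dimensional representations of $\mathfrak{g}^x$, and $\mathcal{R}_X=\bigsqcup_{x\in X_{\rm rat}}\mathcal{R}_x$, with $\Gamma$ acting by $g\cdot[\rho]=[\rho\circ g^{-1}]\in\mathcal{R}_{g\cdot x}$ for $[\rho]\in\mathcal{R}_x$. $\mathcal{E}$ is the set of finitely supported $\Gamma$-equivariant functions $\Psi:X_{\rm rat}\to\mathcal{R}_X$ with $\Psi(x)\in\mathcal{R}_x$, where $\operatorname{supp}\Psi=\{x:\Psi(x)\neq0\}$ and $0$ denotes the class of the one-dimensional trivial representation. For $\Psi\in\mathcal{E}$, $\mathrm{ev}_\Psi$ is the isomorphism class of $\mathrm{ev}_{\mathbf x}(\Psi(x))_{x\in\mathbf{x}}$, where $\mathbf{x}$ contains exactly one element of each $\Gamma$-orbit in $\operatorname{supp}\Psi$ (independent of the choice); if $\operatorname{supp}\Psi=\emptyset$, it is the class of the trivial representation. $\mathcal{S}$ is the set of isomorphism classes of irreducible finite-dimensional representations of $\mathfrak{M}$. *)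

theory Defs
  imports
    "HOL-Algebra.Group_Action"
    "HOL-Library.Function_Algebras"
    "HOL-Computational_Algebra.Polynomial"
begin

section \<open>Spaces of functionals\<close>

definition fscale :: "'k::field \<Rightarrow> ('i \<Rightarrow> 'k) \<Rightarrow> 'i \<Rightarrow> 'k" where
  "fscale c F = (\<lambda>i. c * F i)"

lemma vector_space_fscale: "vector_space (fscale :: 'k::field \<Rightarrow> ('i \<Rightarrow> 'k) \<Rightarrow> _)"
  by unfold_locales (auto simp: fscale_def fun_eq_iff algebra_simps)

lemma vector_space_mult: "vector_space ((*) :: 'k::field \<Rightarrow> 'k \<Rightarrow> 'k)"
  by unfold_locales (auto simp: algebra_simps)

lemma linear_intro:
  assumes "vector_space s1" "vector_space s2"
    "\<And>x y. f (x + y) = f x + f y" "\<And>c x. f (s1 c x) = s2 c (f x)"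
  shows "Vector_Spaces.linear s1 s2 f"
  using assms
  by (simp add: Vector_Spaces.linear_def module_hom_def module_hom_axioms_def
      vector_space_def module_def)

text \<open>
  Tensor products of vector spaces are not in the library. Over a field, a tensor product embeds
  into the space of functionals on the (bi- or multi-)linear forms; it is the span there of the
  evaluations at tuples of vectors, which are the pure tensors. This model is used for
  both kinds of tensor products below, and its universal property is an instance of the
  next definition and lemma, where \<open>P\<close> singles out the multilinear forms among all functions.
\<close>

definition evaluation :: "(('x \<Rightarrow> 'k::field) \<Rightarrow> bool) \<Rightarrow> 'x \<Rightarrow> ('x \<Rightarrow> 'k) \<Rightarrow> 'k" where
  "evaluation P x = (\<lambda>m. if P m then m x else 0)"

lemma evaluation_lift:
  fixes sW :: "'k::field \<Rightarrow> 'w::ab_group_add \<Rightarrow> 'w" and \<beta> :: "'x \<Rightarrow> 'w"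
  assumes W: "vector_space sW"
    and P: "\<And>\<phi>. Vector_Spaces.linear sW (*) \<phi> \<Longrightarrow> P (\<lambda>x. \<phi> (\<beta> x))"
  shows "\<exists>F. Vector_Spaces.linear fscale sW F \<and> (\<forall>x\<in>X. F (evaluation P x) = \<beta> x)"
proof -
  interpret f: vector_space "fscale :: 'k \<Rightarrow> (('x \<Rightarrow> 'k) \<Rightarrow> 'k) \<Rightarrow> _" by (rule vector_space_fscale)
  interpret W: vector_space sW by (rule W)
  interpret k: vector_space "(*) :: 'k \<Rightarrow> 'k \<Rightarrow> 'k" by (rule vector_space_mult)
  interpret Wk: vector_space_pair sW "(*) :: 'k \<Rightarrow> 'k \<Rightarrow> 'k" by unfold_locales
  interpret fW: vector_space_pair "fscale :: 'k \<Rightarrow> (('x \<Rightarrow> 'k) \<Rightarrow> 'k) \<Rightarrow> _" sW by unfold_locales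
  let ?e = "evaluation P"
  have sep: "w = 0" if "\<And>\<phi>. Vector_Spaces.linear sW (*) \<phi> \<Longrightarrow> \<phi> w = 0" for w
  proof (rule ccontr)
    assume "w \<noteq> 0"
    then have "W.independent {w}" by simp
    from Wk.linear_independent_extend[OF this, of "\<lambda>_. 1"]
    obtain \<phi> where "Vector_Spaces.linear sW (*) \<phi>" "\<phi> w = 1" by auto
    with that show False by force
  qed
  obtain B where B: "B \<subseteq> ?e ` X" "f.independent B" "f.span B = f.span (?e ` X)"
    using f.maximal_independent_subset[of "?e ` X"]
    by (metis f.span_mono f.span_span order_antisym_conv)
  define s where "s b = (SOME x. x \<in> X \<and> ?e x = b)" for b
  have s: "s b \<in> X \<and> ?e (s b) = b" if "b \<in> B" for b
    unfolding s_def using that B(1) by (intro someI_ex[of "\<lambda>x. x \<in> X \<and> ?e x = b"]) auto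
  obtain F where F: "Vector_Spaces.linear fscale sW F" "\<And>b. b \<in> B \<Longrightarrow> F b = \<beta> (s b)"
    using fW.linear_independent_extend[OF B(2), of "\<lambda>b. \<beta> (s b)"] by auto
  interpret F: Vector_Spaces.linear fscale sW F by (rule F(1))
  have "F (?e x) = \<beta> x" if x: "x \<in> X" for x
  proof -
    have "?e x \<in> f.span B" unfolding B(3) using x by (auto intro: f.span_base)
    then obtain t r where t: "finite t" "t \<subseteq> B" "?e x = (\<Sum>b\<in>t. fscale (r b) b)"
      unfolding f.span_explicit by blast
    have "\<beta> x - (\<Sum>b\<in>t. sW (r b) (\<beta> (s b))) = 0"
    proof (rule sep)
      fix \<phi> assume \<phi>: "Vector_Spaces.linear sW (*) \<phi>"
      interpret \<phi>: Vector_Spaces.linear sW "(*)" \<phi> by (rule \<phi>)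
      have ev: "\<phi> (\<beta> y) = ?e y (\<lambda>x. \<phi> (\<beta> x))" for y
        using P[OF \<phi>] by (simp add: evaluation_def)
      have sum_app: "(\<Sum>b\<in>t. G b) m = (\<Sum>b\<in>t. G b m)"
        for G :: "(('x \<Rightarrow> 'k) \<Rightarrow> 'k) \<Rightarrow> ('x \<Rightarrow> 'k) \<Rightarrow> 'k" and m
        using t(1) by induction auto
      have "\<phi> (\<beta> x) = (\<Sum>b\<in>t. r b * ?e (s b) (\<lambda>x. \<phi> (\<beta> x)))"
        unfolding ev[of x] t(3) sum_app using t(2) s
        by (intro sum.cong) (auto simp: fscale_def)
      then show "\<phi> (\<beta> x - (\<Sum>b\<in>t. sW (r b) (\<beta> (s b)))) = 0"
        by (simp add: \<phi>.diff \<phi>.sum \<phi>.scale flip: ev)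
    qed
    moreover have "F (?e x) = (\<Sum>b\<in>t. sW (r b) (\<beta> (s b)))"
      unfolding t(3) using t(2) F(2) by (auto simp: F.sum F.scale intro!: sum.cong)
    ultimately show ?thesis by simp
  qed
  with F(1) show ?thesis by blast
qed


section \<open>Representations of Lie algebras\<close>

text \<open>
  The Lie algebra is a subspace \<open>L\<close>, closed under the bracket, of a type with scaling \<open>scL\<close> and
  bracket \<open>br\<close>; the representation space is a subspace \<open>V\<close> of a type with scaling \<open>sc\<close>.
  Values of \<open>\<rho>\<close> outside \<open>L\<close> and \<open>V\<close> are irrelevant.
\<close>

definition lie_rep ::
  "('k::field \<Rightarrow> 'l::ab_group_add \<Rightarrow> 'l) \<Rightarrow> ('l \<Rightarrow> 'l \<Rightarrow> 'l) \<Rightarrow> 'l set \<Rightarrow>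
   ('k \<Rightarrow> 'v::ab_group_add \<Rightarrow> 'v) \<Rightarrow> 'v set \<Rightarrow> ('l \<Rightarrow> 'v \<Rightarrow> 'v) \<Rightarrow> bool" where
  "lie_rep scL br L sc V \<rho> \<longleftrightarrow>
     module.subspace sc V \<and>
     (\<forall>u\<in>L. \<forall>v\<in>V. \<rho> u v \<in> V) \<and>
     (\<forall>u\<in>L. \<forall>v\<in>V. \<forall>w\<in>V. \<rho> u (v + w) = \<rho> u v + \<rho> u w) \<and>
     (\<forall>u\<in>L. \<forall>c. \<forall>v\<in>V. \<rho> u (sc c v) = sc c (\<rho> u v)) \<and>
     (\<forall>u\<in>L. \<forall>t\<in>L. \<forall>v\<in>V. \<rho> (u + t) v = \<rho> u v + \<rho> t v) \<and>
     (\<forall>u\<in>L. \<forall>c. \<forall>v\<in>V. \<rho> (scL c u) v = sc c (\<rho> u v)) \<and>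
     (\<forall>u\<in>L. \<forall>t\<in>L. \<forall>v\<in>V. \<rho> (br u t) v = \<rho> u (\<rho> t v) - \<rho> t (\<rho> u v))"

definition irreducible_rep ::
  "'l set \<Rightarrow> ('k::field \<Rightarrow> 'v::ab_group_add \<Rightarrow> 'v) \<Rightarrow> 'v set \<Rightarrow> ('l \<Rightarrow> 'v \<Rightarrow> 'v) \<Rightarrow> bool" where
  "irreducible_rep L sc V \<rho> \<longleftrightarrow>
     V \<noteq> {0} \<and>
     (\<forall>W. module.subspace sc W \<and> W \<subseteq> V \<and> (\<forall>u\<in>L. \<forall>w\<in>W. \<rho> u w \<in> W) \<longrightarrow> W = {0} \<or> W = V)"

definition rep_iso ::
  "'l set \<Rightarrow> ('k::field \<Rightarrow> 'v::ab_group_add \<Rightarrow> 'v) \<Rightarrow> 'v set \<Rightarrow> ('l \<Rightarrow> 'v \<Rightarrow> 'v) \<Rightarrow>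
   ('k \<Rightarrow> 'w::ab_group_add \<Rightarrow> 'w) \<Rightarrow> 'w set \<Rightarrow> ('l \<Rightarrow> 'w \<Rightarrow> 'w) \<Rightarrow> bool" where
  "rep_iso L sc V \<rho> sc' W \<sigma> \<longleftrightarrow>
     (\<exists>\<phi>. bij_betw \<phi> V W \<and>
          (\<forall>v\<in>V. \<forall>w\<in>V. \<phi> (v + w) = \<phi> v + \<phi> w) \<and>
          (\<forall>c. \<forall>v\<in>V. \<phi> (sc c v) = sc' c (\<phi> v)) \<and>
          (\<forall>u\<in>L. \<forall>v\<in>V. \<phi> (\<rho> u v) = \<sigma> u (\<phi> v)))"

text \<open>
  Isomorphism classes are formed inside one universe: all finite-dimensional subspaces of the
  sequence space \<open>nat \<Rightarrow> 'k\<close>, which contains a copy of every finite-dimensional space.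
\<close>

type_synonym ('l, 'k) rep = "(nat \<Rightarrow> 'k) set \<times> ('l \<Rightarrow> (nat \<Rightarrow> 'k) \<Rightarrow> nat \<Rightarrow> 'k)"

definition fd_reps ::
  "('k::field \<Rightarrow> 'l::ab_group_add \<Rightarrow> 'l) \<Rightarrow> ('l \<Rightarrow> 'l \<Rightarrow> 'l) \<Rightarrow> 'l set \<Rightarrow> ('l, 'k) rep set" where
  "fd_reps scL br L =
     {(V, \<rho>). lie_rep scL br L fscale V \<rho> \<and> (\<exists>B. finite B \<and> V = module.span fscale B)}"

text \<open>The isomorphism class of a representation on a finite-dimensional space \<open>V\<close> of any type:\<close>

definition iso_class ::
  "('k::field \<Rightarrow> 'l::ab_group_add \<Rightarrow> 'l) \<Rightarrow> ('l \<Rightarrow> 'l \<Rightarrow> 'l) \<Rightarrow> 'l set \<Rightarrow>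
   ('k \<Rightarrow> 'v::ab_group_add \<Rightarrow> 'v) \<Rightarrow> 'v set \<Rightarrow> ('l \<Rightarrow> 'v \<Rightarrow> 'v) \<Rightarrow> ('l, 'k) rep set" where
  "iso_class scL br L sc V \<rho> = {(W, \<sigma>) \<in> fd_reps scL br L. rep_iso L sc V \<rho> fscale W \<sigma>}"

definition irr_classes ::
  "('k::field \<Rightarrow> 'l::ab_group_add \<Rightarrow> 'l) \<Rightarrow> ('l \<Rightarrow> 'l \<Rightarrow> 'l) \<Rightarrow> 'l set \<Rightarrow> ('l, 'k) rep set set" where
  "irr_classes scL br L =
     {iso_class scL br L fscale V \<rho> | V \<rho>. (V, \<rho>) \<in> fd_reps scL br L \<and> irreducible_rep L fscale V \<rho>}"

definition trivial_class ::
  "('k::field \<Rightarrow> 'l::ab_group_add \<Rightarrow> 'l) \<Rightarrow> ('l \<Rightarrow> 'l \<Rightarrow> 'l) \<Rightarrow> 'l set \<Rightarrow> ('l, 'k) rep set" where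
  "trivial_class scL br L = iso_class scL br L (*) (UNIV :: 'k set) (\<lambda>u v. 0)"


lemma rep_iso_trans:
  assumes "rep_iso L sc V \<rho> sc' W \<sigma>" "rep_iso L sc' W \<sigma> sc'' Z \<tau>"
  shows "rep_iso L sc V \<rho> sc'' Z \<tau>"
proof -
  from assms obtain \<phi> \<psi> where
    \<phi>: "bij_betw \<phi> V W" "\<forall>v\<in>V. \<forall>w\<in>V. \<phi> (v + w) = \<phi> v + \<phi> w" "\<forall>c. \<forall>v\<in>V. \<phi> (sc c v) = sc' c (\<phi> v)"
      "\<forall>u\<in>L. \<forall>v\<in>V. \<phi> (\<rho> u v) = \<sigma> u (\<phi> v)" and
    \<psi>: "bij_betw \<psi> W Z" "\<forall>v\<in>W. \<forall>w\<in>W. \<psi> (v + w) = \<psi> v + \<psi> w" "\<forall>c. \<forall>v\<in>W. \<psi> (sc' c v) = sc'' c (\<psi> v)"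
      "\<forall>u\<in>L. \<forall>v\<in>W. \<psi> (\<sigma> u v) = \<tau> u (\<psi> v)"
    unfolding rep_iso_def by blast
  have "\<phi> v \<in> W" if "v \<in> V" for v using \<phi>(1) that by (auto simp: bij_betw_def)
  with \<phi> \<psi> bij_betw_trans[OF \<phi>(1) \<psi>(1)] show ?thesis
    unfolding rep_iso_def by (intro exI[of _ "\<psi> \<circ> \<phi>"]) simp
qed

lemma rep_iso_sym:
  assumes iso: "rep_iso L sc V \<rho> sc' W \<sigma>"
    and V: "\<And>v w. v \<in> V \<Longrightarrow> w \<in> V \<Longrightarrow> v + w \<in> V" "\<And>c v. v \<in> V \<Longrightarrow> sc c v \<in> V"
      "\<And>u v. u \<in> L \<Longrightarrow> v \<in> V \<Longrightarrow> \<rho> u v \<in> V"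
  shows "rep_iso L sc' W \<sigma> sc V \<rho>"
proof -
  from iso obtain \<phi> where
    \<phi>: "bij_betw \<phi> V W" "\<forall>v\<in>V. \<forall>w\<in>V. \<phi> (v + w) = \<phi> v + \<phi> w" "\<forall>c. \<forall>v\<in>V. \<phi> (sc c v) = sc' c (\<phi> v)"
      "\<forall>u\<in>L. \<forall>v\<in>V. \<phi> (\<rho> u v) = \<sigma> u (\<phi> v)"
    unfolding rep_iso_def by blast
  let ?\<psi> = "inv_into V \<phi>"
  have W: "W = \<phi> ` V" and l: "\<And>v. v \<in> V \<Longrightarrow> ?\<psi> (\<phi> v) = v"
    using \<phi>(1) by (auto simp: bij_betw_def)
  have "?\<psi> (\<phi> v + \<phi> w) = v + w" if "v \<in> V" "w \<in> V" for v w
    using that \<phi>(2) V(1) l by metis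
  moreover have "?\<psi> (sc' c (\<phi> v)) = sc c v" if "v \<in> V" for c v
    using that \<phi>(3) V(2) l by metis
  moreover have "?\<psi> (\<sigma> u (\<phi> v)) = \<rho> u v" if "u \<in> L" "v \<in> V" for u v
    using that \<phi>(4) V(3) l by metis
  ultimately show ?thesis
    unfolding rep_iso_def using bij_betw_inv_into[OF \<phi>(1)]
    by (intro exI[of _ ?\<psi>]) (auto simp: W l)
qed

lemma iso_class_cong:
  assumes "rep_iso L sc V \<rho> sc' W \<sigma>"
    and "\<And>v w. v \<in> V \<Longrightarrow> w \<in> V \<Longrightarrow> v + w \<in> V" "\<And>c v. v \<in> V \<Longrightarrow> sc c v \<in> V"
      "\<And>u v. u \<in> L \<Longrightarrow> v \<in> V \<Longrightarrow> \<rho> u v \<in> V"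
  shows "iso_class scL br L sc V \<rho> = iso_class scL br L sc' W \<sigma>"
proof -
  have "rep_iso L sc' W \<sigma> sc V \<rho>" by (rule rep_iso_sym[OF assms(1)]) (use assms in auto)
  with assms(1) show ?thesis
    unfolding iso_class_def by (auto intro: rep_iso_trans)
qed


section \<open>Tensor products of finitely many representations\<close>

definition multilinear_form ::
  "'i set \<Rightarrow> ('k::field \<Rightarrow> 'v::ab_group_add \<Rightarrow> 'v) \<Rightarrow> ('i \<Rightarrow> 'v set) \<Rightarrow> (('i \<Rightarrow> 'v) \<Rightarrow> 'k) \<Rightarrow> bool" where
  "multilinear_form I sc V m \<longleftrightarrow>
     (\<forall>v\<in>Pi\<^sub>E I V. \<forall>i\<in>I. \<forall>a\<in>V i. \<forall>b\<in>V i. \<forall>c.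
        m (v(i := a + b)) = m (v(i := a)) + m (v(i := b)) \<and>
        m (v(i := sc c a)) = c * m (v(i := a)))"

definition pure_tensor ::
  "'i set \<Rightarrow> ('k::field \<Rightarrow> 'v::ab_group_add \<Rightarrow> 'v) \<Rightarrow> ('i \<Rightarrow> 'v set) \<Rightarrow> ('i \<Rightarrow> 'v) \<Rightarrow>
   (('i \<Rightarrow> 'v) \<Rightarrow> 'k) \<Rightarrow> 'k" where
  "pure_tensor I sc V = evaluation (multilinear_form I sc V)"

text \<open>For \<open>I = {}\<close> this is the line spanned by the empty tensor.\<close>

definition tensor_space ::
  "'i set \<Rightarrow> ('k::field \<Rightarrow> 'v::ab_group_add \<Rightarrow> 'v) \<Rightarrow> ('i \<Rightarrow> 'v set) \<Rightarrow> ((('i \<Rightarrow> 'v) \<Rightarrow> 'k) \<Rightarrow> 'k) set" where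
  "tensor_space I sc V = module.span fscale (pure_tensor I sc V ` Pi\<^sub>E I V)"

text \<open>
  The tensor product representation of the direct sum of Lie algebras indexed by \<open>I\<close>, with
  \<open>u = (u\<^sub>i)\<close> in the direct sum: by \<open>tensor_rep_pure_tensor\<close> below, it is the operator that sends
  a pure tensor \<open>v\<close> to the sum over \<open>i \<in> I\<close> of the pure tensors \<open>v\<close> with \<open>v\<^sub>i\<close> replaced by \<open>\<rho>\<^sub>i(u\<^sub>i) v\<^sub>i\<close>.
\<close>

definition tensor_rep ::
  "'i set \<Rightarrow> ('k::field \<Rightarrow> 'v::ab_group_add \<Rightarrow> 'v) \<Rightarrow> ('i \<Rightarrow> 'v set) \<Rightarrow> ('i \<Rightarrow> 'l \<Rightarrow> 'v \<Rightarrow> 'v) \<Rightarrow>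
   ('i \<Rightarrow> 'l) \<Rightarrow> ((('i \<Rightarrow> 'v) \<Rightarrow> 'k) \<Rightarrow> 'k) \<Rightarrow> (('i \<Rightarrow> 'v) \<Rightarrow> 'k) \<Rightarrow> 'k" where
  "tensor_rep I sc V \<rho> u T =
     (\<lambda>m. if multilinear_form I sc V m then T (\<lambda>v. \<Sum>i\<in>I. m (v(i := \<rho> i (u i) (v i)))) else 0)"

lemma pure_tensor_multilinear:
  assumes "v \<in> Pi\<^sub>E I V" "i \<in> I" "a \<in> V i" "b \<in> V i"
  shows "pure_tensor I sc V (v(i := a + b)) = pure_tensor I sc V (v(i := a)) + pure_tensor I sc V (v(i := b))"
    and "pure_tensor I sc V (v(i := sc c a)) = fscale c (pure_tensor I sc V (v(i := a)))"
  using assms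
  by (auto simp: pure_tensor_def evaluation_def fscale_def fun_eq_iff multilinear_form_def)

lemma tensor_space_universal:
  fixes sW :: "'k::field \<Rightarrow> 'w::ab_group_add \<Rightarrow> 'w" and sc :: "'k \<Rightarrow> 'v::ab_group_add \<Rightarrow> 'v"
  assumes W: "vector_space sW"
    and \<beta>: "\<And>v i a b c. v \<in> Pi\<^sub>E I V \<Longrightarrow> i \<in> I \<Longrightarrow> a \<in> V i \<Longrightarrow> b \<in> V i \<Longrightarrow>
        \<beta> (v(i := a + b)) = \<beta> (v(i := a)) + \<beta> (v(i := b)) \<and> \<beta> (v(i := sc c a)) = sW c (\<beta> (v(i := a)))"
  shows "\<exists>F. Vector_Spaces.linear fscale sW F \<and> (\<forall>v\<in>Pi\<^sub>E I V. F (pure_tensor I sc V v) = \<beta> v)"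
  unfolding pure_tensor_def
proof (rule evaluation_lift[OF W])
  fix \<phi> :: "'w \<Rightarrow> 'k" assume \<phi>: "Vector_Spaces.linear sW (*) \<phi>"
  interpret \<phi>: Vector_Spaces.linear sW "(*)" \<phi> by (rule \<phi>)
  show "multilinear_form I sc V (\<lambda>v. \<phi> (\<beta> v))"
    unfolding multilinear_form_def using \<beta> by (simp add: \<phi>.add \<phi>.scale)
qed

lemma tensor_rep_linear:
  "tensor_rep I sc V \<rho> u (T + T') = tensor_rep I sc V \<rho> u T + tensor_rep I sc V \<rho> u T'"
  "tensor_rep I sc V \<rho> u (fscale c T) = fscale c (tensor_rep I sc V \<rho> u T)"
  by (auto simp: tensor_rep_def fscale_def fun_eq_iff)

lemma tensor_rep_pure_tensor:
  fixes sc :: "'k::field \<Rightarrow> 'v::ab_group_add \<Rightarrow> 'v" and I :: "'i set"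
  assumes "finite I" and v: "v \<in> Pi\<^sub>E I V"
    and rep: "\<And>i. i \<in> I \<Longrightarrow> lie_rep scL br (L i) sc (V i) (\<rho> i)" and u: "\<And>i. i \<in> I \<Longrightarrow> u i \<in> L i"
  shows "tensor_rep I sc V \<rho> u (pure_tensor I sc V v) =
         (\<Sum>i\<in>I. pure_tensor I sc V (v(i := \<rho> i (u i) (v i))))"
proof
  fix m
  have "multilinear_form I sc V (\<lambda>v. \<Sum>i\<in>I. m (v(i := \<rho> i (u i) (v i))))"
    if m: "multilinear_form I sc V m"
    unfolding multilinear_form_def
  proof (intro ballI allI conjI)
    fix w j a b c assume w: "w \<in> Pi\<^sub>E I V" and j: "j \<in> I" and ab: "a \<in> V j" "b \<in> V j"
    have st: "\<rho> i (u i) x \<in> V i" if "i \<in> I" "x \<in> V i" for i x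
      using rep[OF that(1)] u[OF that(1)] that(2) by (simp add: lie_rep_def)
    have w': "w(i := x) \<in> Pi\<^sub>E I V" if "i \<in> I" "x \<in> V i" for i x
      using w that by (auto simp: PiE_iff extensional_def)
    have wi: "w i \<in> V i" if "i \<in> I" for i using w that by auto
    have mm: "m (w'(j := x + y)) = m (w'(j := x)) + m (w'(j := y))"
             "m (w'(j := sc c x)) = c * m (w'(j := x))"
      if "w' \<in> Pi\<^sub>E I V" "x \<in> V j" "y \<in> V j" for w' x y
      using m that j by (auto simp: multilinear_form_def)
    have lin: "\<rho> j (u j) (a + b) = \<rho> j (u j) a + \<rho> j (u j) b" "\<rho> j (u j) (sc c a) = sc c (\<rho> j (u j) a)"
      using rep[OF j] u[OF j] ab by (auto simp: lie_rep_def)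
    show "(\<Sum>i\<in>I. m ((w(j := a + b))(i := \<rho> i (u i) ((w(j := a + b)) i)))) =
          (\<Sum>i\<in>I. m ((w(j := a))(i := \<rho> i (u i) ((w(j := a)) i)))) +
          (\<Sum>i\<in>I. m ((w(j := b))(i := \<rho> i (u i) ((w(j := b)) i))))"
      unfolding sum.distrib[symmetric]
    proof (rule sum.cong[OF refl])
      fix i assume i: "i \<in> I"
      show "m ((w(j := a + b))(i := \<rho> i (u i) ((w(j := a + b)) i))) =
            m ((w(j := a))(i := \<rho> i (u i) ((w(j := a)) i))) + m ((w(j := b))(i := \<rho> i (u i) ((w(j := b)) i)))"
      proof (cases "i = j")
        case True
        then show ?thesis using mm(1)[OF w, of "\<rho> j (u j) a" "\<rho> j (u j) b"] st[OF j] ab by (simp add: lin)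
      next
        case False
        then show ?thesis
          using mm(1)[OF w'[OF i st[OF i wi[OF i]]] ab] by (simp add: fun_upd_twist[of j i])
      qed
    qed
    show "(\<Sum>i\<in>I. m ((w(j := sc c a))(i := \<rho> i (u i) ((w(j := sc c a)) i)))) =
          c * (\<Sum>i\<in>I. m ((w(j := a))(i := \<rho> i (u i) ((w(j := a)) i))))"
      unfolding sum_distrib_left
    proof (rule sum.cong[OF refl])
      fix i assume i: "i \<in> I"
      show "m ((w(j := sc c a))(i := \<rho> i (u i) ((w(j := sc c a)) i))) =
            c * m ((w(j := a))(i := \<rho> i (u i) ((w(j := a)) i)))"
      proof (cases "i = j")
        case True
        then show ?thesis using mm(2)[OF w, of "\<rho> j (u j) a" "\<rho> j (u j) a"] st[OF j] ab by (simp add: lin)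
      next
        case False
        then show ?thesis
          using mm(2)[OF w'[OF i st[OF i wi[OF i]]] ab] by (simp add: fun_upd_twist[of j i])
      qed
    qed
  qed
  moreover have "(\<Sum>i\<in>I. G i) m = (\<Sum>i\<in>I. G i m)" for G :: "'i \<Rightarrow> (('i \<Rightarrow> 'v) \<Rightarrow> 'k) \<Rightarrow> 'k"
    using \<open>finite I\<close> by induction auto
  ultimately show "tensor_rep I sc V \<rho> u (pure_tensor I sc V v) m =
      (\<Sum>i\<in>I. pure_tensor I sc V (v(i := \<rho> i (u i) (v i)))) m"
    by (simp add: tensor_rep_def pure_tensor_def evaluation_def)
qed


lemma tensor_rep_empty:
  fixes sc :: "'k::field \<Rightarrow> 'v::ab_group_add \<Rightarrow> 'v" and V :: "'i \<Rightarrow> 'v set"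
  shows "rep_iso L fscale (tensor_space {} sc V) (\<lambda>u. tensor_rep {} sc V \<rho> (h u)) (*) (UNIV :: 'k set) (\<lambda>u v. 0)"
    and "T \<in> tensor_space {} sc V \<Longrightarrow> T' \<in> tensor_space {} sc V \<Longrightarrow> T + T' \<in> tensor_space {} sc V"
    and "T \<in> tensor_space {} sc V \<Longrightarrow> fscale c T \<in> tensor_space {} sc V"
    and "T \<in> tensor_space {} sc V \<Longrightarrow> tensor_rep {} sc V \<rho> u T \<in> tensor_space {} sc V"
proof -
  interpret f: vector_space "fscale :: 'k \<Rightarrow> ((('i \<Rightarrow> 'v) \<Rightarrow> 'k) \<Rightarrow> 'k) \<Rightarrow> _" by (rule vector_space_fscale)
  define e :: "(('i \<Rightarrow> 'v) \<Rightarrow> 'k) \<Rightarrow> 'k" where "e = (\<lambda>m. m (\<lambda>_. undefined))"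
  have ts: "tensor_space {} sc V = range (\<lambda>c. fscale c e)"
    by (simp add: tensor_space_def pure_tensor_def evaluation_def multilinear_form_def e_def
        f.span_singleton)
  have z: "tensor_rep {} sc V \<rho> u T = 0" if "T \<in> tensor_space {} sc V" for T u
    using that unfolding ts
    by (auto simp: tensor_rep_def fscale_def fun_eq_iff e_def)
  show "T \<in> tensor_space {} sc V \<Longrightarrow> T' \<in> tensor_space {} sc V \<Longrightarrow> T + T' \<in> tensor_space {} sc V"
    "T \<in> tensor_space {} sc V \<Longrightarrow> fscale c T \<in> tensor_space {} sc V"
    by (auto simp: tensor_space_def intro: f.span_add f.span_scale)
  show "T \<in> tensor_space {} sc V \<Longrightarrow> tensor_rep {} sc V \<rho> u T \<in> tensor_space {} sc V"
    by (simp add: z) (simp add: tensor_space_def f.span_zero)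
  have "bij_betw (\<lambda>T. T (\<lambda>_. 1)) (tensor_space {} sc V) UNIV"
    unfolding ts by (auto simp: bij_betw_def inj_on_def fscale_def e_def image_image)
  then show "rep_iso L fscale (tensor_space {} sc V) (\<lambda>u. tensor_rep {} sc V \<rho> (h u)) (*) (UNIV :: 'k set) (\<lambda>u v. 0)"
    unfolding rep_iso_def
    by (intro exI[of _ "\<lambda>T. T (\<lambda>_. 1)"]) (auto simp: fscale_def z)
qed


section \<open>Equivariant map algebras\<close>

text \<open>
  The unit of \<open>A\<close> is a parameter rather than the one of class \<open>comm_ring_1\<close>, which would
  exclude the zero algebra (the empty scheme). The actions of \<open>\<Gamma>\<close> on \<open>A\<close> and on the scheme
  \<open>X = Spec A\<close> determine each other; the former is taken as the datum.
\<close>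

locale equivariant_map_algebra =
  group \<Gamma> + A: vector_space scA + g: vector_space scg +
  actA: group_action \<Gamma> UNIV actA + actg: group_action \<Gamma> UNIV actg
  for \<Gamma> :: "'c monoid"
    and scA :: "'k::{alg_closed_field,field_char_0} \<Rightarrow> 'a::comm_ring \<Rightarrow> 'a" and unitA :: 'a
    and scg :: "'k \<Rightarrow> 'g::ab_group_add \<Rightarrow> 'g" and br :: "'g \<Rightarrow> 'g \<Rightarrow> 'g"
    and actA :: "'c \<Rightarrow> 'a \<Rightarrow> 'a" and actg :: "'c \<Rightarrow> 'g \<Rightarrow> 'g" +
  assumes finite_group: "finite (carrier \<Gamma>)"
    and unitA: "unitA * f = f"
    and scA_mult: "scA c f * h = scA c (f * h)"
    and finite_dim: "\<exists>B. finite_dimensional_vector_space scg B"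
    and br_linear_left: "Vector_Spaces.linear scg scg (\<lambda>u. br u v)"
    and br_linear_right: "Vector_Spaces.linear scg scg (br u)"
    and br_alternating: "br u u = 0"
    and jacobi: "br u (br v w) + br v (br w u) + br w (br u v) = 0"
    and actA_linear: "\<gamma> \<in> carrier \<Gamma> \<Longrightarrow> Vector_Spaces.linear scA scA (actA \<gamma>)"
    and actA_mult: "\<gamma> \<in> carrier \<Gamma> \<Longrightarrow> actA \<gamma> (f * h) = actA \<gamma> f * actA \<gamma> h"
    and actg_linear: "\<gamma> \<in> carrier \<Gamma> \<Longrightarrow> Vector_Spaces.linear scg scg (actg \<gamma>)"
    and actg_br: "\<gamma> \<in> carrier \<Gamma> \<Longrightarrow> actg \<gamma> (br u v) = br (actg \<gamma> u) (actg \<gamma> v)"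
begin

subsection \<open>The Lie algebra \<open>(\<gg> \<otimes> A)\<^sup>\<Gamma>\<close>\<close>

definition bilinear_form :: "('g \<times> 'a \<Rightarrow> 'k) \<Rightarrow> bool" where
  "bilinear_form B \<longleftrightarrow>
     (\<forall>u. Vector_Spaces.linear scA (*) (\<lambda>f. B (u, f))) \<and>
     (\<forall>f. Vector_Spaces.linear scg (*) (\<lambda>u. B (u, f)))"

definition tens :: "'g \<Rightarrow> 'a \<Rightarrow> ('g \<times> 'a \<Rightarrow> 'k) \<Rightarrow> 'k" where
  "tens u f = evaluation bilinear_form (u, f)"

definition gA :: "(('g \<times> 'a \<Rightarrow> 'k) \<Rightarrow> 'k) set" where
  "gA = module.span fscale {tens u f | u f. True}"

text \<open>
  The bracket and the diagonal action on \<open>\<gg> \<otimes> A\<close>; see \<open>brA_tens\<close> and \<open>actgA_tens\<close> below.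
\<close>

definition brA ::
  "(('g \<times> 'a \<Rightarrow> 'k) \<Rightarrow> 'k) \<Rightarrow> (('g \<times> 'a \<Rightarrow> 'k) \<Rightarrow> 'k) \<Rightarrow> ('g \<times> 'a \<Rightarrow> 'k) \<Rightarrow> 'k" where
  "brA \<alpha> \<beta> =
     (\<lambda>B. if bilinear_form B then \<alpha> (\<lambda>(u, f). \<beta> (\<lambda>(v, h). B (br u v, f * h))) else 0)"

definition actgA :: "'c \<Rightarrow> (('g \<times> 'a \<Rightarrow> 'k) \<Rightarrow> 'k) \<Rightarrow> ('g \<times> 'a \<Rightarrow> 'k) \<Rightarrow> 'k" where
  "actgA \<gamma> \<alpha> = (\<lambda>B. if bilinear_form B then \<alpha> (\<lambda>(u, f). B (actg \<gamma> u, actA \<gamma> f)) else 0)"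

definition MM :: "(('g \<times> 'a \<Rightarrow> 'k) \<Rightarrow> 'k) set" where
  "MM = {\<alpha> \<in> gA. \<forall>\<gamma>\<in>carrier \<Gamma>. actgA \<gamma> \<alpha> = \<alpha>}"

subsection \<open>Rational points and evaluation\<close>

text \<open>A \<open>k\<close>-rational point \<open>x\<close> of \<open>Spec A\<close> is the \<open>k\<close>-algebra homomorphism \<open>f \<mapsto> f(x)\<close>.\<close>

definition X_rat :: "('a \<Rightarrow> 'k) set" where
  "X_rat = {x. Vector_Spaces.linear scA (*) x \<and> (\<forall>f h. x (f * h) = x f * x h) \<and> x unitA = 1}"

text \<open>From \<open>\<gamma> \<cdot> f = f \<circ> \<gamma>\<^sup>-\<^sup>1\<close> one gets \<open>f(\<gamma> \<cdot> x) = (\<gamma>\<^sup>-\<^sup>1 \<cdot> f)(x)\<close>.\<close>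

definition actX :: "'c \<Rightarrow> ('a \<Rightarrow> 'k) \<Rightarrow> 'a \<Rightarrow> 'k" where
  "actX \<gamma> x = (\<lambda>f. x (actA (inv\<^bsub>\<Gamma>\<^esub> \<gamma>) f))"

definition gfix :: "('a \<Rightarrow> 'k) \<Rightarrow> 'g set" where
  "gfix x = {u. \<forall>\<gamma>\<in>stabilizer \<Gamma> actX x. actg \<gamma> u = u}"

definition ev_at :: "('a \<Rightarrow> 'k) \<Rightarrow> (('g \<times> 'a \<Rightarrow> 'k) \<Rightarrow> 'k) \<Rightarrow> 'g" where
  "ev_at x \<alpha> =
     (THE w. \<exists>ps. \<alpha> = (\<Sum>(u, f)\<leftarrow>ps. tens u f) \<and> w = (\<Sum>(u, f)\<leftarrow>ps. scg (x f) u))"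

definition ev :: "('a \<Rightarrow> 'k) set \<Rightarrow> (('g \<times> 'a \<Rightarrow> 'k) \<Rightarrow> 'k) \<Rightarrow> ('a \<Rightarrow> 'k) \<Rightarrow> 'g" where
  "ev xs \<alpha> = (\<lambda>x\<in>xs. ev_at x \<alpha>)"

text \<open>The underlying space of the following representation is \<open>tensor_space xs sc V\<close>.\<close>

definition ev_rep ::
  "('a \<Rightarrow> 'k) set \<Rightarrow> ('k \<Rightarrow> 'v::ab_group_add \<Rightarrow> 'v) \<Rightarrow> (('a \<Rightarrow> 'k) \<Rightarrow> 'v set) \<Rightarrow>
   (('a \<Rightarrow> 'k) \<Rightarrow> 'g \<Rightarrow> 'v \<Rightarrow> 'v) \<Rightarrow>
   (('g \<times> 'a \<Rightarrow> 'k) \<Rightarrow> 'k) \<Rightarrow> (((('a \<Rightarrow> 'k) \<Rightarrow> 'v) \<Rightarrow> 'k) \<Rightarrow> 'k) \<Rightarrow> ((('a \<Rightarrow> 'k) \<Rightarrow> 'v) \<Rightarrow> 'k) \<Rightarrow> 'k" where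
  "ev_rep xs sc V \<rho> \<alpha> = tensor_rep xs sc V \<rho> (ev xs \<alpha>)"

subsection \<open>The map \<open>\<Psi> \<mapsto> ev\<^sub>\<Psi>\<close>\<close>

definition RR :: "('a \<Rightarrow> 'k) \<Rightarrow> ('g, 'k) rep set set" where
  "RR x = irr_classes scg br (gfix x)"

text \<open>
  \<open>[\<rho>] \<mapsto> [\<rho> \<circ> \<gamma>\<^sup>-\<^sup>1]\<close>. The elementwise image of an isomorphism class over \<open>gfix x\<close> is already
  a whole isomorphism class over \<open>gfix (actX \<gamma> x)\<close>; see \<open>act_class_iso_class\<close> below.
\<close>

definition act_class :: "'c \<Rightarrow> ('g, 'k) rep set \<Rightarrow> ('g, 'k) rep set" where
  "act_class \<gamma> c = (\<lambda>(V, \<rho>). (V, \<lambda>u. \<rho> (actg (inv\<^bsub>\<Gamma>\<^esub> \<gamma>) u))) ` c"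

definition supp :: "(('a \<Rightarrow> 'k) \<Rightarrow> ('g, 'k) rep set) \<Rightarrow> ('a \<Rightarrow> 'k) set" where
  "supp \<Psi> = {x \<in> X_rat. \<Psi> x \<noteq> trivial_class scg br (gfix x)}"

text \<open>
  A function from \<open>X_rat\<close> to the disjoint union of the \<open>RR x\<close> with \<open>\<Psi>(x) \<in> RR x\<close> is a
  dependent function.
\<close>

definition EE :: "(('a \<Rightarrow> 'k) \<Rightarrow> ('g, 'k) rep set) set" where
  "EE = {\<Psi> \<in> Pi\<^sub>E X_rat RR. finite (supp \<Psi>) \<and>
           (\<forall>\<gamma>\<in>carrier \<Gamma>. \<forall>x\<in>X_rat. \<Psi> (actX \<gamma> x) = act_class \<gamma> (\<Psi> x))}"

definition SS :: "((('g \<times> 'a \<Rightarrow> 'k) \<Rightarrow> 'k), 'k) rep set set" where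
  "SS = irr_classes fscale brA MM"

definition orbit_transversal :: "('a \<Rightarrow> 'k) set \<Rightarrow> ('a \<Rightarrow> 'k) set \<Rightarrow> bool" where
  "orbit_transversal Y xs \<longleftrightarrow> xs \<subseteq> Y \<and> (\<forall>x\<in>Y. \<exists>!y. y \<in> xs \<and> y \<in> orbit \<Gamma> actX x)"

text \<open>
  If the support is empty then so is \<open>xs\<close>, and the empty tensor product is the one-dimensional
  trivial representation; see \<open>ev_class_empty\<close> below.
\<close>

definition ev_class ::
  "(('a \<Rightarrow> 'k) \<Rightarrow> ('g, 'k) rep set) \<Rightarrow> ((('g \<times> 'a \<Rightarrow> 'k) \<Rightarrow> 'k), 'k) rep set" where
  "ev_class \<Psi> =
     (let xs = (SOME xs. orbit_transversal (supp \<Psi>) xs);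
          V = (\<lambda>x. fst (SOME r. r \<in> \<Psi> x));
          \<rho> = (\<lambda>x. snd (SOME r. r \<in> \<Psi> x))
      in iso_class fscale brA MM fscale (tensor_space xs fscale V) (ev_rep xs fscale V \<rho>))"

subsection \<open>Sanity checks\<close>

lemma br_bilinear:
  "br (u + u') v = br u v + br u' v" "br u (v + v') = br u v + br u v'"
  "br (scg c u) v = scg c (br u v)" "br u (scg c v) = scg c (br u v)"
proof -
  interpret l: Vector_Spaces.linear scg scg "\<lambda>u. br u v" by (rule br_linear_left)
  interpret r: Vector_Spaces.linear scg scg "br u" by (rule br_linear_right)
  show "br (u + u') v = br u v + br u' v" "br u (v + v') = br u v + br u v'"
    "br (scg c u) v = scg c (br u v)" "br u (scg c v) = scg c (br u v)"
    by (simp_all add: l.add l.scale r.add r.scale)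
qed

lemma bilinear_formI:
  assumes "\<And>u f f'. B (u, f + f') = B (u, f) + B (u, f')" "\<And>u c f. B (u, scA c f) = c * B (u, f)"
    "\<And>u u' f. B (u + u', f) = B (u, f) + B (u', f)" "\<And>u c f. B (scg c u, f) = c * B (u, f)"
  shows "bilinear_form B"
proof -
  show ?thesis unfolding bilinear_form_def
    by (auto intro!: linear_intro A.vector_space_axioms g.vector_space_axioms vector_space_mult simp: assms)
qed

lemma bilinear_formD:
  assumes "bilinear_form B"
  shows "B (u, f + f') = B (u, f) + B (u, f')" "B (u, scA c f) = c * B (u, f)"
    "B (u + u', f) = B (u, f) + B (u', f)" "B (scg c u, f) = c * B (u, f)"
proof -
  interpret l: Vector_Spaces.linear scA "(*)" "\<lambda>f. B (u, f)" using assms by (simp add: bilinear_form_def)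
  interpret r: Vector_Spaces.linear scg "(*)" "\<lambda>u. B (u, f)" using assms by (simp add: bilinear_form_def)
  show "B (u, f + f') = B (u, f) + B (u, f')" "B (u, scA c f) = c * B (u, f)"
    "B (u + u', f) = B (u, f) + B (u', f)" "B (scg c u, f) = c * B (u, f)"
    by (simp_all add: l.add l.scale r.add r.scale)
qed

lemma tens_bilinear:
  "tens u (f + f') = tens u f + tens u f'" "tens u (scA c f) = fscale c (tens u f)"
  "tens (u + u') f = tens u f + tens u' f" "tens (scg c u) f = fscale c (tens u f)"
  by (auto simp: tens_def evaluation_def fun_eq_iff fscale_def bilinear_formD)

lemma tens_universal:
  fixes sW :: "'k \<Rightarrow> 'w::ab_group_add \<Rightarrow> 'w"
  assumes W: "vector_space sW"
    and \<beta>1: "\<And>u. Vector_Spaces.linear scA sW (\<beta> u)"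
    and \<beta>2: "\<And>f. Vector_Spaces.linear scg sW (\<lambda>u. \<beta> u f)"
  shows "\<exists>F. Vector_Spaces.linear fscale sW F \<and> (\<forall>u f. F (tens u f) = \<beta> u f)"
proof -
  have "\<exists>F. Vector_Spaces.linear fscale sW F \<and>
          (\<forall>p\<in>UNIV. F (evaluation bilinear_form p) = (\<lambda>(u, f). \<beta> u f) p)"
  proof (rule evaluation_lift[OF W])
    fix \<phi> :: "'w \<Rightarrow> 'k" assume \<phi>: "Vector_Spaces.linear sW (*) \<phi>"
    interpret \<phi>: Vector_Spaces.linear sW "(*)" \<phi> by (rule \<phi>)
    have "\<beta> u (f + f') = \<beta> u f + \<beta> u f'" "\<beta> u (scA c f) = sW c (\<beta> u f)"
      "\<beta> (u + u') f = \<beta> u f + \<beta> u' f" "\<beta> (scg c u) f = sW c (\<beta> u f)" for u u' f f' c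
    proof -
      interpret l: Vector_Spaces.linear scA sW "\<beta> u" by (rule \<beta>1)
      interpret r: Vector_Spaces.linear scg sW "\<lambda>u. \<beta> u f" by (rule \<beta>2)
      show "\<beta> u (f + f') = \<beta> u f + \<beta> u f'" "\<beta> u (scA c f) = sW c (\<beta> u f)"
        "\<beta> (u + u') f = \<beta> u f + \<beta> u' f" "\<beta> (scg c u) f = sW c (\<beta> u f)"
        by (simp_all add: l.add l.scale r.add r.scale)
    qed
    then show "bilinear_form (\<lambda>p. \<phi> (case p of (u, f) \<Rightarrow> \<beta> u f))"
      by (intro bilinear_formI) (simp_all add: \<phi>.add \<phi>.scale)
  qed
  then show ?thesis by (auto simp: tens_def)
qed

lemma ev_at_sum:
  assumes x: "x \<in> X_rat"
  shows "ev_at x (\<Sum>(u, f)\<leftarrow>ps. tens u f) = (\<Sum>(u, f)\<leftarrow>ps. scg (x f) u)"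
proof -
  interpret x: Vector_Spaces.linear scA "(*)" x using x by (simp add: X_rat_def)
  have "\<exists>F. Vector_Spaces.linear fscale scg F \<and> (\<forall>u f. F (tens u f) = scg (x f) u)"
    by (rule tens_universal)
       (auto intro!: linear_intro A.vector_space_axioms g.vector_space_axioms
             simp: x.add x.scale algebra_simps g.scale_left_distrib g.scale_right_distrib)
  then obtain F where F: "Vector_Spaces.linear fscale scg F" "\<And>u f. F (tens u f) = scg (x f) u"
    by blast
  interpret F: Vector_Spaces.linear fscale scg F by (rule F(1))
  have *: "F (\<Sum>(u, f)\<leftarrow>ps. tens u f) = (\<Sum>(u, f)\<leftarrow>ps. scg (x f) u)" for ps
  proof (induction ps)
    case Nil
    show ?case unfolding list.map sum_list.Nil F.zero ..
  next
    case (Cons p ps)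
    obtain u f where p: "p = (u, f)" by (cases p)
    show ?case
      unfolding p list.map sum_list.Cons split_conv F.add Cons.IH F(2) ..
  qed
  show ?thesis unfolding ev_at_def
    by (rule the_equality) (auto simp flip: *)
qed

lemma gA_linear:
  assumes "\<alpha> \<in> gA" "bilinear_form B" "bilinear_form B'"
  shows "\<alpha> (B + B') = \<alpha> B + \<alpha> B'" "\<alpha> (fscale c B) = c * \<alpha> B"
proof -
  interpret f: vector_space "fscale :: 'k \<Rightarrow> (('g \<times> 'a \<Rightarrow> 'k) \<Rightarrow> 'k) \<Rightarrow> _" by (rule vector_space_fscale)
  have bil: "bilinear_form (B + B')" "bilinear_form (fscale c B)"
    using assms(2,3) by (auto intro!: bilinear_formI simp: bilinear_formD fscale_def algebra_simps)
  note bil' = bil[unfolded plus_fun_def fscale_def]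
  have "\<alpha> (B + B') = \<alpha> B + \<alpha> B' \<and> \<alpha> (fscale c B) = c * \<alpha> B"
    using assms(1) unfolding gA_def
  proof (induction rule: f.span_induct_alt)
    case base
    then show ?case by simp
  next
    case (step d y \<beta>)
    then obtain u f where "y = tens u f" by blast
    with step bil bil' assms(2,3) show ?case
      by (auto simp: fscale_def tens_def evaluation_def algebra_simps)
  qed
  then show "\<alpha> (B + B') = \<alpha> B + \<alpha> B'" "\<alpha> (fscale c B) = c * \<alpha> B" by auto
qed

lemma gA_bilinear_br:
  assumes \<beta>: "\<beta> \<in> gA" and B: "bilinear_form B"
  shows "bilinear_form (\<lambda>(v, h). B (br u v, f * h))"
    and "bilinear_form (\<lambda>(u, f). \<beta> (\<lambda>(v, h). B (br u v, f * h)))"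
proof -
  have mult: "f * scA c h = scA c (f * h)" "scA c h * f = scA c (h * f)" for f h c
    by (metis mult.commute scA_mult)+
  show 1: "bilinear_form (\<lambda>(v, h). B (br u v, f * h))" for u f
    by (rule bilinear_formI) (simp_all add: mult br_bilinear bilinear_formD[OF B] distrib_left)
  note lin = gA_linear[OF \<beta> 1 1, unfolded plus_fun_def fscale_def split_def]
  show "bilinear_form (\<lambda>(u, f). \<beta> (\<lambda>(v, h). B (br u v, f * h)))"
    by (rule bilinear_formI)
       (simp_all add: lin mult br_bilinear bilinear_formD[OF B] distrib_right split_def)
qed

lemma brA_bilinear:
  assumes "\<alpha> \<in> gA" "\<beta> \<in> gA" "\<beta>' \<in> gA"
  shows "brA (\<alpha> + \<alpha>') \<beta> = brA \<alpha> \<beta> + brA \<alpha>' \<beta>" "brA (fscale c \<alpha>) \<beta> = fscale c (brA \<alpha> \<beta>)"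
    "brA \<alpha> (\<beta> + \<beta>') = brA \<alpha> \<beta> + brA \<alpha> \<beta>'" "brA \<alpha> (fscale c \<beta>) = fscale c (brA \<alpha> \<beta>)"
proof -
  show "brA (\<alpha> + \<alpha>') \<beta> = brA \<alpha> \<beta> + brA \<alpha>' \<beta>" "brA (fscale c \<alpha>) \<beta> = fscale c (brA \<alpha> \<beta>)"
    by (auto simp: brA_def fscale_def fun_eq_iff)
  note lin = gA_linear[OF assms(1) gA_bilinear_br(2) gA_bilinear_br(2),
      unfolded plus_fun_def fscale_def split_def]
  show "brA \<alpha> (\<beta> + \<beta>') = brA \<alpha> \<beta> + brA \<alpha> \<beta>'" "brA \<alpha> (fscale c \<beta>) = fscale c (brA \<alpha> \<beta>)"
    using assms by (auto simp: brA_def fscale_def fun_eq_iff split_def lin[symmetric])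
qed

lemma brA_tens: "brA (tens u f) (tens v h) = tens (br u v) (f * h)"
proof
  fix B
  interpret f: vector_space "fscale :: 'k \<Rightarrow> (('g \<times> 'a \<Rightarrow> 'k) \<Rightarrow> 'k) \<Rightarrow> _" by (rule vector_space_fscale)
  have "tens v h \<in> gA" unfolding gA_def
    by (rule f.span_base, rule CollectI, rule exI[of _ v], rule exI[of _ h]) simp
  note bil = gA_bilinear_br[OF this, of B]
  show "brA (tens u f) (tens v h) B = tens (br u v) (f * h) B"
  proof (cases "bilinear_form B")
    case True
    have "brA (tens u f) (tens v h) B = tens v h (\<lambda>(v, h). B (br u v, f * h))"
      using True bil(2)[OF True] by (simp add: brA_def tens_def[of u f] evaluation_def)
    also have "\<dots> = B (br u v, f * h)"
      using bil(1)[OF True, of u f] by (simp add: tens_def evaluation_def)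
    finally show ?thesis using True by (simp add: tens_def evaluation_def)
  next
    case False
    then show ?thesis by (simp add: brA_def tens_def evaluation_def)
  qed
qed

lemma actgA_linear:
  "actgA \<gamma> (\<alpha> + \<beta>) = actgA \<gamma> \<alpha> + actgA \<gamma> \<beta>" "actgA \<gamma> (fscale c \<alpha>) = fscale c (actgA \<gamma> \<alpha>)"
  by (auto simp: actgA_def fscale_def fun_eq_iff)

lemma actgA_tens:
  assumes "\<gamma> \<in> carrier \<Gamma>"
  shows "actgA \<gamma> (tens u f) = tens (actg \<gamma> u) (actA \<gamma> f)"
proof -
  interpret a: Vector_Spaces.linear scA scA "actA \<gamma>" by (rule actA_linear) fact
  interpret b: Vector_Spaces.linear scg scg "actg \<gamma>" by (rule actg_linear) fact
  have "bilinear_form (\<lambda>(u, f). B (actg \<gamma> u, actA \<gamma> f))" if "bilinear_form B" for B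
    by (rule bilinear_formI) (simp_all add: a.add a.scale b.add b.scale bilinear_formD[OF that])
  then show ?thesis by (auto simp: actgA_def tens_def evaluation_def fun_eq_iff)
qed

lemma actg_inv:
  assumes "\<gamma> \<in> carrier \<Gamma>"
  shows "actg \<gamma> (actg (inv\<^bsub>\<Gamma>\<^esub> \<gamma>) u) = u" "actg (inv\<^bsub>\<Gamma>\<^esub> \<gamma>) (actg \<gamma> u) = u"
  using assms actg.orbit_sym_aux[of \<gamma> u "actg \<gamma> u"] actg.orbit_sym_aux[of "inv\<^bsub>\<Gamma>\<^esub> \<gamma>" u "actg (inv\<^bsub>\<Gamma>\<^esub> \<gamma>) u"]
  by auto

lemma actX_actX:
  assumes "\<gamma> \<in> carrier \<Gamma>" "\<delta> \<in> carrier \<Gamma>"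
  shows "actX \<gamma> (actX \<delta> x) = actX (\<gamma> \<otimes>\<^bsub>\<Gamma>\<^esub> \<delta>) x"
  using assms by (simp add: actX_def inv_mult_group actA.composition_rule)

lemma actX_inv:
  assumes "\<gamma> \<in> carrier \<Gamma>"
  shows "actX \<gamma> (actX (inv\<^bsub>\<Gamma>\<^esub> \<gamma>) x) = x" "actX (inv\<^bsub>\<Gamma>\<^esub> \<gamma>) (actX \<gamma> x) = x"
proof -
  have "actX \<one>\<^bsub>\<Gamma>\<^esub> x = x"
    using actA.id_eq_one by (auto simp: actX_def fun_eq_iff restrict_def)
  then show "actX \<gamma> (actX (inv\<^bsub>\<Gamma>\<^esub> \<gamma>) x) = x" "actX (inv\<^bsub>\<Gamma>\<^esub> \<gamma>) (actX \<gamma> x) = x"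
    using assms by (simp_all add: actX_actX)
qed

lemma actg_gfix:
  assumes "\<gamma> \<in> carrier \<Gamma>" "u \<in> gfix x"
  shows "actg \<gamma> u \<in> gfix (actX \<gamma> x)"
  unfolding gfix_def
proof (intro CollectI ballI)
  fix \<delta> assume "\<delta> \<in> stabilizer \<Gamma> actX (actX \<gamma> x)"
  then have \<delta>: "\<delta> \<in> carrier \<Gamma>" "actX \<delta> (actX \<gamma> x) = actX \<gamma> x" by (auto simp: stabilizer_def)
  let ?e = "inv\<^bsub>\<Gamma>\<^esub> \<gamma> \<otimes>\<^bsub>\<Gamma>\<^esub> (\<delta> \<otimes>\<^bsub>\<Gamma>\<^esub> \<gamma>)"
  have "actX ?e x = x"
    using assms(1) \<delta> by (simp add: actX_actX[symmetric] actX_inv)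
  then have "?e \<in> stabilizer \<Gamma> actX x" using assms(1) \<delta>(1) by (simp add: stabilizer_def)
  then have "actg ?e u = u" using assms(2) by (auto simp: gfix_def)
  then have "actg \<gamma> (actg (inv\<^bsub>\<Gamma>\<^esub> \<gamma>) (actg \<delta> (actg \<gamma> u))) = actg \<gamma> u"
    using assms(1) \<delta>(1) by (simp add: actg.composition_rule)
  then show "actg \<delta> (actg \<gamma> u) = actg \<gamma> u" using assms(1) by (simp add: actg_inv)
qed

lemma lie_rep_twist:
  assumes \<gamma>: "\<gamma> \<in> carrier \<Gamma>" and rep: "lie_rep scg br (gfix x) sc V \<rho>"
  shows "lie_rep scg br (gfix (actX \<gamma> x)) sc V (\<lambda>u. \<rho> (actg (inv\<^bsub>\<Gamma>\<^esub> \<gamma>) u))"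
proof -
  have \<gamma>': "inv\<^bsub>\<Gamma>\<^esub> \<gamma> \<in> carrier \<Gamma>" using \<gamma> by simp
  interpret b: Vector_Spaces.linear scg scg "actg (inv\<^bsub>\<Gamma>\<^esub> \<gamma>)" by (rule actg_linear[OF \<gamma>'])
  have "actg (inv\<^bsub>\<Gamma>\<^esub> \<gamma>) u \<in> gfix x" if "u \<in> gfix (actX \<gamma> x)" for u
    using actg_gfix[OF \<gamma>' that] by (simp add: actX_inv \<gamma>)
  with rep show ?thesis
    by (simp add: lie_rep_def b.add b.scale actg_br[OF \<gamma>'])
qed

lemma act_class_iso_class:
  assumes \<gamma>: "\<gamma> \<in> carrier \<Gamma>"
  shows "act_class \<gamma> (iso_class scg br (gfix x) sc V \<rho>) =
         iso_class scg br (gfix (actX \<gamma> x)) sc V (\<lambda>u. \<rho> (actg (inv\<^bsub>\<Gamma>\<^esub> \<gamma>) u))"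
proof -
  have twist: "(W, \<lambda>u. \<sigma> (actg (inv\<^bsub>\<Gamma>\<^esub> \<gamma>) u)) \<in>
      iso_class scg br (gfix (actX \<gamma> x)) sc V (\<lambda>u. \<rho> (actg (inv\<^bsub>\<Gamma>\<^esub> \<gamma>) u))"
    if "(W, \<sigma>) \<in> iso_class scg br (gfix x) sc V \<rho>" "\<gamma> \<in> carrier \<Gamma>" for W \<sigma> \<gamma> x \<rho>
  proof -
    have "actg (inv\<^bsub>\<Gamma>\<^esub> \<gamma>) u \<in> gfix x" if "u \<in> gfix (actX \<gamma> x)" for u
      using actg_gfix[of "inv\<^bsub>\<Gamma>\<^esub> \<gamma>", OF _ that] \<open>\<gamma> \<in> carrier \<Gamma>\<close> by (simp add: actX_inv)
    note pull = this
    from that(1) obtain \<phi> where \<phi>: "bij_betw \<phi> V W"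
      "\<forall>v\<in>V. \<forall>w\<in>V. \<phi> (v + w) = \<phi> v + \<phi> w" "\<forall>c. \<forall>v\<in>V. \<phi> (sc c v) = fscale c (\<phi> v)"
      "\<forall>u\<in>gfix x. \<forall>v\<in>V. \<phi> (\<rho> u v) = \<sigma> u (\<phi> v)"
      unfolding iso_class_def rep_iso_def by blast
    have "rep_iso (gfix (actX \<gamma> x)) sc V (\<lambda>u. \<rho> (actg (inv\<^bsub>\<Gamma>\<^esub> \<gamma>) u)) fscale W (\<lambda>u. \<sigma> (actg (inv\<^bsub>\<Gamma>\<^esub> \<gamma>) u))"
      unfolding rep_iso_def by (rule exI[of _ \<phi>]) (use \<phi> pull in simp)
    moreover have "(W, \<lambda>u. \<sigma> (actg (inv\<^bsub>\<Gamma>\<^esub> \<gamma>) u)) \<in> fd_reps scg br (gfix (actX \<gamma> x))"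
      using that lie_rep_twist[of \<gamma> x fscale W \<sigma>] by (simp add: iso_class_def fd_reps_def)
    ultimately show ?thesis by (simp add: iso_class_def)
  qed
  show ?thesis
  proof (intro equalityI subsetI)
    fix r assume "r \<in> act_class \<gamma> (iso_class scg br (gfix x) sc V \<rho>)"
    then show "r \<in> iso_class scg br (gfix (actX \<gamma> x)) sc V (\<lambda>u. \<rho> (actg (inv\<^bsub>\<Gamma>\<^esub> \<gamma>) u))"
      using twist[OF _ \<gamma>] by (auto simp: act_class_def)
  next
    fix r assume r: "r \<in> iso_class scg br (gfix (actX \<gamma> x)) sc V (\<lambda>u. \<rho> (actg (inv\<^bsub>\<Gamma>\<^esub> \<gamma>) u))"
    obtain W \<sigma> where [simp]: "r = (W, \<sigma>)" by (cases r)
    have "(W, \<lambda>u. \<sigma> (actg \<gamma> u)) \<in> iso_class scg br (gfix x) sc V \<rho>"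
      using twist[of W \<sigma> "actX \<gamma> x" "\<lambda>u. \<rho> (actg (inv\<^bsub>\<Gamma>\<^esub> \<gamma>) u)" "inv\<^bsub>\<Gamma>\<^esub> \<gamma>"] r \<gamma>
      by (simp add: actX_inv actg_inv)
    then show "r \<in> act_class \<gamma> (iso_class scg br (gfix x) sc V \<rho>)"
      unfolding act_class_def using \<gamma> by (force simp: actg_inv)
  qed
qed

lemma ev_class_empty:
  assumes "supp \<Psi> = {}"
  shows "ev_class \<Psi> = trivial_class fscale brA MM"
proof -
  have xs: "(SOME xs. orbit_transversal {} xs) = {}"
    by (rule some_equality) (auto simp: orbit_transversal_def)
  show ?thesis
    unfolding ev_class_def assms xs Let_def trivial_class_def ev_rep_def
    by (rule iso_class_cong[OF tensor_rep_empty(1)]) (auto simp: tensor_rep_empty)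
qed

end

end

theory Submission
  imports Defs
begin

text \<open>
  The proof rests on two surjectivity statements. First, \<open>\<MM>\<close> separates orbits: if \<open>f \<in> A\<close> has the
  value \<open>1\<close> at \<open>x\<close> and vanishes at the finitely many other points that matter, then the sum of
  \<open>\<gamma>u \<otimes> \<gamma>f\<close> over \<open>\<Gamma>\<close> is equivariant, vanishes at prescribed points outside the orbit of \<open>x\<close> and, for
  \<open>u \<in> \<gg>\<^sup>x\<close>, has at \<open>x\<close> the value \<open>u\<close> times the order of the stabilizer, which is invertible in
  characteristic zero (\<open>equivariant_interpolation\<close>). So \<open>\<MM>\<close> maps onto the direct sum of the
  \<open>\<gg>\<^sup>x\<close> for points \<open>x\<close> in different orbits. Second, over an algebraically closed field an
  irreducible algebra of operators on a finite-dimensional space contains all operators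
  (\<open>burnside\<close>). A subspace of a tensor product of irreducible representations that is stable under the
  direct sum of the Lie algebras is therefore stable under all operators on single factors, and
  projections onto basis vectors show that it is zero or everything (\<open>irreducible_tensor\<close>). Together
  these say that the representation attached to \<open>\<Psi>\<close> is irreducible.

  For injectivity, \<open>\<Psi>(x)\<close> is recovered from this representation, on \<open>T\<close> say, as follows. Given a
  second function \<open>\<Psi>'\<close> with the representation space \<open>T'\<close>, consider the \<open>\<alpha> \<in> \<MM>\<close> that vanish at all points
  used for \<open>\<Psi>\<close> or \<open>\<Psi>'\<close> outside the orbit of \<open>x\<close>. Their values at \<open>x\<close> still exhaust
  \<open>\<gg>\<^sup>x\<close>, and they act on \<open>T\<close> only through the factor over the orbit of \<open>x\<close>, if there is one; otherwise they act by
  zero, and \<open>\<Psi>(x)\<close> is trivial. In both cases \<open>T\<close> has \<open>\<Psi>(x)\<close> as a quotient with respect to these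
  \<open>\<alpha>\<close> (\<open>local_quotient\<close>), and \<open>T'\<close> is spanned by images of \<open>\<Psi>'(x)\<close> (\<open>local_insertion\<close>). An isomorphism
  of \<open>T'\<close> with \<open>T\<close>, restricted to a suitable image of \<open>\<Psi>'(x)\<close> and followed by the quotient map, is a
  nonzero homomorphism from \<open>\<Psi>'(x)\<close> to \<open>\<Psi>(x)\<close>, and Schur's lemma applies.
\<close>


section \<open>Linear maps between subspaces\<close>

text \<open>
  Representation spaces are subspaces of a type, and a map has prescribed values only there, so
  linearity can be asked for only on the subspace.
\<close>

definition linear_between ::
  "('k::field \<Rightarrow> 'v::ab_group_add \<Rightarrow> 'v) \<Rightarrow> 'v set \<Rightarrow> ('k \<Rightarrow> 'w::ab_group_add \<Rightarrow> 'w) \<Rightarrow> 'w set \<Rightarrow>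
   ('v \<Rightarrow> 'w) \<Rightarrow> bool" where
  "linear_between sc V sc' W f \<longleftrightarrow> f \<in> V \<rightarrow> W \<and>
     (\<forall>v\<in>V. \<forall>w\<in>V. f (v + w) = f v + f w) \<and> (\<forall>c. \<forall>v\<in>V. f (sc c v) = sc' c (f v))"

lemma linear_betweenI:
  assumes "\<And>v. v \<in> V \<Longrightarrow> f v \<in> W" "\<And>v w. v \<in> V \<Longrightarrow> w \<in> V \<Longrightarrow> f (v + w) = f v + f w"
    "\<And>c v. v \<in> V \<Longrightarrow> f (sc c v) = sc' c (f v)"
  shows "linear_between sc V sc' W f"
  using assms by (auto simp: linear_between_def)

lemma linear_betweenD:
  assumes "linear_between sc V sc' W f"
  shows "v \<in> V \<Longrightarrow> f v \<in> W" "v \<in> V \<Longrightarrow> w \<in> V \<Longrightarrow> f (v + w) = f v + f w"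
    "v \<in> V \<Longrightarrow> f (sc c v) = sc' c (f v)"
  using assms by (auto simp: linear_between_def)

lemma linear_between_comp:
  assumes "linear_between s1 U s2 V f" "linear_between s2 V s3 W g"
  shows "linear_between s1 U s3 W (\<lambda>v. g (f v))"
  using assms by (auto simp: linear_between_def Pi_def)

lemma linear_between_linear:
  assumes "Vector_Spaces.linear sc sc' F" "F ` V \<subseteq> W"
  shows "linear_between sc V sc' W F"
proof -
  interpret Vector_Spaces.linear sc sc' F by (rule assms(1))
  show ?thesis using assms(2) by (auto simp: linear_between_def add scale)
qed

lemma linear_between_zero:
  assumes "linear_between sc V sc' W f" "0 \<in> V"
  shows "f 0 = 0"
  using linear_betweenD(2)[OF assms(1) assms(2) assms(2)] by simp

lemma linear_between_diff:
  assumes "linear_between sc V sc' W f" "v \<in> V" "w \<in> V" "v - w \<in> V"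
  shows "f (v - w) = f v - f w"
  using linear_betweenD(2)[OF assms(1) assms(4) assms(3)] by (simp add: algebra_simps)

lemma linear_between_sum:
  assumes f: "linear_between sc V sc' W f" and V: "vector_space sc" "module.subspace sc V"
    and x: "\<And>i. i \<in> S \<Longrightarrow> x i \<in> V"
  shows "f (\<Sum>i\<in>S. x i) = (\<Sum>i\<in>S. f (x i))"
proof -
  interpret vector_space sc by (rule V(1))
  show ?thesis
  proof (cases "finite S")
    case True
    then show ?thesis using x
    proof induction
      case empty
      show ?case using linear_between_zero[OF f] V(2) by (simp add: subspace_0)
    next
      case (insert i S)
      then show ?case using V(2) by (simp add: linear_betweenD(2)[OF f] subspace_sum)
    qed
  next
    case False
    then show ?thesis using linear_between_zero[OF f] V(2) by (simp add: subspace_0)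
  qed
qed

lemma rep_iso_iff_linear_between:
  "rep_iso L sc V \<rho> sc' W \<sigma> \<longleftrightarrow>
     (\<exists>\<phi>. bij_betw \<phi> V W \<and> linear_between sc V sc' W \<phi> \<and> (\<forall>u\<in>L. \<forall>v\<in>V. \<phi> (\<rho> u v) = \<sigma> u (\<phi> v)))"
  unfolding rep_iso_def linear_between_def by (auto simp: bij_betw_def)

lemma linear_between_inv_into:
  assumes f: "bij_betw f V W" "linear_between sc V sc' W f"
    and V: "vector_space sc" "module.subspace sc V"
  shows "linear_between sc' W sc V (inv_into V f)"
proof -
  interpret vector_space sc by (rule V(1))
  have W: "W = f ` V" and l: "\<And>v. v \<in> V \<Longrightarrow> inv_into V f (f v) = v"
    using f(1) by (auto simp: bij_betw_def)
  show ?thesis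
  proof (rule linear_betweenI)
    fix v w c assume v: "v \<in> W"
    then obtain v' where v': "v' \<in> V" "v = f v'" using W by auto
    then show "inv_into V f v \<in> V" by (simp add: l)
    show "inv_into V f (sc' c v) = sc c (inv_into V f v)"
      using v' l subspace_scale[OF V(2)] linear_betweenD(3)[OF f(2)] by metis
    assume "w \<in> W"
    then obtain w' where w': "w' \<in> V" "w = f w'" using W by auto
    show "inv_into V f (v + w) = inv_into V f v + inv_into V f w"
      using v' w' l subspace_add[OF V(2)] linear_betweenD(2)[OF f(2)] by metis
  qed
qed

lemma (in vector_space) functional_exists:
  assumes "v \<noteq> 0"
  shows "\<exists>\<phi>. Vector_Spaces.linear scale (*) \<phi> \<and> \<phi> v = 1"
proof -
  interpret k: vector_space "(*) :: 'a \<Rightarrow> 'a \<Rightarrow> 'a" by (rule vector_space_mult)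
  interpret vector_space_pair scale "(*) :: 'a \<Rightarrow> 'a \<Rightarrow> 'a" by unfold_locales
  have "independent {v}" using assms by simp
  from linear_independent_extend[OF this, of "\<lambda>_. 1"] show ?thesis by auto
qed


section \<open>Irreducible representations\<close>

lemma lie_repD:
  assumes "lie_rep scL br L sc V \<rho>" "u \<in> L"
  shows "linear_between sc V sc V (\<rho> u)"
    and "t \<in> L \<Longrightarrow> v \<in> V \<Longrightarrow> \<rho> (u + t) v = \<rho> u v + \<rho> t v"
    and "v \<in> V \<Longrightarrow> \<rho> (scL c u) v = sc c (\<rho> u v)"
    and "t \<in> L \<Longrightarrow> v \<in> V \<Longrightarrow> \<rho> (br u t) v = \<rho> u (\<rho> t v) - \<rho> t (\<rho> u v)"
  using assms by (auto simp: lie_rep_def linear_between_def)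

lemma lie_rep_zero:
  assumes "lie_rep scL br L sc V \<rho>" "0 \<in> L" "v \<in> V"
  shows "\<rho> 0 v = 0"
  using lie_repD(2)[OF assms(1,2,2,3)] by simp

text \<open>
  Schur's lemma: kernel and image of a homomorphism of representations are stable, so if it is not zero, the
  kernel is zero and the image is everything.
\<close>

lemma schur_rep_iso:
  assumes V: "vector_space sc" "module.subspace sc V" "\<And>u. u \<in> L \<Longrightarrow> linear_between sc V sc V (\<rho> u)"
      "irreducible_rep L sc V \<rho>"
    and W: "vector_space sc'" "irreducible_rep L sc' W \<sigma>" "module.subspace sc' W"
    and \<phi>: "linear_between sc V sc' W \<phi>" "\<And>u v. u \<in> L \<Longrightarrow> v \<in> V \<Longrightarrow> \<phi> (\<rho> u v) = \<sigma> u (\<phi> v)"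
    and nz: "\<exists>v\<in>V. \<phi> v \<noteq> 0"
  shows "rep_iso L sc V \<rho> sc' W \<sigma>"
proof -
  interpret V: vector_space sc by (rule V(1))
  interpret W: vector_space sc' by (rule W(1))
  have \<phi>0: "\<phi> 0 = 0" using linear_between_zero[OF \<phi>(1) V.subspace_0[OF V(2)]] .
  let ?K = "{v\<in>V. \<phi> v = 0}"
  have "V.subspace ?K"
    using V(2) \<phi>(1) by (auto simp: V.subspace_def linear_between_def \<phi>0)
  moreover have "\<rho> u v \<in> ?K" if "u \<in> L" "v \<in> ?K" for u v
  proof -
    have "\<phi> (\<rho> u v) = \<sigma> u 0" "\<sigma> u 0 = \<phi> (\<rho> u 0)"
      using that \<phi>(2)[of u v] \<phi>(2)[OF that(1) V.subspace_0[OF V(2)]] by (simp_all add: \<phi>0)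
    moreover have "\<rho> u 0 = 0" using V(3)[OF that(1)] V.subspace_0[OF V(2)] by (rule linear_between_zero)
    ultimately show ?thesis using V(3)[OF that(1)] that(2) by (simp add: linear_betweenD \<phi>0)
  qed
  ultimately have "?K = {0} \<or> ?K = V"
    using V(4) unfolding irreducible_rep_def by blast
  with nz have K: "?K = {0}" by auto
  have "inj_on \<phi> V"
  proof (rule inj_onI)
    fix v w assume vw: "v \<in> V" "w \<in> V" "\<phi> v = \<phi> w"
    then have "v - w \<in> V" using V(2) by (simp add: V.subspace_diff)
    then have "v - w \<in> ?K" using vw by (simp add: linear_between_diff[OF \<phi>(1)])
    then show "v = w" unfolding K by simp
  qed
  moreover have "W.subspace (\<phi> ` V)"
  proof (rule W.subspaceI)
    show "0 \<in> \<phi> ` V" using \<phi>0 V.subspace_0[OF V(2)] by force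
    fix x y c assume "x \<in> \<phi> ` V"
    then obtain v where v: "v \<in> V" "x = \<phi> v" by auto
    have "sc' c x = \<phi> (sc c v)" using v linear_betweenD[OF \<phi>(1)] by simp
    then show "sc' c x \<in> \<phi> ` V" using v V.subspace_scale[OF V(2)] by auto
    assume "y \<in> \<phi> ` V"
    then obtain w where w: "w \<in> V" "y = \<phi> w" by auto
    have "x + y = \<phi> (v + w)" using v w linear_betweenD[OF \<phi>(1)] by simp
    then show "x + y \<in> \<phi> ` V" using v w V.subspace_add[OF V(2)] by auto
  qed
  moreover have "\<sigma> u w \<in> \<phi> ` V" if "u \<in> L" "w \<in> \<phi> ` V" for u w
    using that \<phi>(2) linear_betweenD(1)[OF V(3)] by (force simp flip: \<phi>(2))
  ultimately have "\<phi> ` V = W" "inj_on \<phi> V"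
    using W(2) nz linear_betweenD(1)[OF \<phi>(1)] unfolding irreducible_rep_def by blast+
  with \<phi> show ?thesis unfolding rep_iso_iff_linear_between bij_betw_def by blast
qed

lemma irreducible_rep_iso:
  assumes V: "vector_space sc" "module.subspace sc V" "\<And>u. u \<in> L \<Longrightarrow> linear_between sc V sc V (\<rho> u)"
      "irreducible_rep L sc V \<rho>"
    and W: "vector_space sc'"
    and iso: "rep_iso L sc V \<rho> sc' W \<sigma>"
  shows "irreducible_rep L sc' W \<sigma>"
proof -
  interpret V: vector_space sc by (rule V(1))
  interpret W: vector_space sc' by (rule W(1))
  from iso obtain \<phi> where \<phi>: "bij_betw \<phi> V W" "linear_between sc V sc' W \<phi>"
    "\<And>u v. u \<in> L \<Longrightarrow> v \<in> V \<Longrightarrow> \<phi> (\<rho> u v) = \<sigma> u (\<phi> v)"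
    unfolding rep_iso_iff_linear_between by blast
  have \<phi>0: "\<phi> 0 = 0" using linear_between_zero[OF \<phi>(2) V.subspace_0[OF V(2)]] .
  have W_eq: "W = \<phi> ` V" and inj: "inj_on \<phi> V" using \<phi>(1) by (auto simp: bij_betw_def)
  show ?thesis unfolding irreducible_rep_def
  proof (intro conjI allI impI; (elim conjE)?)
    show "W \<noteq> {0}"
    proof
      assume W0: "W = {0}"
      have "v = 0" if "v \<in> V" for v
      proof (rule inj_onD[OF inj])
        show "\<phi> v = \<phi> 0" using that W0 W_eq \<phi>0 by auto
      qed (use that V.subspace_0[OF V(2)] in auto)
      with V.subspace_0[OF V(2)] have "V = {0}" by auto
      then show False using V(4) by (simp add: irreducible_rep_def)
    qed
    fix U assume U: "W.subspace U" "U \<subseteq> W" "\<forall>u\<in>L. \<forall>w\<in>U. \<sigma> u w \<in> U"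
    let ?U = "{v\<in>V. \<phi> v \<in> U}"
    have im: "\<phi> ` ?U = U" using U(2) W_eq by auto
    have "V.subspace ?U"
      using V(2) U(1) \<phi>(2) by (auto simp: V.subspace_def W.subspace_def linear_between_def \<phi>0)
    moreover have "\<rho> u v \<in> ?U" if "u \<in> L" "v \<in> ?U" for u v
      using that U(3) linear_betweenD(1)[OF V(3)] by (simp add: \<phi>(3))
    ultimately have "?U = {0} \<or> ?U = V" using V(4) unfolding irreducible_rep_def by blast
    then show "U = {0} \<or> U = W"
    proof
      assume "?U = {0}"
      then have "U = \<phi> ` {0}" using im by metis
      then show ?thesis using \<phi>0 by simp
    next
      assume "?U = V"
      then have "U = \<phi> ` V" using im by metis
      then show ?thesis using W_eq by simp
    qed
  qed
qed


subsection \<open>Eigenvectors\<close>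

locale alg_closed_vector_space = vector_space sc
  for sc :: "'k::alg_closed_field \<Rightarrow> 'v::ab_group_add \<Rightarrow> 'v"
begin

text \<open>
  The vector \<open>p(h) v\<close>, computed by Horner's scheme; the recursion along the coefficients makes the laws below
  provable by induction on \<open>p\<close>.
\<close>

definition poly_op :: "('v \<Rightarrow> 'v) \<Rightarrow> 'k poly \<Rightarrow> 'v \<Rightarrow> 'v" where
  "poly_op h p v = fold_coeffs (\<lambda>a w. sc a v + h w) p 0"

context
  fixes h V
  assumes V: "subspace V" and h: "linear_between sc V sc V h"
begin

lemma endo_zero: "h 0 = 0"
  using linear_between_zero[OF h subspace_0[OF V]] .

lemma poly_op_0: "poly_op h 0 v = 0"
  by (simp add: poly_op_def)

lemma poly_op_pCons:
  shows "poly_op h (pCons a p) v = sc a v + h (poly_op h p v)"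
  by (cases "p = 0 \<and> a = 0") (auto simp: poly_op_def endo_zero)

lemma poly_op_mem: "v \<in> V \<Longrightarrow> poly_op h p v \<in> V"
  by (induction p) (auto simp: poly_op_0 poly_op_pCons V subspace_0 subspace_add subspace_scale
      linear_betweenD(1)[OF h])

lemma poly_op_add: "v \<in> V \<Longrightarrow> poly_op h (p + q) v = poly_op h p v + poly_op h q v"
  by (induction p q rule: poly_induct2)
     (auto simp: poly_op_0 poly_op_pCons scale_left_distrib linear_betweenD(2)[OF h] poly_op_mem algebra_simps)

lemma poly_op_smult: "v \<in> V \<Longrightarrow> poly_op h (smult c p) v = sc c (poly_op h p v)"
  by (induction p)
     (auto simp: poly_op_0 poly_op_pCons linear_betweenD(3)[OF h] poly_op_mem algebra_simps)

lemma poly_op_sum: "v \<in> V \<Longrightarrow> poly_op h (\<Sum>i\<in>S. p i) v = (\<Sum>i\<in>S. poly_op h (p i) v)"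
  by (induction S rule: infinite_finite_induct) (auto simp: poly_op_0 poly_op_add)

lemma poly_op_monom: "v \<in> V \<Longrightarrow> poly_op h (monom c i) v = sc c ((h ^^ i) v)"
proof (induction i)
  case 0
  then show ?case by (simp add: monom_0 poly_op_pCons poly_op_0 endo_zero)
next
  case (Suc i)
  have "(h ^^ i) v \<in> V" using Suc.prems by (induction i) (auto simp: linear_betweenD(1)[OF h])
  then show ?case using Suc
    by (simp add: monom_Suc poly_op_pCons linear_betweenD(3)[OF h])
qed

text \<open>
  Among the vectors \<open>h\<^sup>i v\<close>, one more than the number of generators, either two coincide or
  there is a linear relation.
\<close>

lemma annihilating_polynomial:
  assumes "finite B" "V \<subseteq> span B" "v \<in> V"
  shows "\<exists>p. p \<noteq> 0 \<and> poly_op h p v = 0"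
proof -
  let ?x = "\<lambda>i. (h ^^ i) v"
  have xV: "?x i \<in> V" for i using assms(3) by (induction i) (auto simp: linear_betweenD(1)[OF h])
  show ?thesis
  proof (cases "inj_on ?x {..card B}")
    case False
    then obtain i j where ij: "i \<noteq> j" "?x i = ?x j" unfolding inj_on_def by blast
    let ?p = "monom (1::'k) i + monom (-1) j"
    have "coeff ?p i \<noteq> coeff 0 i" using ij(1) by simp
    then have "?p \<noteq> 0" by metis
    moreover have "poly_op h ?p v = 0"
      using assms(3) ij(2) by (simp add: poly_op_add poly_op_monom)
    ultimately show ?thesis by blast
  next
    case True
    let ?S = "?x ` {..card B}"
    have "card ?S = Suc (card B)" using True by (simp add: card_image)
    moreover have "?S \<subseteq> span B" using xV assms(2) by auto
    ultimately have "dependent ?S"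
      using independent_span_bound[of B ?S] assms(1) by fastforce
    then obtain u where u: "(\<Sum>s\<in>?S. sc (u s) s) = 0" "\<exists>s\<in>?S. u s \<noteq> 0"
      using dependent_finite[of ?S] by auto
    then obtain i where i: "i \<le> card B" "u (?x i) \<noteq> 0" by auto
    let ?p = "\<Sum>i\<le>card B. monom (u (?x i)) i"
    have "coeff ?p i = u (?x i)" using i(1) by (simp add: coeff_sum)
    then have "?p \<noteq> 0" using i(2) by auto
    moreover have "poly_op h ?p v = 0"
      using assms(3) u(1) True by (simp add: poly_op_sum poly_op_monom sum.reindex o_def)
    ultimately show ?thesis by blast
  qed
qed

end

lemma eigenvector_exists:
  assumes V: "subspace V" "V \<noteq> {0}" and B: "finite B" "V \<subseteq> span B"
    and h: "linear_between sc V sc V h"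
  shows "\<exists>c. \<exists>v\<in>V. v \<noteq> 0 \<and> h v = sc c v"
proof -
  \<comment> \<open>Let the linear factors of \<open>p\<close> act one by one; the last nonzero vector is an eigenvector.\<close>
  have *: "\<exists>c. \<exists>v\<in>V. v \<noteq> 0 \<and> h v = sc c v"
    if "p \<noteq> 0" "poly_op h p v = 0" "v \<in> V" "v \<noteq> 0" for p v
    using that
  proof (induction "degree p" arbitrary: p)
    case 0
    then obtain a where "p = [:a:]" by (metis degree_eq_zeroE)
    with 0 have "p = [:a:]" "a \<noteq> 0" by auto
    with 0 show ?case
      by (simp add: poly_op_pCons[OF V(1) h] poly_op_0[OF V(1) h] endo_zero[OF V(1) h])
  next
    case (Suc n)
    then obtain c where c: "poly p c = 0" using alg_closed_imp_poly_has_root[of p] by auto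
    then have "[:-c, 1:] dvd p" by (simp add: poly_eq_0_iff_dvd)
    then obtain q where q: "p = [:-c, 1:] * q" by (rule dvdE)
    then have q': "p = smult (-c) q + pCons 0 q" by simp
    let ?w = "poly_op h q v"
    have "q \<noteq> 0" using q Suc.prems(1) by auto
    have "poly_op h p v = h ?w - sc c ?w"
      using Suc.prems(3) unfolding q'
      by (simp add: poly_op_add[OF V(1) h] poly_op_pCons[OF V(1) h] poly_op_smult[OF V(1) h]
          del: smult_minus_left)
    then have hw: "h ?w = sc c ?w" using Suc.prems(2) by simp
    show ?case
    proof (cases "?w = 0")
      case True
      have "degree p = Suc (degree q)" unfolding q using \<open>q \<noteq> 0\<close> by (subst degree_mult_eq) auto
      then show ?thesis using Suc.hyps(1)[of q] Suc.hyps(2) \<open>q \<noteq> 0\<close> True Suc.prems by simp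
    next
      case False
      then show ?thesis using hw poly_op_mem[OF V(1) h Suc.prems(3)] by blast
    qed
  qed
  obtain v where "v \<in> V" "v \<noteq> 0" using V subspace_0 by blast
  with annihilating_polynomial[OF V(1) h B] * show ?thesis by blast
qed

end


subsection \<open>Burnside's theorem\<close>

locale irreducible_operator_algebra = alg_closed_vector_space sc
  for sc :: "'k::alg_closed_field \<Rightarrow> 'v::ab_group_add \<Rightarrow> 'v" +
  fixes V B :: "'v set" and A :: "('v \<Rightarrow> 'v) set"
  assumes finite_B: "finite B" and V_eq: "V = span B"
    and op_linear: "a \<in> A \<Longrightarrow> linear_between sc V sc V a"
    and op_id: "(\<lambda>v. v) \<in> A"
    and op_add: "a \<in> A \<Longrightarrow> b \<in> A \<Longrightarrow> (\<lambda>v. a v + b v) \<in> A"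
    and op_scale: "a \<in> A \<Longrightarrow> (\<lambda>v. sc c (a v)) \<in> A"
    and op_comp: "a \<in> A \<Longrightarrow> b \<in> A \<Longrightarrow> (\<lambda>v. a (b v)) \<in> A"
    and irreducible: "irreducible_rep A sc V (\<lambda>a. a)"
begin

lemma subspace_V: "subspace V"
  by (simp add: V_eq)

lemma op_diff:
  assumes "a \<in> A" "b \<in> A"
  shows "(\<lambda>v. a v - b v) \<in> A"
  using op_add[OF assms(1) op_scale[OF assms(2), of "-1"]] by simp

lemma op_sum: "finite S \<Longrightarrow> (\<And>i. i \<in> S \<Longrightarrow> a i \<in> A) \<Longrightarrow> (\<lambda>v. \<Sum>i\<in>S. a i v) \<in> A"
proof (induction S rule: finite_induct)
  case empty
  show ?case using op_scale[OF op_id, of 0] by simp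
next
  case (insert i S)
  then show ?case using op_add[of "a i"] by simp
qed

text \<open>
  Every eigenspace of \<open>h\<close> is stable under \<open>A\<close>, and there is a nonzero one.
\<close>

lemma commuting_is_scalar:
  assumes h: "linear_between sc V sc V h" and comm: "\<And>a v. a \<in> A \<Longrightarrow> v \<in> V \<Longrightarrow> h (a v) = a (h v)"
  shows "\<exists>c. \<forall>v\<in>V. h v = sc c v"
proof -
  have V0: "V \<noteq> {0}" using irreducible by (simp add: irreducible_rep_def)
  obtain c v where v: "v \<in> V" "v \<noteq> 0" "h v = sc c v"
    using eigenvector_exists[OF subspace_V V0 finite_B _ h] V_eq by blast
  let ?E = "{v\<in>V. h v = sc c v}"
  have "subspace ?E"
    using subspace_V endo_zero[OF subspace_V h]
    by (auto intro!: subspaceI simp: subspace_0 subspace_add subspace_scale linear_betweenD[OF h] scale_right_distrib)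
  moreover have "a w \<in> ?E" if "a \<in> A" "w \<in> ?E" for a w
    using that by (simp add: comm linear_betweenD[OF op_linear])
  ultimately have "?E = {0} \<or> ?E = V"
    using irreducible unfolding irreducible_rep_def by blast
  with v show ?thesis by blast
qed

text \<open>
  Jacobson density. In the inductive step an operator must be found that vanishes on \<open>S\<close> but not on
  \<open>s\<close>. If there were none, then \<open>a s\<close> would be a function of the family \<open>(a b)\<close> with \<open>b \<in> S\<close>, which
  ranges over all of \<open>V\<^bsup>S\<^esup>\<close>; the components of this function commute with \<open>A\<close>, so they are scalars
  by Schur's lemma, and \<open>a = 1\<close> shows that \<open>s\<close> depends linearly on \<open>S\<close>.
\<close>

lemma density:
  assumes "finite S" "independent S" "S \<subseteq> V" "g \<in> S \<rightarrow> V"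
  shows "\<exists>a\<in>A. \<forall>s\<in>S. a s = g s"
  using assms
proof (induction S arbitrary: g rule: finite_induct)
  case empty
  show ?case using op_id by blast
next
  case (insert s S)
  have ind: "independent S" "s \<notin> span S"
    using insert.prems(1) insert.hyps(2) by (simp_all add: independent_insert)
  have sV: "s \<in> V" and SV: "S \<subseteq> V" using insert.prems by auto
  have "\<exists>a\<in>A. (\<forall>b\<in>S. a b = 0) \<and> a s \<noteq> 0"
  proof (rule ccontr)
    assume "\<not> ?thesis"
    then have no: "\<And>a. a \<in> A \<Longrightarrow> \<forall>b\<in>S. a b = 0 \<Longrightarrow> a s = 0" by blast
    \<comment> \<open>\<open>e b v\<close> sends \<open>b\<close> to \<open>v\<close> and the rest of \<open>S\<close> to zero; its value at \<open>s\<close> does not depend on the choice.\<close>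
    define e where "e b v = (SOME a. a \<in> A \<and> (\<forall>b'\<in>S. a b' = (if b' = b then v else 0)))" for b v
    have "e b v \<in> A \<and> (\<forall>b'\<in>S. e b v b' = (if b' = b then v else 0))" if "v \<in> V" for b v
    proof -
      have "(\<lambda>b'. if b' = b then v else 0) \<in> S \<rightarrow> V" using that subspace_0[OF subspace_V] by auto
      from insert.IH[OF ind(1) SV this]
      have "\<exists>a. a \<in> A \<and> (\<forall>b'\<in>S. a b' = (if b' = b then v else 0))" by blast
      then show ?thesis unfolding e_def by (rule someI_ex)
    qed
    then have e: "\<And>b v. v \<in> V \<Longrightarrow> e b v \<in> A"
      "\<And>b v b'. v \<in> V \<Longrightarrow> b' \<in> S \<Longrightarrow> e b v b' = (if b' = b then v else 0)"
      by auto
    have uniq: "a s = e b v s" if "a \<in> A" "v \<in> V" "\<And>b'. b' \<in> S \<Longrightarrow> a b' = (if b' = b then v else 0)" for a b v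
      using no[OF op_diff[OF that(1) e(1)[OF that(2)]]] that e(2)[OF that(2)] by simp
    have "\<exists>c. \<forall>v\<in>V. e b v s = sc c v" if b: "b \<in> S" for b
    proof (rule commuting_is_scalar)
      show "linear_between sc V sc V (\<lambda>v. e b v s)"
      proof (rule linear_betweenI)
        fix v w c assume v: "v \<in> V"
        show "e b v s \<in> V" using linear_betweenD(1)[OF op_linear[OF e(1)[OF v]] sV] .
        show "e b (sc c v) s = sc c (e b v s)"
          using uniq[OF op_scale[OF e(1)[OF v], of c b] subspace_scale[OF subspace_V v, of c], of b] v
          by (simp add: e)
        assume w: "w \<in> V"
        show "e b (v + w) s = e b v s + e b w s"
          using uniq[OF op_add[OF e(1)[OF v, of b] e(1)[OF w, of b]] subspace_add[OF subspace_V v w], of b] v w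
          by (simp add: e)
      qed
      fix a v assume a: "a \<in> A" and v: "v \<in> V"
      have "a 0 = 0" by (rule endo_zero[OF subspace_V op_linear[OF a]])
      then show "e b (a v) s = a (e b v s)"
        using uniq[OF op_comp[OF a e(1)[OF v, of b]] linear_betweenD(1)[OF op_linear[OF a] v], of b] v
        by (simp add: e)
    qed
    then have "\<forall>b\<in>S. \<exists>c. \<forall>v\<in>V. e b v s = sc c v" by blast
    from bchoice[OF this] obtain c where c: "\<And>b v. b \<in> S \<Longrightarrow> v \<in> V \<Longrightarrow> e b v s = sc (c b) v"
      by blast
    \<comment> \<open>The identity minus the operators \<open>e b b\<close> kills \<open>S\<close>, hence also \<open>s\<close>.\<close>
    have "(\<lambda>v. v - (\<Sum>b\<in>S. e b b v)) \<in> A"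
      using SV insert.hyps(1) by (intro op_diff op_id op_sum e) auto
    moreover have "b' - (\<Sum>b\<in>S. e b b b') = 0" if "b' \<in> S" for b'
    proof -
      have "(\<Sum>b\<in>S. e b b b') = (\<Sum>b\<in>S. if b' = b then b else 0)"
        using SV that by (intro sum.cong) (auto simp: e)
      then show ?thesis using that insert.hyps(1) by simp
    qed
    ultimately have "s - (\<Sum>b\<in>S. e b b s) = 0" by (intro no) auto
    then have "s = (\<Sum>b\<in>S. sc (c b) b)" using c SV by (simp add: subset_iff)
    also have "\<dots> \<in> span S" by (intro span_sum span_scale span_base)
    finally show False using ind(2) by simp
  qed
  then obtain a where a: "a \<in> A" "\<forall>b\<in>S. a b = 0" "a s \<noteq> 0" by blast
  have asV: "a s \<in> V" using linear_betweenD(1)[OF op_linear[OF a(1)] sV] .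
  \<comment> \<open>The vector \<open>a s\<close> generates \<open>V\<close>, so the value at \<open>s\<close> can be corrected without changing those on \<open>S\<close>.\<close>
  let ?O = "{b (a s) | b. b \<in> A}"
  have O_I: "b (a s) \<in> ?O" if "b \<in> A" for b using that by blast
  have "subspace ?O"
  proof (rule subspaceI)
    show "0 \<in> ?O" using O_I[OF op_scale[OF op_id, of 0]] by simp
    fix x y c assume "x \<in> ?O"
    then obtain b where b: "b \<in> A" "x = b (a s)" by blast
    show "sc c x \<in> ?O" unfolding b(2) using O_I[OF op_scale[OF b(1)]] .
    assume "y \<in> ?O"
    then obtain b' where b': "b' \<in> A" "y = b' (a s)" by blast
    show "x + y \<in> ?O" unfolding b(2) b'(2) using O_I[OF op_add[OF b(1) b'(1)]] .
  qed
  moreover have "?O \<subseteq> V" using asV linear_betweenD(1)[OF op_linear] by auto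
  moreover have "\<forall>b\<in>A. \<forall>w\<in>?O. b w \<in> ?O" using O_I[OF op_comp] by blast
  moreover have "a s \<in> ?O" using O_I[OF op_id] .
  ultimately have O: "?O = V" using irreducible a(3) unfolding irreducible_rep_def by blast
  obtain a0 where a0: "a0 \<in> A" "\<forall>b\<in>S. a0 b = g b"
    using insert.IH[OF ind(1) SV, of g] insert.prems(3) by auto
  have "g s - a0 s \<in> V"
    using insert.prems(3) linear_betweenD(1)[OF op_linear[OF a0(1)] sV] subspace_V
    by (auto intro: subspace_diff)
  then have "g s - a0 s \<in> ?O" unfolding O .
  then obtain b where b: "b \<in> A" "b (a s) = g s - a0 s"
    by (elim CollectE exE conjE) (simp only:)
  have "b 0 = 0" by (rule endo_zero[OF subspace_V op_linear[OF b(1)]])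
  then have "\<forall>t\<in>insert s S. a0 t + b (a t) = g t" using a a0 b by simp
  then show ?case
    by (rule bexI[of _ "\<lambda>t. a0 t + b (a t)"]) (rule op_add[OF a0(1) op_comp[OF b(1) a(1)]])
qed

theorem burnside:
  assumes E: "linear_between sc V sc V E"
  shows "\<exists>a\<in>A. \<forall>v\<in>V. a v = E v"
proof -
  obtain C where C: "C \<subseteq> B" "independent C" "B \<subseteq> span C"
    using maximal_independent_subset[of B] by blast
  have VC: "V = span C" unfolding V_eq using C(1,3) by (metis span_mono span_span subset_antisym)
  then have CV: "C \<subseteq> V" by (auto intro: span_base)
  obtain a where a: "a \<in> A" "\<forall>s\<in>C. a s = E s"
    using density[OF finite_subset[OF C(1) finite_B] C(2) CV, of E] linear_betweenD(1)[OF E] CV by blast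
  have "v \<in> V \<and> a v = E v" if "v \<in> span C" for v
    using that
  proof (induction rule: span_induct_alt)
    case base
    show ?case using endo_zero[OF subspace_V E] endo_zero[OF subspace_V op_linear[OF a(1)]]
        subspace_0[OF subspace_V] by simp
  next
    case (step c x y)
    then show ?case using CV a subspace_V
      by (auto simp: linear_betweenD[OF E] linear_betweenD[OF op_linear[OF a(1)]] subspace_add subspace_scale)
  qed
  then show ?thesis using a(1) VC by blast
qed

end


section \<open>Operators on one tensor factor\<close>

text \<open>
  The operator \<open>1 \<otimes> \<dots> \<otimes> E \<otimes> \<dots> \<otimes> 1\<close> with \<open>E\<close> in position \<open>i\<close>. A tensor is a functional on
  multilinear forms, so the operator is the transpose of precomposition of forms with \<open>E\<close>.
\<close>

definition factor_op ::
  "'i set \<Rightarrow> ('k::field \<Rightarrow> 'v::ab_group_add \<Rightarrow> 'v) \<Rightarrow> ('i \<Rightarrow> 'v set) \<Rightarrow> 'i \<Rightarrow> ('v \<Rightarrow> 'v) \<Rightarrow>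
   ((('i \<Rightarrow> 'v) \<Rightarrow> 'k) \<Rightarrow> 'k) \<Rightarrow> (('i \<Rightarrow> 'v) \<Rightarrow> 'k) \<Rightarrow> 'k" where
  "factor_op I sc V i E T = (\<lambda>m. if multilinear_form I sc V m then T (\<lambda>v. m (v(i := E (v i)))) else 0)"

lemma sum_fun_apply: "(\<Sum>i\<in>S. G i) m = (\<Sum>i\<in>S. G i m)"
  by (induction S rule: infinite_finite_induct) auto

lemma linear_map_sum:
  assumes "Vector_Spaces.linear s1 s2 F"
  shows "F (\<Sum>i\<in>S. x i) = (\<Sum>i\<in>S. F (x i))"
proof -
  interpret Vector_Spaces.linear s1 s2 F by fact
  show ?thesis by (rule sum)
qed

lemma factor_op_linear: "Vector_Spaces.linear fscale fscale (factor_op I sc V i E)"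
  by (rule linear_intro) (auto intro: vector_space_fscale simp: factor_op_def fscale_def fun_eq_iff)

lemma tensor_rep_is_linear: "Vector_Spaces.linear fscale fscale (tensor_rep I sc V \<rho> u)"
  by (rule linear_intro) (auto intro: vector_space_fscale simp: tensor_rep_linear)

locale tensor_product = vector_space sc
  for sc :: "'k::field \<Rightarrow> 'v::ab_group_add \<Rightarrow> 'v" +
  fixes I :: "'i set" and V :: "'i \<Rightarrow> 'v set"
  assumes finite_I: "finite I" and subspace_V: "i \<in> I \<Longrightarrow> subspace (V i)"
begin

sublocale f: vector_space "fscale :: 'k \<Rightarrow> ((('i \<Rightarrow> 'v) \<Rightarrow> 'k) \<Rightarrow> 'k) \<Rightarrow> _"
  by (rule vector_space_fscale)

abbreviation "T \<equiv> tensor_space I sc V"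
abbreviation "pure \<equiv> pure_tensor I sc V"
abbreviation "fop \<equiv> factor_op I sc V"
abbreviation "endo i \<equiv> linear_between sc (V i) sc (V i)"

lemma subspace_T: "f.subspace T"
  by (simp add: tensor_space_def)

lemma pure_in_T: "v \<in> Pi\<^sub>E I V \<Longrightarrow> pure v \<in> T"
  by (auto simp: tensor_space_def intro: f.span_base)

lemma PiE_upd: "v \<in> Pi\<^sub>E I V \<Longrightarrow> i \<in> I \<Longrightarrow> a \<in> V i \<Longrightarrow> v(i := a) \<in> Pi\<^sub>E I V"
  by (auto simp: PiE_iff extensional_def)

lemma PiE_component: "v \<in> Pi\<^sub>E I V \<Longrightarrow> i \<in> I \<Longrightarrow> v i \<in> V i"
  by auto

lemma T_linear_eqI:
  assumes "Vector_Spaces.linear fscale s F" "Vector_Spaces.linear fscale s G"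
    and "\<And>v. v \<in> Pi\<^sub>E I V \<Longrightarrow> F (pure v) = G (pure v)" "t \<in> T"
  shows "F t = G t"
proof -
  interpret F: Vector_Spaces.linear fscale s F by fact
  interpret G: Vector_Spaces.linear fscale s G by fact
  show ?thesis using assms(4) unfolding tensor_space_def
  proof (induction rule: f.span_induct_alt)
    case base
    show ?case by (simp only: F.zero G.zero)
  next
    case (step c x y)
    then obtain v where v: "v \<in> Pi\<^sub>E I V" "x = pure v" by blast
    show ?case unfolding v(2) F.add G.add F.scale G.scale assms(3)[OF v(1)] step(2) ..
  qed
qed

lemma T_linear_image:
  assumes "Vector_Spaces.linear fscale s F" "module.subspace s W"
    and "\<And>v. v \<in> Pi\<^sub>E I V \<Longrightarrow> F (pure v) \<in> W" "t \<in> T"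
  shows "F t \<in> W"
proof -
  interpret F: Vector_Spaces.linear fscale s F by fact
  show ?thesis using assms(4) unfolding tensor_space_def
  proof (induction rule: f.span_induct_alt)
    case base
    show ?case unfolding F.zero by (rule F.vs2.subspace_0[OF assms(2)])
  next
    case (step c x y)
    then obtain v where v: "v \<in> Pi\<^sub>E I V" "x = pure v" by blast
    show ?case unfolding v(2) F.add F.scale
      by (intro F.vs2.subspace_add F.vs2.subspace_scale assms(2) assms(3) step(2) v(1))
  qed
qed

lemma T_induct [consumes 1, case_names zero step]:
  assumes "t \<in> T" "P 0" "\<And>c v y. v \<in> Pi\<^sub>E I V \<Longrightarrow> y \<in> T \<Longrightarrow> P y \<Longrightarrow> P (fscale c (pure v) + y)"
  shows "P t"
proof -
  have "t \<in> T \<and> P t" using assms(1) unfolding tensor_space_def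
  proof (induction rule: f.span_induct_alt)
    case base
    show ?case by (rule conjI, rule f.span_zero, rule assms(2))
  next
    case (step c x y)
    then obtain v where v: "v \<in> Pi\<^sub>E I V" "x = pure v" by blast
    have y: "y \<in> f.span (pure ` Pi\<^sub>E I V)" "P y" using step(2) by blast+
    have "y \<in> T" using y(1) unfolding tensor_space_def .
    show ?case unfolding v(2)
      by (intro conjI f.span_add f.span_scale f.span_base imageI v(1) y(1) assms(3) y(2) \<open>y \<in> T\<close>)
  qed
  then show ?thesis ..
qed

lemma pure_upd_zero:
  assumes "v \<in> Pi\<^sub>E I V" "i \<in> I"
  shows "pure (v(i := 0)) = 0"
  using pure_tensor_multilinear(1)[OF assms, where a = 0 and b = 0 and sc = sc]
    subspace_0[OF subspace_V[OF assms(2)]] by simp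

lemma factor_op_pure:
  assumes v: "v \<in> Pi\<^sub>E I V" and i: "i \<in> I" and E: "endo i E"
  shows "fop i E (pure v) = pure (v(i := E (v i)))"
proof
  fix m
  have "multilinear_form I sc V (\<lambda>v. m (v(i := E (v i))))" if m: "multilinear_form I sc V m"
    unfolding multilinear_form_def
  proof (intro ballI allI)
    fix w j a b c assume w: "w \<in> Pi\<^sub>E I V" and j: "j \<in> I" and ab: "a \<in> V j" "b \<in> V j"
    have mm: "m (w'(j := x + y)) = m (w'(j := x)) + m (w'(j := y))"
      "m (w'(j := sc c x)) = c * m (w'(j := x))"
      if "w' \<in> Pi\<^sub>E I V" "x \<in> V j" "y \<in> V j" for w' x y
      using m that j by (auto simp: multilinear_form_def)
    show "m ((w(j := a + b))(i := E ((w(j := a + b)) i))) =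
          m ((w(j := a))(i := E ((w(j := a)) i))) + m ((w(j := b))(i := E ((w(j := b)) i))) \<and>
          m ((w(j := sc c a))(i := E ((w(j := sc c a)) i))) = c * m ((w(j := a))(i := E ((w(j := a)) i)))"
    proof (cases "i = j")
      case True
      have "E a \<in> V j" "E b \<in> V j" using ab linear_betweenD(1)[OF E] True by auto
      then show ?thesis using mm[OF w] ab linear_betweenD(2,3)[OF E] True by simp
    next
      case False
      have "w(i := E (w i)) \<in> Pi\<^sub>E I V"
        using w i linear_betweenD(1)[OF E] by (intro PiE_upd) auto
      from mm[OF this ab] show ?thesis using False by (simp add: fun_upd_twist[of j i])
    qed
  qed
  then show "fop i E (pure v) m = pure (v(i := E (v i))) m"
    by (simp add: factor_op_def pure_tensor_def evaluation_def)
qed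

lemma factor_op_T:
  assumes "i \<in> I" "endo i E" "t \<in> T"
  shows "fop i E t \<in> T"
proof (rule T_linear_image[OF factor_op_linear subspace_T _ assms(3)])
  fix v assume v: "v \<in> Pi\<^sub>E I V"
  then show "fop i E (pure v) \<in> T"
    unfolding factor_op_pure[OF v assms(1,2)]
    using assms(1) linear_betweenD(1)[OF assms(2)] by (intro pure_in_T PiE_upd) auto
qed

lemma linear_plus:
  assumes "Vector_Spaces.linear fscale fscale F" "Vector_Spaces.linear fscale fscale G"
  shows "Vector_Spaces.linear fscale fscale
    (\<lambda>t :: (('i \<Rightarrow> 'v) \<Rightarrow> 'k) \<Rightarrow> 'k. F t + G t :: (('i \<Rightarrow> 'v) \<Rightarrow> 'k) \<Rightarrow> 'k)"
proof -
  interpret F: Vector_Spaces.linear fscale fscale F by fact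
  interpret G: Vector_Spaces.linear fscale fscale G by fact
  show ?thesis by (rule linear_intro) (auto intro: vector_space_fscale
      simp: F.add G.add F.scale G.scale f.scale_right_distrib simp del: plus_fun_apply)
qed

lemma linear_minus:
  assumes "Vector_Spaces.linear fscale fscale F" "Vector_Spaces.linear fscale fscale G"
  shows "Vector_Spaces.linear fscale fscale
    (\<lambda>t :: (('i \<Rightarrow> 'v) \<Rightarrow> 'k) \<Rightarrow> 'k. F t - G t :: (('i \<Rightarrow> 'v) \<Rightarrow> 'k) \<Rightarrow> 'k)"
proof -
  interpret F: Vector_Spaces.linear fscale fscale F by fact
  interpret G: Vector_Spaces.linear fscale fscale G by fact
  show ?thesis by (rule linear_intro) (auto intro: vector_space_fscale
      simp: F.add G.add F.scale G.scale f.scale_right_diff_distrib simp del: plus_fun_apply)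
qed

lemma linear_fscale_comp:
  assumes "Vector_Spaces.linear fscale fscale F"
  shows "Vector_Spaces.linear fscale fscale
    (\<lambda>t :: (('i \<Rightarrow> 'v) \<Rightarrow> 'k) \<Rightarrow> 'k. fscale c (F t) :: (('i \<Rightarrow> 'v) \<Rightarrow> 'k) \<Rightarrow> 'k)"
proof -
  interpret F: Vector_Spaces.linear fscale fscale F by fact
  show ?thesis by (rule linear_intro) (auto intro: vector_space_fscale
      simp: F.add F.scale f.scale_right_distrib mult.commute simp del: plus_fun_apply)
qed

lemma linear_comp:
  assumes "Vector_Spaces.linear s1 s2 F" "Vector_Spaces.linear s2 s3 G"
  shows "Vector_Spaces.linear s1 s3 (\<lambda>t. G (F t))"
  using Vector_Spaces.linear_compose[OF assms] by (simp add: o_def)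

lemma linear_id: "Vector_Spaces.linear fscale fscale (\<lambda>t :: (('i \<Rightarrow> 'v) \<Rightarrow> 'k) \<Rightarrow> 'k. t)"
  by (rule linear_intro) (auto intro: vector_space_fscale)

lemma linear_zero:
  "Vector_Spaces.linear fscale fscale (\<lambda>t :: (('i \<Rightarrow> 'v) \<Rightarrow> 'k) \<Rightarrow> 'k. 0 :: (('i \<Rightarrow> 'v) \<Rightarrow> 'k) \<Rightarrow> 'k)"
  by (rule linear_intro) (auto intro: vector_space_fscale simp: f.scale_zero_right)

lemma linear_family_sum:
  assumes "\<And>i. i \<in> S \<Longrightarrow> Vector_Spaces.linear fscale fscale (F i)"
  shows "Vector_Spaces.linear fscale fscale
    (\<lambda>t :: (('i \<Rightarrow> 'v) \<Rightarrow> 'k) \<Rightarrow> 'k. \<Sum>i\<in>S. F i t :: (('i \<Rightarrow> 'v) \<Rightarrow> 'k) \<Rightarrow> 'k)"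
  using assms
proof (induction S rule: infinite_finite_induct)
  case (insert i S)
  then show ?case by (simp add: linear_plus del: plus_fun_apply)
qed (simp_all add: linear_zero del: zero_fun_apply)

lemma factor_op_algebra:
  assumes i: "i \<in> I" and E: "endo i E" "endo i E'" and t: "t \<in> T"
  shows "fop i (\<lambda>v. v) t = t"
    and "fop i (\<lambda>v. E v + E' v) t = fop i E t + fop i E' t"
    and "fop i (\<lambda>v. E v - E' v) t = fop i E t - fop i E' t"
    and "fop i (\<lambda>v. sc c (E v)) t = fscale c (fop i E t)"
    and "fop i (\<lambda>v. E (E' v)) t = fop i E (fop i E' t)"
proof -
  note Ed = linear_betweenD[OF E(1)] and Ed' = linear_betweenD[OF E(2)]
  note sub = subspace_add[OF subspace_V[OF i]] subspace_diff[OF subspace_V[OF i]]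
    subspace_scale[OF subspace_V[OF i]]
  have lin: "endo i (\<lambda>v. v)" "endo i (\<lambda>v. E v + E' v)" "endo i (\<lambda>v. E v - E' v)"
    "endo i (\<lambda>v. sc c (E v))" "endo i (\<lambda>v. E (E' v))" for c
    by (auto intro!: linear_betweenI simp: Ed Ed' sub algebra_simps)
  note PiE = PiE_component[OF _ i]
  note pt' = pure_tensor_multilinear(2)[OF _ i, where b = 0 and sc = sc]
  note pt = pure_tensor_multilinear[OF _ i, where sc = sc]
  show "fop i (\<lambda>v. v) t = t"
    by (rule T_linear_eqI[OF factor_op_linear linear_id _ t]) (simp add: factor_op_pure i lin)
  show "fop i (\<lambda>v. E v + E' v) t = fop i E t + fop i E' t"
    by (rule T_linear_eqI[OF factor_op_linear linear_plus[OF factor_op_linear factor_op_linear] _ t])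
       (simp add: factor_op_pure i lin E pt PiE Ed Ed' del: plus_fun_apply)
  show "fop i (\<lambda>v. sc c (E v)) t = fscale c (fop i E t)"
    by (rule T_linear_eqI[OF factor_op_linear linear_fscale_comp[OF factor_op_linear] _ t])
       (simp add: factor_op_pure i lin E pt' PiE Ed subspace_0[OF subspace_V[OF i]])
  show "fop i (\<lambda>v. E v - E' v) t = fop i E t - fop i E' t"
  proof (rule T_linear_eqI[OF factor_op_linear linear_minus[OF factor_op_linear factor_op_linear] _ t])
    fix v assume v: "v \<in> Pi\<^sub>E I V"
    have "pure (v(i := (E (v i) - E' (v i)) + E' (v i))) =
        pure (v(i := E (v i) - E' (v i))) + pure (v(i := E' (v i)))"
      using v by (intro pt) (auto simp: PiE Ed Ed' sub)
    then show "fop i (\<lambda>v. E v - E' v) (pure v) = fop i E (pure v) - fop i E' (pure v)"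
      using v by (simp add: factor_op_pure i lin E del: plus_fun_apply)
  qed
  show "fop i (\<lambda>v. E (E' v)) t = fop i E (fop i E' t)"
    by (rule T_linear_eqI[OF factor_op_linear linear_comp[OF factor_op_linear factor_op_linear] _ t])
       (simp add: factor_op_pure i lin E PiE Ed' PiE_upd)
qed

lemma factor_op_cong:
  assumes "i \<in> I" "endo i E" "\<And>v. v \<in> V i \<Longrightarrow> E v = E' v" "t \<in> T"
  shows "fop i E t = fop i E' t"
proof -
  have "endo i E'" using assms(1-3) subspace_V[OF assms(1)]
    by (auto simp: linear_between_def Pi_def subspace_add subspace_scale)
  then show ?thesis
    by (intro T_linear_eqI[OF factor_op_linear factor_op_linear _ assms(4)])
       (simp add: factor_op_pure assms(1-3) PiE_component)
qed

lemma factor_op_zero: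
  assumes "i \<in> I" "\<And>v. v \<in> V i \<Longrightarrow> E v = 0" "t \<in> T"
  shows "fop i E t = 0"
proof -
  have E: "endo i E" using assms(2) subspace_V[OF assms(1)]
    by (auto intro!: linear_betweenI simp: subspace_0 subspace_add subspace_scale)
  show ?thesis
    by (rule T_linear_eqI[OF factor_op_linear linear_zero _ assms(3)])
       (use assms in \<open>simp add: factor_op_pure E PiE_component pure_upd_zero\<close>)
qed

lemma factor_op_commute:
  assumes ij: "i \<in> I" "j \<in> I" "i \<noteq> j" and E: "endo i E" "endo j E'" and t: "t \<in> T"
  shows "fop i E (fop j E' t) = fop j E' (fop i E t)"
proof (rule T_linear_eqI[OF linear_comp[OF factor_op_linear factor_op_linear]
        linear_comp[OF factor_op_linear factor_op_linear] _ t])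
  fix v assume v: "v \<in> Pi\<^sub>E I V"
  have "v(i := E (v i)) \<in> Pi\<^sub>E I V" "v(j := E' (v j)) \<in> Pi\<^sub>E I V"
    using v ij E by (auto intro!: PiE_upd simp: linear_betweenD PiE_component)
  then show "fop i E (fop j E' (pure v)) = fop j E' (fop i E (pure v))"
    using v ij E by (simp add: factor_op_pure fun_upd_twist[OF ij(3)])
qed

end


context tensor_product
begin

lemma pure_upd_linear:
  assumes "v \<in> Pi\<^sub>E I V" "i \<in> I"
  shows "linear_between sc (V i) fscale T (\<lambda>a. pure (v(i := a)))"
  using assms subspace_0[OF subspace_V[OF assms(2)]]
  by (intro linear_betweenI pure_in_T PiE_upd pure_tensor_multilinear[where b = 0] pure_tensor_multilinear(1))

text \<open>
  All factors except the \<open>i\<close>-th are contracted with linear functionals. They are chosen with the value \<open>1\<close>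
  at the entries of \<open>w\<close>, which makes \<open>F\<close> left inverse to the insertion of \<open>a\<close> into \<open>w\<close>.
\<close>

lemma factor_projection:
  assumes i: "i \<in> I" and w: "w \<in> Pi\<^sub>E I V" "\<And>j. j \<in> I \<Longrightarrow> j \<noteq> i \<Longrightarrow> w j \<noteq> 0"
  shows "\<exists>F. Vector_Spaces.linear fscale sc F \<and> (\<forall>t\<in>T. F t \<in> V i) \<and> (\<forall>a\<in>V i. F (pure (w(i := a))) = a) \<and>
             (\<forall>E t. endo i E \<longrightarrow> t \<in> T \<longrightarrow> F (fop i E t) = E (F t))"
proof -
  have "\<forall>j\<in>I - {i}. \<exists>\<phi>. Vector_Spaces.linear sc (*) \<phi> \<and> \<phi> (w j) = 1"
    using w(2) functional_exists by blast
  from bchoice[OF this] obtain \<phi> where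
    \<phi>: "\<And>j. j \<in> I \<Longrightarrow> j \<noteq> i \<Longrightarrow> Vector_Spaces.linear sc (*) (\<phi> j)" "\<And>j. j \<in> I \<Longrightarrow> j \<noteq> i \<Longrightarrow> \<phi> j (w j) = 1"
    by blast
  let ?c = "\<lambda>v. \<Prod>j\<in>I - {i}. \<phi> j (v j)"
  have c_i: "?c (v(i := a)) = ?c v" for v a
    by (rule prod.cong) auto
  have c_j: "?c (v(j := a)) = \<phi> j a * (\<Prod>l\<in>I - {i} - {j}. \<phi> l (v l))" if "j \<in> I" "j \<noteq> i" for v j a
  proof -
    have "?c (v(j := a)) = \<phi> j a * (\<Prod>l\<in>I - {i} - {j}. \<phi> l ((v(j := a)) l))"
      using finite_I that by (subst prod.remove[of _ j]) auto
    also have "(\<Prod>l\<in>I - {i} - {j}. \<phi> l ((v(j := a)) l)) = (\<Prod>l\<in>I - {i} - {j}. \<phi> l (v l))"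
      by (rule prod.cong) auto
    finally show ?thesis .
  qed
  have "\<exists>F. Vector_Spaces.linear fscale sc F \<and> (\<forall>v\<in>Pi\<^sub>E I V. F (pure v) = sc (?c v) (v i))"
  proof (rule tensor_space_universal[OF vector_space_axioms])
    fix v j a b c assume j: "j \<in> I"
    show "sc (?c (v(j := a + b))) ((v(j := a + b)) i) =
          sc (?c (v(j := a))) ((v(j := a)) i) + sc (?c (v(j := b))) ((v(j := b)) i) \<and>
          sc (?c (v(j := sc c a))) ((v(j := sc c a)) i) = sc c (sc (?c (v(j := a))) ((v(j := a)) i))"
    proof (cases "j = i")
      case True
      then show ?thesis by (simp add: c_i scale_right_distrib mult.commute)
    next
      case False
      interpret \<phi>: Vector_Spaces.linear sc "(*)" "\<phi> j" by (rule \<phi>(1)[OF j False])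
      show ?thesis using False
        unfolding c_j[OF j False] \<phi>.add \<phi>.scale distrib_right scale_left_distrib
        by (simp only: fun_upd_other not_False_eq_True mult.assoc scale_scale simp_thms False[symmetric])
    qed
  qed
  then obtain F where F: "Vector_Spaces.linear fscale sc F" "\<And>v. v \<in> Pi\<^sub>E I V \<Longrightarrow> F (pure v) = sc (?c v) (v i)"
    by blast
  interpret F: Vector_Spaces.linear fscale sc F by (rule F(1))
  have FV: "F t \<in> V i" if "t \<in> T" for t
    using T_linear_image[OF F(1) subspace_V[OF i] _ that] F(2) subspace_scale[OF subspace_V[OF i]] PiE_component[OF _ i]
    by simp
  moreover have "F (pure (w(i := a))) = a" if "a \<in> V i" for a
    using F(2)[OF PiE_upd[OF w(1) i that]] by (simp add: c_i \<phi>(2))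
  moreover have "F (fop i E t) = E (F t)" if E: "endo i E" and "t \<in> T" for E t
    using that(2)
  proof (induction rule: T_induct)
    case zero
    interpret fo: Vector_Spaces.linear fscale fscale "fop i E" by (rule factor_op_linear)
    show ?case using linear_between_zero[OF E subspace_0[OF subspace_V[OF i]]]
      by (simp only: fo.zero F.zero)
  next
    case (step c v y)
    interpret fo: Vector_Spaces.linear fscale fscale "fop i E" by (rule factor_op_linear)
    have v_i: "v i \<in> V i" using step(1) i by auto
    have "F (fop i E (pure v)) = E (F (pure v))"
      using step(1) i v_i linear_betweenD[OF E] by (simp add: factor_op_pure E F(2) PiE_upd c_i)
    then have "F (fop i E (fscale c (pure v) + y)) = sc c (E (F (pure v))) + E (F y)"
      by (simp only: fo.add fo.scale F.add F.scale step.IH)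
    also have "\<dots> = E (F (fscale c (pure v) + y))"
      using FV[OF step(2)] FV[OF pure_in_T[OF step(1)]] linear_betweenD[OF E] subspace_scale[OF subspace_V[OF i]]
      by (simp only: F.add F.scale)
    finally show ?case .
  qed
  ultimately show ?thesis using F(1) by blast
qed

lemma pure_nonzero:
  assumes "v \<in> Pi\<^sub>E I V" "\<And>i. i \<in> I \<Longrightarrow> v i \<noteq> 0"
  shows "pure v \<noteq> 0"
proof (cases "I = {}")
  case True
  have "pure v (\<lambda>_. 1) = 1"
    unfolding pure_tensor_def evaluation_def True by (simp add: multilinear_form_def)
  then show ?thesis by auto
next
  case False
  then obtain i where i: "i \<in> I" by auto
  from factor_projection[OF i assms] obtain F where
    F: "Vector_Spaces.linear fscale sc F" "\<And>a. a \<in> V i \<Longrightarrow> F (pure (v(i := a))) = a" by blast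
  interpret F: Vector_Spaces.linear fscale sc F by (rule F(1))
  have "F (pure v) = v i" using F(2)[OF PiE_component[OF assms(1) i]] by simp
  then have "F (pure v) \<noteq> 0" using assms(2)[OF i] by simp
  then show ?thesis by (metis F.zero)
qed

text \<open>
  By multilinearity, one position after the other can be restricted to entries from the finite
  generating set.
\<close>

lemma finite_dim_T:
  assumes B: "\<And>i. i \<in> I \<Longrightarrow> finite (B i) \<and> V i = span (B i)"
  shows "\<exists>C. finite C \<and> T = f.span C"
proof -
  have *: "pure v \<in> f.span (pure ` {w\<in>Pi\<^sub>E I V. \<forall>i\<in>J. w i \<in> B i})" if "J \<subseteq> I" "v \<in> Pi\<^sub>E I V" for J v
    using finite_subset[OF that(1) finite_I] that
  proof (induction arbitrary: v rule: finite_induct)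
    case empty
    then show ?case by (auto intro: f.span_base)
  next
    case (insert i J)
    then have i: "i \<in> I" by simp
    let ?S = "{w\<in>Pi\<^sub>E I V. \<forall>i\<in>insert i J. w i \<in> B i}"
    have "pure w \<in> f.span (pure ` ?S)" if w: "w \<in> Pi\<^sub>E I V" "\<forall>i\<in>J. w i \<in> B i" for w
    proof -
      note lin = pure_upd_linear[OF w(1) i]
      have "a \<in> V i \<and> pure (w(i := a)) \<in> f.span (pure ` ?S)" if "a \<in> span (B i)" for a
        using that
      proof (induction rule: span_induct_alt)
        case base
        show ?case unfolding pure_upd_zero[OF w(1) i]
          by (intro conjI f.span_zero subspace_0[OF subspace_V[OF i]])
      next
        case (step c x y)
        have xV: "x \<in> V i" using step(1) B[OF i] span_base by auto
        have "w(i := x) \<in> ?S" using w xV i step(1) insert.hyps(2) by (auto intro!: PiE_upd)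
        then have "pure (w(i := x)) \<in> f.span (pure ` ?S)" by (auto intro: f.span_base)
        moreover have eq: "pure (w(i := sc c x + y)) = fscale c (pure (w(i := x))) + pure (w(i := y))"
          using xV step(2) subspace_scale[OF subspace_V[OF i]] linear_betweenD(2,3)[OF lin] by simp
        moreover have "y \<in> V i" "pure (w(i := y)) \<in> f.span (pure ` ?S)" using step(2) by blast+
        ultimately show ?case unfolding eq
          by (intro conjI subspace_add subspace_scale subspace_V[OF i] xV f.span_add f.span_scale)
      qed
      from this[of "w i"] show ?thesis using w(1) i B[OF i] by auto
    qed
    then have "pure ` {w\<in>Pi\<^sub>E I V. \<forall>i\<in>J. w i \<in> B i} \<subseteq> f.span (pure ` ?S)" by blast
    then have "f.span (pure ` {w\<in>Pi\<^sub>E I V. \<forall>i\<in>J. w i \<in> B i}) \<subseteq> f.span (pure ` ?S)"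
      by (rule f.span_minimal) simp
    with insert.IH[of v] insert.prems show ?case by auto
  qed
  have BV: "B i \<subseteq> V i" if "i \<in> I" for i using B[OF that] span_superset[of "B i"] by simp
  have "{w\<in>Pi\<^sub>E I V. \<forall>i\<in>I. w i \<in> B i} = Pi\<^sub>E I B"
    using BV by (auto simp: PiE_iff extensional_def)
  with *[OF subset_refl] have "pure ` Pi\<^sub>E I V \<subseteq> f.span (pure ` Pi\<^sub>E I B)" by auto
  then have "T \<subseteq> f.span (pure ` Pi\<^sub>E I B)"
    unfolding tensor_space_def by (rule f.span_minimal) simp
  moreover have "f.span (pure ` Pi\<^sub>E I B) \<subseteq> T"
    unfolding tensor_space_def using BV by (intro f.span_mono image_mono PiE_mono) auto
  moreover have "finite (pure ` Pi\<^sub>E I B)" using finite_I B by (intro finite_imageI finite_PiE) auto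
  ultimately show ?thesis by blast
qed

end


section \<open>Tensor products of representations\<close>

text \<open>
  The Lie algebra \<open>M\<close> acts on the tensor product through a homomorphism \<open>h\<close> to the direct sum of the
  \<open>L i\<close>. Evaluation at finitely many points is such an \<open>h\<close>.
\<close>

locale tensor_product_of_reps = tensor_product sc I V
  for sc :: "'k::field \<Rightarrow> 'v::ab_group_add \<Rightarrow> 'v" and I :: "'i set" and V :: "'i \<Rightarrow> 'v set" +
  fixes scL :: "'k \<Rightarrow> 'l::ab_group_add \<Rightarrow> 'l" and br :: "'l \<Rightarrow> 'l \<Rightarrow> 'l" and L :: "'i \<Rightarrow> 'l set"
    and \<rho> :: "'i \<Rightarrow> 'l \<Rightarrow> 'v \<Rightarrow> 'v"
    and scM :: "'k \<Rightarrow> 'm::ab_group_add \<Rightarrow> 'm" and brM :: "'m \<Rightarrow> 'm \<Rightarrow> 'm" and M :: "'m set"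
    and h :: "'m \<Rightarrow> 'i \<Rightarrow> 'l"
  assumes rep: "i \<in> I \<Longrightarrow> lie_rep scL br (L i) sc (V i) (\<rho> i)"
    and h_mem: "\<alpha> \<in> M \<Longrightarrow> i \<in> I \<Longrightarrow> h \<alpha> i \<in> L i"
    and h_add: "\<alpha> \<in> M \<Longrightarrow> \<beta> \<in> M \<Longrightarrow> i \<in> I \<Longrightarrow> h (\<alpha> + \<beta>) i = h \<alpha> i + h \<beta> i"
    and h_scale: "\<alpha> \<in> M \<Longrightarrow> i \<in> I \<Longrightarrow> h (scM c \<alpha>) i = scL c (h \<alpha> i)"
    and h_br: "\<alpha> \<in> M \<Longrightarrow> \<beta> \<in> M \<Longrightarrow> i \<in> I \<Longrightarrow> h (brM \<alpha> \<beta>) i = br (h \<alpha> i) (h \<beta> i)"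
    and M_closed: "\<alpha> \<in> M \<Longrightarrow> \<beta> \<in> M \<Longrightarrow> \<alpha> + \<beta> \<in> M" "\<alpha> \<in> M \<Longrightarrow> scM c \<alpha> \<in> M"
      "\<alpha> \<in> M \<Longrightarrow> \<beta> \<in> M \<Longrightarrow> brM \<alpha> \<beta> \<in> M"
begin

abbreviation "\<tau> \<alpha> \<equiv> tensor_rep I sc V \<rho> (h \<alpha>)"

lemma endo_rep: "\<alpha> \<in> M \<Longrightarrow> i \<in> I \<Longrightarrow> endo i (\<rho> i (h \<alpha> i))"
  using lie_repD(1)[OF rep h_mem] .

text \<open>
  The definition of \<open>tensor_rep\<close> agrees with this sum on pure tensors, hence on their span. The sum reduces
  identities for the tensor product representation to identities of operators on single factors.
\<close>

lemma tensor_rep_factors: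
  assumes "\<alpha> \<in> M" "t \<in> T"
  shows "\<tau> \<alpha> t = (\<Sum>i\<in>I. fop i (\<rho> i (h \<alpha> i)) t)"
proof (rule T_linear_eqI[OF tensor_rep_is_linear linear_family_sum _ assms(2)])
  fix v assume v: "v \<in> Pi\<^sub>E I V"
  show "\<tau> \<alpha> (pure v) = (\<Sum>i\<in>I. fop i (\<rho> i (h \<alpha> i)) (pure v))"
  proof -
    have "\<tau> \<alpha> (pure v) = (\<Sum>i\<in>I. pure (v(i := \<rho> i (h \<alpha> i) (v i))))"
      by (rule tensor_rep_pure_tensor[OF finite_I v, where L = L and scL = scL and br = br])
         (auto intro: rep h_mem assms(1))
    then show ?thesis using v by (simp add: factor_op_pure endo_rep assms(1))
  qed
qed (rule factor_op_linear)

lemma tensor_rep_single: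
  assumes "\<alpha> \<in> M" "t \<in> T" "i \<in> I" "\<And>j. j \<in> I \<Longrightarrow> j \<noteq> i \<Longrightarrow> h \<alpha> j = 0"
  shows "\<tau> \<alpha> t = fop i (\<rho> i (h \<alpha> i)) t"
proof -
  have "fop j (\<rho> j (h \<alpha> j)) t = 0" if "j \<in> I - {i}" for j
    using that assms lie_rep_zero[OF rep[of j]] h_mem[OF assms(1), of j]
    by (intro factor_op_zero) auto
  then show ?thesis
    unfolding tensor_rep_factors[OF assms(1,2)] sum.remove[OF finite_I assms(3)] by simp
qed

lemma tensor_rep_vanish:
  assumes "\<alpha> \<in> M" "t \<in> T" "\<And>j. j \<in> I \<Longrightarrow> h \<alpha> j = 0"
  shows "\<tau> \<alpha> t = 0"
  unfolding tensor_rep_factors[OF assms(1,2)]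
proof (rule sum.neutral, intro ballI)
  fix j assume "j \<in> I"
  then show "fop j (\<rho> j (h \<alpha> j)) t = 0"
    using assms lie_rep_zero[OF rep[of j]] h_mem[OF assms(1), of j]
    by (intro factor_op_zero) auto
qed

lemma tensor_rep_T:
  assumes "\<alpha> \<in> M" "t \<in> T"
  shows "\<tau> \<alpha> t \<in> T"
  unfolding tensor_rep_factors[OF assms]
  using assms by (intro f.subspace_sum subspace_T factor_op_T endo_rep) auto

lemma tensor_rep_commutator:
  assumes \<alpha>: "\<alpha> \<in> M" and \<beta>: "\<beta> \<in> M" and t: "t \<in> T"
  shows "\<tau> (brM \<alpha> \<beta>) t = \<tau> \<alpha> (\<tau> \<beta> t) - \<tau> \<beta> (\<tau> \<alpha> t)"
proof -
  let ?a = "\<lambda>i. fop i (\<rho> i (h \<alpha> i))" and ?b = "\<lambda>i. fop i (\<rho> i (h \<beta> i))"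
  have ab: "\<tau> \<alpha> (\<tau> \<beta> t) = (\<Sum>i\<in>I. \<Sum>j\<in>I. ?a i (?b j t))"
    unfolding tensor_rep_factors[OF \<alpha> tensor_rep_T[OF \<beta> t]]
    unfolding tensor_rep_factors[OF \<beta> t] linear_map_sum[OF factor_op_linear] ..
  have ba: "\<tau> \<beta> (\<tau> \<alpha> t) = (\<Sum>i\<in>I. \<Sum>j\<in>I. ?b j (?a i t))"
    unfolding tensor_rep_factors[OF \<beta> tensor_rep_T[OF \<alpha> t]]
    unfolding tensor_rep_factors[OF \<alpha> t] linear_map_sum[OF factor_op_linear]
    by (rule sum.swap)
  \<comment> \<open>Operators on different factors commute, so only the diagonal terms survive.\<close>
  have inner: "(\<Sum>j\<in>I. ?a i (?b j t) - ?b j (?a i t)) = fop i (\<rho> i (h (brM \<alpha> \<beta>) i)) t"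
    if i: "i \<in> I" for i
  proof -
    have "?a i (?b j t) - ?b j (?a i t) = 0" if "j \<in> I - {i}" for j
    proof -
      have j: "j \<in> I" "i \<noteq> j" using that by auto
      show ?thesis by (simp only: factor_op_commute[OF i j endo_rep[OF \<alpha> i] endo_rep[OF \<beta> j(1)] t] diff_self)
    qed
    then have "(\<Sum>j\<in>I. ?a i (?b j t) - ?b j (?a i t)) = ?a i (?b i t) - ?b i (?a i t)"
      unfolding sum.remove[OF finite_I i] by simp
    also have "\<dots> = fop i (\<lambda>v. \<rho> i (h \<alpha> i) (\<rho> i (h \<beta> i) v)) t - fop i (\<lambda>v. \<rho> i (h \<beta> i) (\<rho> i (h \<alpha> i) v)) t"
      by (simp only: factor_op_algebra(5)[OF i endo_rep[OF \<alpha> i] endo_rep[OF \<beta> i] t]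
          factor_op_algebra(5)[OF i endo_rep[OF \<beta> i] endo_rep[OF \<alpha> i] t])
    also have "\<dots> = fop i (\<lambda>v. \<rho> i (h \<alpha> i) (\<rho> i (h \<beta> i) v) - \<rho> i (h \<beta> i) (\<rho> i (h \<alpha> i) v)) t"
      by (rule factor_op_algebra(3)[symmetric, OF i _ _ t])
         (auto intro: linear_between_comp endo_rep \<alpha> \<beta> i)
    also have "\<dots> = fop i (\<rho> i (h (brM \<alpha> \<beta>) i)) t"
      by (rule factor_op_cong[symmetric, OF i endo_rep[OF M_closed(3)[OF \<alpha> \<beta>] i] _ t])
         (simp add: h_br \<alpha> \<beta> i lie_repD(4)[OF rep[OF i]] h_mem)
    finally show ?thesis .
  qed
  show ?thesis
    unfolding ab ba sum_subtractf[symmetric] tensor_rep_factors[OF M_closed(3)[OF \<alpha> \<beta>] t]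
    by (rule sum.cong) (simp_all only: inner)
qed

lemma lie_rep_tensor: "lie_rep scM brM M fscale T \<tau>"
  unfolding lie_rep_def
proof (intro conjI ballI allI)
  fix \<alpha> \<beta> t c assume \<alpha>: "\<alpha> \<in> M" and t: "t \<in> T"
  show "\<tau> (scM c \<alpha>) t = fscale c (\<tau> \<alpha> t)"
    unfolding tensor_rep_factors[OF \<alpha> t] tensor_rep_factors[OF M_closed(2)[OF \<alpha>] t] f.scale_sum_right
  proof (rule sum.cong[OF refl])
    fix i assume i: "i \<in> I"
    have "fop i (\<rho> i (h (scM c \<alpha>) i)) t = fop i (\<lambda>v. sc c (\<rho> i (h \<alpha> i) v)) t"
      by (rule factor_op_cong[OF i endo_rep[OF M_closed(2)[OF \<alpha>] i] _ t])
         (simp add: h_scale \<alpha> i lie_repD(3)[OF rep[OF i]] h_mem)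
    also have "\<dots> = fscale c (fop i (\<rho> i (h \<alpha> i)) t)"
      by (rule factor_op_algebra(4)[OF i endo_rep[OF \<alpha> i] endo_rep[OF \<alpha> i] t])
    finally show "fop i (\<rho> i (h (scM c \<alpha>) i)) t = fscale c (fop i (\<rho> i (h \<alpha> i)) t)" .
  qed
  assume \<beta>: "\<beta> \<in> M"
  show "\<tau> (\<alpha> + \<beta>) t = \<tau> \<alpha> t + \<tau> \<beta> t"
    unfolding tensor_rep_factors[OF \<alpha> t] tensor_rep_factors[OF \<beta> t]
      tensor_rep_factors[OF M_closed(1)[OF \<alpha> \<beta>] t] sum.distrib[symmetric]
  proof (rule sum.cong[OF refl])
    fix i assume i: "i \<in> I"
    have "fop i (\<rho> i (h (\<alpha> + \<beta>) i)) t = fop i (\<lambda>v. \<rho> i (h \<alpha> i) v + \<rho> i (h \<beta> i) v) t"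
      by (rule factor_op_cong[OF i endo_rep[OF M_closed(1)[OF \<alpha> \<beta>] i] _ t])
         (simp add: h_add \<alpha> \<beta> i lie_repD(2)[OF rep[OF i]] h_mem)
    also have "\<dots> = fop i (\<rho> i (h \<alpha> i)) t + fop i (\<rho> i (h \<beta> i)) t"
      by (rule factor_op_algebra(2)[OF i endo_rep[OF \<alpha> i] endo_rep[OF \<beta> i] t])
    finally show "fop i (\<rho> i (h (\<alpha> + \<beta>) i)) t = fop i (\<rho> i (h \<alpha> i)) t + fop i (\<rho> i (h \<beta> i)) t" .
  qed
  show "\<tau> (brM \<alpha> \<beta>) t = \<tau> \<alpha> (\<tau> \<beta> t) - \<tau> \<beta> (\<tau> \<alpha> t)" using tensor_rep_commutator[OF \<alpha> \<beta> t] .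
qed (auto simp: subspace_T tensor_rep_T tensor_rep_linear simp del: plus_fun_apply)

end


text \<open>
  By linearity, \<open>onto\<close> amounts to surjectivity of \<open>h\<close> onto the direct sum. It is stated in the form
  in which it is used: elements of \<open>M\<close> can act on a single factor, by any element of \<open>L i\<close>.
\<close>

locale irreducible_tensor_product =
  tensor_product_of_reps sc I V scL br L \<rho> scM brM M h
  for sc :: "'k::alg_closed_field \<Rightarrow> 'v::ab_group_add \<Rightarrow> 'v" and I :: "'i set" and V
    and scL :: "'k \<Rightarrow> 'l::ab_group_add \<Rightarrow> 'l" and br L \<rho>
    and scM :: "'k \<Rightarrow> 'm::ab_group_add \<Rightarrow> 'm" and brM M h +
  assumes irr: "i \<in> I \<Longrightarrow> irreducible_rep (L i) sc (V i) (\<rho> i)"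
    and fd: "i \<in> I \<Longrightarrow> \<exists>B. finite B \<and> V i = span B"
    and onto: "i \<in> I \<Longrightarrow> u \<in> L i \<Longrightarrow> \<exists>\<alpha>\<in>M. h \<alpha> i = u \<and> (\<forall>j\<in>I - {i}. h \<alpha> j = 0)"
begin

context
  fixes W
  assumes W: "f.subspace W" "W \<subseteq> T" and inv: "\<And>\<alpha> t. \<alpha> \<in> M \<Longrightarrow> t \<in> W \<Longrightarrow> \<tau> \<alpha> t \<in> W"
begin

lemma stable_rep:
  assumes i: "i \<in> I" and u: "u \<in> L i" and t: "t \<in> W"
  shows "fop i (\<rho> i u) t \<in> W"
proof -
  obtain \<alpha> where \<alpha>: "\<alpha> \<in> M" "h \<alpha> i = u" "\<forall>j\<in>I - {i}. h \<alpha> j = 0" using onto[OF i u] by blast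
  have "\<tau> \<alpha> t = fop i (\<rho> i (h \<alpha> i)) t"
    using \<alpha> i t W(2) by (intro tensor_rep_single) auto
  then show ?thesis using inv[OF \<alpha>(1) t] \<alpha>(2) by simp
qed

text \<open>
  The operators on the \<open>i\<close>-th factor that preserve \<open>W\<close> form an algebra. It contains the operators \<open>\<rho> i u\<close>,
  so it is irreducible, and Burnside's theorem shows in \<open>stable_endo\<close> that it contains every operator.
\<close>

lemma stable_operator_algebra:
  assumes i: "i \<in> I" and B: "finite B" "V i = span B"
  shows "irreducible_operator_algebra sc (V i) B {E. endo i E \<and> (\<forall>t\<in>W. fop i E t \<in> W)}"
    (is "irreducible_operator_algebra _ _ _ ?A")
proof (unfold_locales)
  note sub = subspace_V[OF i]
  have WT: "t \<in> T" if "t \<in> W" for t using that W(2) by auto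
  show "finite B" "V i = span B" by (fact B)+
  show "linear_between sc (V i) sc (V i) a" if "a \<in> ?A" for a using that by simp
  show "(\<lambda>v. v) \<in> ?A"
  proof -
    have id: "endo i (\<lambda>v. v)" by (auto simp: linear_between_def)
    then show ?thesis by (simp add: factor_op_algebra(1)[OF i id id WT])
  qed
  show "(\<lambda>v. a v + b v) \<in> ?A" if "a \<in> ?A" "b \<in> ?A" for a b
  proof -
    have ab: "endo i a" "endo i b" using that by auto
    have "endo i (\<lambda>v. a v + b v)"
      using sub by (auto intro!: linear_betweenI simp: linear_betweenD[OF ab(1)] linear_betweenD[OF ab(2)]
          subspace_add scale_right_distrib)
    moreover have "fop i (\<lambda>v. a v + b v) t \<in> W" if "t \<in> W" for t
      unfolding factor_op_algebra(2)[OF i ab WT[OF that]]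
      using \<open>a \<in> ?A\<close> \<open>b \<in> ?A\<close> that by (intro f.subspace_add W(1)) auto
    ultimately show ?thesis by blast
  qed
  show "(\<lambda>v. sc c (a v)) \<in> ?A" if "a \<in> ?A" for a c
  proof -
    have a: "endo i a" using that by auto
    have "endo i (\<lambda>v. sc c (a v))"
      using sub by (auto intro!: linear_betweenI simp: linear_betweenD[OF a] subspace_scale scale_right_distrib
          mult.commute)
    moreover have "fop i (\<lambda>v. sc c (a v)) t \<in> W" if "t \<in> W" for t
      unfolding factor_op_algebra(4)[OF i a a WT[OF that]]
      using \<open>a \<in> ?A\<close> that by (intro f.subspace_scale W(1)) auto
    ultimately show ?thesis by blast
  qed
  show "(\<lambda>v. a (b v)) \<in> ?A" if "a \<in> ?A" "b \<in> ?A" for a b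
  proof -
    have ab: "endo i a" "endo i b" using that by auto
    then have "endo i (\<lambda>v. a (b v))" by (rule linear_between_comp[rotated])
    moreover have "fop i (\<lambda>v. a (b v)) t \<in> W" if "t \<in> W" for t
      unfolding factor_op_algebra(5)[OF i ab WT[OF that]]
      using \<open>a \<in> ?A\<close> \<open>b \<in> ?A\<close> that by auto
    ultimately show ?thesis by blast
  qed
  have "\<rho> i u \<in> ?A" if "u \<in> L i" for u
    using lie_repD(1)[OF rep[OF i] that] stable_rep[OF i that] by blast
  then show "irreducible_rep ?A sc (V i) (\<lambda>a. a)"
    using irr[OF i] unfolding irreducible_rep_def by meson
qed

lemma stable_endo:
  assumes i: "i \<in> I" and E: "endo i E" and t: "t \<in> W"
  shows "fop i E t \<in> W"
proof -
  obtain B where B: "finite B" "V i = span B" using fd[OF i] by blast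
  obtain a where a: "endo i a" "\<And>t. t \<in> W \<Longrightarrow> fop i a t \<in> W" "\<And>v. v \<in> V i \<Longrightarrow> a v = E v"
    using irreducible_operator_algebra.burnside[OF stable_operator_algebra[OF i B] E] by blast
  have "fop i a t = fop i E t" using t W(2) by (intro factor_op_cong i a) auto
  then show ?thesis using a(2)[OF t] by simp
qed

text \<open>
  A nonzero element of \<open>W\<close> is decomposed along a basis of the \<open>i\<close>-th factor; each component is its image
  under a projection of that factor, so it lies in \<open>W\<close> again, and some component does not vanish.
\<close>

lemma stable_localize:
  assumes J: "J \<subseteq> I" and t0: "t0 \<in> W" "t0 \<noteq> 0"
  shows "\<exists>b\<in>Pi\<^sub>E I V. \<exists>t\<in>W. t \<noteq> 0 \<and> t \<in> f.span (pure ` {v\<in>Pi\<^sub>E I V. \<forall>i\<in>J. v i = b i})"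
  using finite_subset[OF J finite_I] J
proof (induction J rule: finite_induct)
  case empty
  have "(\<lambda>i\<in>I. 0) \<in> Pi\<^sub>E I V" using subspace_0[OF subspace_V] by auto
  moreover have "t0 \<in> f.span (pure ` Pi\<^sub>E I V)" using t0(1) W(2) by (auto simp: tensor_space_def)
  moreover have "{v\<in>Pi\<^sub>E I V. \<forall>i\<in>{}. v i = b i} = Pi\<^sub>E I V" for b :: "'i \<Rightarrow> 'v" by simp
  ultimately have "t0 \<in> f.span (pure ` {v\<in>Pi\<^sub>E I V. \<forall>i\<in>{}. v i = (\<lambda>i\<in>I. 0) i})" by (simp only:)
  with \<open>(\<lambda>i\<in>I. 0) \<in> Pi\<^sub>E I V\<close> t0 show ?case by blast
next
  case (insert i J)
  then have i: "i \<in> I" by simp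
  obtain b t where b: "b \<in> Pi\<^sub>E I V" and t: "t \<in> W" "t \<noteq> 0"
    "t \<in> f.span (pure ` {v\<in>Pi\<^sub>E I V. \<forall>i\<in>J. v i = b i})" using insert.IH insert.prems by blast
  have tT: "t \<in> T" using t(1) W(2) by auto
  obtain B where B: "finite B" "V i = span B" using fd[OF i] by blast
  obtain C where C: "C \<subseteq> B" "independent C" "B \<subseteq> span C"
    using maximal_independent_subset[of B] by blast
  have VC: "V i = span C" unfolding B(2) using C(1,3) by (metis span_mono span_span subset_antisym)
  have finC: "finite C" using finite_subset[OF C(1) B(1)] .
  let ?P = "\<lambda>c v. sc (representation C v c) c"
  have CV: "c \<in> V i" if "c \<in> C" for c using that VC span_base by auto
  have P: "endo i (?P c)" if "c \<in> C" for c
    using CV[OF that] subspace_scale[OF subspace_V[OF i]]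
    by (auto intro!: linear_betweenI simp: VC representation_add[OF C(2)] representation_scale[OF C(2)]
        scale_left_distrib)
  have sumP: "(\<Sum>c\<in>C. ?P c v) = v" if "v \<in> V i" for v
    using sum_representation_eq[OF C(2) _ finC subset_refl] that VC by auto
  have "(\<Sum>c\<in>C. fop i (?P c) t) = t"
  proof (rule T_linear_eqI[OF linear_family_sum linear_id _ tT])
    fix v assume v: "v \<in> Pi\<^sub>E I V"
    have "(\<Sum>c\<in>C. fop i (?P c) (pure v)) = (\<Sum>c\<in>C. pure (v(i := ?P c (v i))))"
      by (rule sum.cong) (simp_all add: factor_op_pure[OF v i P])
    also have "\<dots> = pure (v(i := (\<Sum>c\<in>C. ?P c (v i))))"
      using v i by (intro linear_between_sum[symmetric, OF pure_upd_linear[OF v i] vector_space_axioms subspace_V[OF i]])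
        (auto intro: linear_betweenD(1)[OF P])
    also have "\<dots> = pure v" using sumP[OF PiE_component[OF v i]] by simp
    finally show "(\<Sum>c\<in>C. fop i (?P c) (pure v)) = pure v" .
  qed (rule factor_op_linear)
  then have "\<not> (\<forall>c\<in>C. fop i (?P c) t = 0)" using t(2) sum.neutral[of C "\<lambda>c. fop i (?P c) t"] by argo
  then obtain c where c: "c \<in> C" "fop i (?P c) t \<noteq> 0" by blast
  let ?S = "{v\<in>Pi\<^sub>E I V. \<forall>j\<in>insert i J. v j = (b(i := c)) j}"
  interpret fo: Vector_Spaces.linear fscale fscale "fop i (?P c)" by (rule factor_op_linear)
  have "fop i (?P c) t \<in> f.span (pure ` ?S)" using t(3)
  proof (induction rule: f.span_induct_alt)
    case base
    show ?case unfolding fo.zero by (rule f.span_zero)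
  next
    case (step r x y)
    then obtain v where v: "v \<in> Pi\<^sub>E I V" "\<forall>i\<in>J. v i = b i" "x = pure v" by auto
    have "v(i := c) \<in> ?S" using v insert.hyps(2) CV[OF c(1)] i by (auto intro!: PiE_upd)
    then have *: "pure (v(i := c)) \<in> f.span (pure ` ?S)" by (intro f.span_base imageI)
    have "fop i (?P c) x = fscale (representation C (v i) c) (pure (v(i := c)))"
      unfolding v(3) factor_op_pure[OF v(1) i P[OF c(1)]]
      by (rule linear_betweenD(3)[OF pure_upd_linear[OF v(1) i] CV[OF c(1)]])
    then show ?case unfolding fo.add fo.scale
      using step(2) * by (simp only: f.span_add f.span_scale)
  qed
  moreover have "b(i := c) \<in> Pi\<^sub>E I V" using b i CV[OF c(1)] by (rule PiE_upd)
  ultimately show ?case using c(2) stable_endo[OF i P[OF c(1)] t(1)] by blast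
qed

text \<open>
  With all positions localized, \<open>W\<close> contains a pure tensor of nonzero vectors \<open>b i\<close>. Operators on the single
  factors turn each \<open>b i\<close> into an arbitrary vector, so \<open>W\<close> contains all pure tensors.
\<close>

lemma stable_is_everything:
  assumes "W \<noteq> {0}"
  shows "W = T"
proof -
  obtain t0 where "t0 \<in> W" "t0 \<noteq> 0" using assms f.subspace_0[OF W(1)] by blast
  from stable_localize[OF subset_refl this] obtain b t where
    b: "b \<in> Pi\<^sub>E I V" and t: "t \<in> W" "t \<noteq> 0" "t \<in> f.span (pure ` {v\<in>Pi\<^sub>E I V. \<forall>i\<in>I. v i = b i})"
    by blast
  have "{v\<in>Pi\<^sub>E I V. \<forall>i\<in>I. v i = b i} = {b}" using b by (auto intro: PiE_ext)
  with t(3) have "t \<in> f.span {pure b}" by simp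
  then obtain r where r: "t = fscale r (pure b)" unfolding f.span_singleton by blast
  then have "r \<noteq> 0" and b0: "pure b \<noteq> 0" using t(2) by (auto simp: f.scale_zero_left f.scale_zero_right)
  have "fscale (inverse r) t = pure b" unfolding r using \<open>r \<noteq> 0\<close> by simp
  then have bW: "pure b \<in> W" using f.subspace_scale[OF W(1) t(1)] by metis
  have b_i: "b i \<noteq> 0" if "i \<in> I" for i
    using pure_upd_zero[OF b that] b0 by (metis fun_upd_triv)
  have *: "pure (\<lambda>i. if i \<in> J then v i else b i) \<in> W" if "J \<subseteq> I" and v: "v \<in> Pi\<^sub>E I V" for v J
    using finite_subset[OF that(1) finite_I] that(1)
  proof (induction J rule: finite_induct)
    case empty
    show ?case using bW by simp
  next
    case (insert i J)
    then have i: "i \<in> I" by simp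
    let ?w = "\<lambda>i. if i \<in> J then v i else b i"
    have w: "?w \<in> Pi\<^sub>E I V" using b v insert.prems by (auto simp: PiE_iff extensional_def)
    obtain B where B: "finite B" "V i = span B" using fd[OF i] by blast
    have "\<exists>a\<in>{E. endo i E \<and> (\<forall>t\<in>W. fop i E t \<in> W)}. \<forall>s\<in>{b i}. a s = v i"
      by (rule irreducible_operator_algebra.density[OF stable_operator_algebra[OF i B]])
         (use b_i[OF i] b v i in auto)
    then obtain a where a: "endo i a" "\<And>t. t \<in> W \<Longrightarrow> fop i a t \<in> W" "a (b i) = v i" by blast
    have "fop i a (pure ?w) = pure (\<lambda>j. if j \<in> insert i J then v j else b j)"
      unfolding factor_op_pure[OF w i a(1)] using insert.hyps(2) a(3)
      by (intro arg_cong[of _ _ pure]) (auto simp: fun_eq_iff)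
    then show ?case using a(2)[OF insert.IH] insert.prems by simp
  qed
  have "pure v \<in> W" if "v \<in> Pi\<^sub>E I V" for v
  proof -
    have "(\<lambda>i. if i \<in> I then v i else b i) = v" using b that by (auto simp: fun_eq_iff PiE_iff extensional_def)
    with *[OF subset_refl that] show ?thesis by simp
  qed
  then have "T \<subseteq> W" unfolding tensor_space_def by (intro f.span_minimal W(1)) auto
  with W(2) show ?thesis by simp
qed

end

theorem irreducible_tensor: "irreducible_rep M fscale T \<tau>"
  unfolding irreducible_rep_def
proof (intro conjI allI impI; (elim conjE)?)
  show "T \<noteq> {0}"
  proof -
    have "\<exists>x. x \<in> V i \<and> x \<noteq> 0" if "i \<in> I" for i
      using irr[OF that] subspace_0[OF subspace_V[OF that]] unfolding irreducible_rep_def by blast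
    then have "\<forall>i\<in>I. \<exists>x. x \<in> V i \<and> x \<noteq> 0" by blast
    from bchoice[OF this] obtain v where v: "\<forall>i\<in>I. v i \<in> V i \<and> v i \<noteq> 0" by blast
    then have "restrict v I \<in> Pi\<^sub>E I V" "\<And>i. i \<in> I \<Longrightarrow> restrict v I i \<noteq> 0" by auto
    from pure_nonzero[OF this] pure_in_T[OF this(1)] show ?thesis by blast
  qed
  fix W assume "f.subspace W" "W \<subseteq> T" "\<forall>\<alpha>\<in>M. \<forall>t\<in>W. \<tau> \<alpha> t \<in> W"
  then show "W = {0} \<or> W = T" using stable_is_everything[of W] by blast
qed

end


section \<open>Isomorphism classes\<close>

lemma rep_iso_refl: "rep_iso L sc V \<rho> sc V \<rho>"
  unfolding rep_iso_def by (rule exI[of _ "\<lambda>v. v"]) (auto simp: bij_betw_def inj_on_def)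

lemma lie_rep_closed:
  assumes "vector_space sc" "lie_rep scL br L sc V \<rho>"
  shows "v \<in> V \<Longrightarrow> w \<in> V \<Longrightarrow> v + w \<in> V" "v \<in> V \<Longrightarrow> sc c v \<in> V"
    "u \<in> L \<Longrightarrow> v \<in> V \<Longrightarrow> \<rho> u v \<in> V" "module.subspace sc V"
proof -
  interpret vector_space sc by fact
  show "v \<in> V \<Longrightarrow> w \<in> V \<Longrightarrow> v + w \<in> V" "v \<in> V \<Longrightarrow> sc c v \<in> V"
    "u \<in> L \<Longrightarrow> v \<in> V \<Longrightarrow> \<rho> u v \<in> V" "subspace V"
    using assms(2) by (auto simp: lie_rep_def subspace_add subspace_scale)
qed

text \<open>
  The linear extension of an injection of a basis into the unit vectors of the sequence space embeds
  \<open>V\<close>, and the representation is carried over along this embedding.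
\<close>

lemma fd_copy:
  fixes sc :: "'k::field \<Rightarrow> 'v::ab_group_add \<Rightarrow> 'v" and scL :: "'k \<Rightarrow> 'l::ab_group_add \<Rightarrow> 'l"
  assumes sc: "vector_space sc" and rep: "lie_rep scL br L sc V \<rho>"
    and L: "\<And>u t. u \<in> L \<Longrightarrow> t \<in> L \<Longrightarrow> u + t \<in> L" "\<And>c u. u \<in> L \<Longrightarrow> scL c u \<in> L"
      "\<And>u t. u \<in> L \<Longrightarrow> t \<in> L \<Longrightarrow> br u t \<in> L"
    and fd: "finite B" "V = module.span sc B"
  shows "\<exists>W \<sigma>. (W, \<sigma>) \<in> fd_reps scL br L \<and> rep_iso L sc V \<rho> fscale W \<sigma>"
proof -
  interpret vector_space sc by fact
  interpret f: vector_space "fscale :: 'k \<Rightarrow> (nat \<Rightarrow> 'k) \<Rightarrow> _" by (rule vector_space_fscale)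
  interpret p: vector_space_pair sc "fscale :: 'k \<Rightarrow> (nat \<Rightarrow> 'k) \<Rightarrow> _" by unfold_locales
  obtain C where C: "C \<subseteq> B" "independent C" "B \<subseteq> span C"
    using maximal_independent_subset[of B] by blast
  have VC: "V = span C" unfolding fd(2) using C(1,3) by (metis span_mono span_span subset_antisym)
  have finC: "finite C" using finite_subset[OF C(1) fd(1)] .
  obtain e :: "'v \<Rightarrow> nat" where e: "inj_on e C" using finC finite_imp_inj_to_nat_seg by meson
  obtain F where F: "Vector_Spaces.linear sc fscale F"
    "\<And>b. b \<in> C \<Longrightarrow> F b = (\<lambda>n. if n = e b then 1 else (0::'k))"
    using p.linear_independent_extend[OF C(2), of "\<lambda>b n. if n = e b then 1 else 0"] by auto
  interpret F: Vector_Spaces.linear sc fscale F by (rule F(1))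
  have inj: "inj_on F V"
  proof (rule inj_onI)
    fix v w assume vw: "v \<in> V" "w \<in> V" "F v = F w"
    have rep_eq: "representation C x b = F x (e b)" if "x \<in> V" "b \<in> C" for x b
    proof -
      have "F x = F (\<Sum>b\<in>C. sc (representation C x b) b)"
        using sum_representation_eq[OF C(2) _ finC subset_refl, of x] that VC by simp
      also have "\<dots> = (\<Sum>b\<in>C. fscale (representation C x b) (F b))"
        by (simp only: F.sum F.scale)
      finally have "F x (e b) = (\<Sum>b'\<in>C. if b' = b then representation C x b' else 0)"
        unfolding sum_fun_apply using e that(2) F(2)
        by (auto simp: sum_fun_apply fscale_def inj_on_eq_iff intro!: sum.cong)
      then show ?thesis using finC that(2) by simp
    qed
    have "v = (\<Sum>b\<in>C. sc (representation C v b) b)"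
      using sum_representation_eq[OF C(2) _ finC subset_refl, of v] vw VC by simp
    also have "\<dots> = (\<Sum>b\<in>C. sc (representation C w b) b)"
      by (rule sum.cong) (simp_all add: rep_eq vw)
    also have "\<dots> = w"
      using sum_representation_eq[OF C(2) _ finC subset_refl, of w] vw VC by simp
    finally show "v = w" .
  qed
  note cl = lie_rep_closed[OF sc rep]
  define G where "G = inv_into V F"
  define W where "W = F ` V"
  define \<sigma> where "\<sigma> u w = F (\<rho> u (G w))" for u w
  have G: "G (F v) = v" if "v \<in> V" for v unfolding G_def using inj that by simp
  have "lie_rep scL br L fscale W \<sigma>"
    unfolding lie_rep_def
  proof (intro conjI ballI allI)
    show "f.subspace W" unfolding W_def using cl(4) by (rule p.linear_subspace_image[OF F(1)])
    fix u v c assume u: "u \<in> L" and "v \<in> W"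
    then obtain v' where v: "v' \<in> V" "v = F v'" unfolding W_def by blast
    show "\<sigma> u v \<in> W" using cl(3)[OF u v(1)] v by (simp add: \<sigma>_def W_def G)
    have "\<sigma> u (fscale c v) = F (\<rho> u (G (F (sc c v'))))" unfolding v(2) F.scale \<sigma>_def ..
    also have "\<dots> = fscale c (\<sigma> u v)"
      unfolding G[OF cl(2)[OF v(1)]] v(2) \<sigma>_def G[OF v(1)]
      unfolding linear_betweenD(3)[OF lie_repD(1)[OF rep u] v(1)] F.scale ..
    finally show "\<sigma> u (fscale c v) = fscale c (\<sigma> u v)" .
    show "\<sigma> (scL c u) v = fscale c (\<sigma> u v)"
      using u v lie_repD(3)[OF rep u] by (simp add: G \<sigma>_def F.scale)
    fix t assume t: "t \<in> L"
    show "\<sigma> (u + t) v = \<sigma> u v + \<sigma> t v"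
      unfolding v(2) \<sigma>_def G[OF v(1)] lie_repD(2)[OF rep u t v(1)] F.add ..
    show "\<sigma> (br u t) v = \<sigma> u (\<sigma> t v) - \<sigma> t (\<sigma> u v)"
      unfolding v(2) \<sigma>_def G[OF v(1)] G[OF cl(3)[OF u v(1)]] G[OF cl(3)[OF t v(1)]]
        lie_repD(4)[OF rep u t v(1)] F.diff ..
  next
    fix u v w assume u: "u \<in> L" and "v \<in> W" "w \<in> W"
    then obtain v' w' where v: "v' \<in> V" "v = F v'" and w: "w' \<in> V" "w = F w'" unfolding W_def by blast
    have "\<sigma> u (v + w) = F (\<rho> u (G (F (v' + w'))))" unfolding v(2) w(2) F.add \<sigma>_def ..
    also have "\<dots> = \<sigma> u v + \<sigma> u w"
      unfolding G[OF cl(1)[OF v(1) w(1)]] v(2) w(2) \<sigma>_def G[OF v(1)] G[OF w(1)]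
      unfolding linear_betweenD(2)[OF lie_repD(1)[OF rep u] v(1) w(1)] F.add ..
    finally show "\<sigma> u (v + w) = \<sigma> u v + \<sigma> u w" .
  qed
  moreover have "W = f.span (F ` B)"
    unfolding W_def fd(2) by (rule p.linear_span_image[OF F(1), symmetric])
  then have "\<exists>D. finite D \<and> W = f.span D" using fd(1) by blast
  ultimately have "(W, \<sigma>) \<in> fd_reps scL br L" by (simp add: fd_reps_def)
  moreover have "rep_iso L sc V \<rho> fscale W \<sigma>"
    unfolding rep_iso_iff_linear_between
  proof (intro exI conjI ballI)
    show "bij_betw F V W" using inj by (simp add: bij_betw_def W_def)
    show "linear_between sc V fscale W F" by (rule linear_between_linear[OF F(1)]) (simp add: W_def)
    show "F (\<rho> u v) = \<sigma> u (F v)" if "v \<in> V" for u v using that by (simp add: \<sigma>_def G)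
  qed
  ultimately show ?thesis by blast
qed

lemma fd_repsD:
  assumes "(V, \<rho>) \<in> fd_reps scL br L"
  shows "lie_rep scL br L fscale V \<rho>" "\<exists>B. finite B \<and> V = module.span fscale B"
  using assms by (auto simp: fd_reps_def)

lemma iso_class_eqI:
  assumes "lie_rep scL br L fscale V \<rho>" "rep_iso L fscale V \<rho> fscale W \<sigma>"
  shows "iso_class scL br L fscale V \<rho> = iso_class scL br L fscale W \<sigma>"
  using assms(2) lie_rep_closed(1-3)[OF vector_space_fscale assms(1)] by (rule iso_class_cong) blast+

lemma irr_classes_member:
  assumes c: "c \<in> irr_classes scL br L" and r: "(V, \<rho>) \<in> c"
  shows "lie_rep scL br L fscale V \<rho>" "\<exists>B. finite B \<and> V = module.span fscale B"
    "irreducible_rep L fscale V \<rho>" "c = iso_class scL br L fscale V \<rho>"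
proof -
  from c obtain U \<sigma> where U: "(U, \<sigma>) \<in> fd_reps scL br L" "irreducible_rep L fscale U \<sigma>"
    and c_eq: "c = iso_class scL br L fscale U \<sigma>" by (auto simp: irr_classes_def)
  have V: "(V, \<rho>) \<in> fd_reps scL br L" "rep_iso L fscale U \<sigma> fscale V \<rho>"
    using r unfolding c_eq iso_class_def by auto
  show "lie_rep scL br L fscale V \<rho>" "\<exists>B. finite B \<and> V = module.span fscale B"
    using fd_repsD[OF V(1)] by auto
  note U' = fd_repsD[OF U(1)]
  show "irreducible_rep L fscale V \<rho>"
    by (rule irreducible_rep_iso[OF vector_space_fscale lie_rep_closed(4)[OF vector_space_fscale U'(1)]
          lie_repD(1)[OF U'(1)] U(2) vector_space_fscale V(2)])
  show "c = iso_class scL br L fscale V \<rho>"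
    unfolding c_eq by (rule iso_class_eqI[OF U'(1) V(2)])
qed

lemma irr_classes_nonempty:
  assumes "c \<in> irr_classes scL br L"
  shows "\<exists>r. r \<in> c"
proof -
  from assms obtain U \<sigma> where "(U, \<sigma>) \<in> fd_reps scL br L" "c = iso_class scL br L fscale U \<sigma>"
    by (auto simp: irr_classes_def)
  then have "(U, \<sigma>) \<in> c" by (simp add: iso_class_def rep_iso_refl)
  then show ?thesis ..
qed

lemma irr_classes_member_iso:
  assumes "c \<in> irr_classes scL br L" "(V, \<rho>) \<in> c" "(W, \<sigma>) \<in> c"
  shows "rep_iso L fscale V \<rho> fscale W \<sigma>"
  using assms(3) unfolding irr_classes_member(4)[OF assms(1,2)] by (simp add: iso_class_def)


section \<open>Evaluation of equivariant maps\<close>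

context equivariant_map_algebra
begin

sublocale fM: vector_space "fscale :: 'k \<Rightarrow> (('g \<times> 'a \<Rightarrow> 'k) \<Rightarrow> 'k) \<Rightarrow> _"
  by (rule vector_space_fscale)

lemma subspace_gA: "fM.subspace gA"
  by (simp add: gA_def)

lemma tens_in_gA: "tens u f \<in> gA"
  unfolding gA_def by (rule fM.span_base) blast

lemma gA_induct [consumes 1, case_names tens add scale]:
  assumes "\<alpha> \<in> gA" "\<And>u f. P (tens u f)"
    "\<And>\<alpha> \<beta>. \<alpha> \<in> gA \<Longrightarrow> \<beta> \<in> gA \<Longrightarrow> P \<alpha> \<Longrightarrow> P \<beta> \<Longrightarrow> P (\<alpha> + \<beta>)"
    "\<And>c \<alpha>. \<alpha> \<in> gA \<Longrightarrow> P \<alpha> \<Longrightarrow> P (fscale c \<alpha>)"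
  shows "P \<alpha>"
proof -
  have "\<alpha> \<in> gA \<and> P \<alpha>" using assms(1) unfolding gA_def
  proof (induction rule: fM.span_induct_alt)
    case base
    have "P (fscale 0 (tens 0 0))" by (rule assms(4)[OF tens_in_gA assms(2)])
    then show ?case unfolding fM.scale_zero_left by (intro conjI fM.span_zero)
  next
    case (step c x y)
    then obtain u f where x: "x = tens u f" by blast
    have y: "y \<in> gA" "P y" using step(2) by (simp_all only: gA_def)
    show ?case unfolding x gA_def[symmetric]
      by (intro conjI assms(2,3,4) y tens_in_gA fM.subspace_add[OF subspace_gA] fM.subspace_scale[OF subspace_gA])
  qed
  then show ?thesis ..
qed

lemma gA_induct2 [consumes 2, case_names tens add_left scale_left add_right scale_right]:
  assumes \<alpha>: "\<alpha> \<in> gA" and \<beta>: "\<beta> \<in> gA"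
    and tens: "\<And>u f v h. P (tens u f) (tens v h)"
    and left: "\<And>\<alpha> \<alpha>' \<beta>. \<alpha> \<in> gA \<Longrightarrow> \<alpha>' \<in> gA \<Longrightarrow> \<beta> \<in> gA \<Longrightarrow> P \<alpha> \<beta> \<Longrightarrow> P \<alpha>' \<beta> \<Longrightarrow> P (\<alpha> + \<alpha>') \<beta>"
      "\<And>c \<alpha> \<beta>. \<alpha> \<in> gA \<Longrightarrow> \<beta> \<in> gA \<Longrightarrow> P \<alpha> \<beta> \<Longrightarrow> P (fscale c \<alpha>) \<beta>"
    and right: "\<And>\<alpha> \<beta> \<beta>'. \<alpha> \<in> gA \<Longrightarrow> \<beta> \<in> gA \<Longrightarrow> \<beta>' \<in> gA \<Longrightarrow> P \<alpha> \<beta> \<Longrightarrow> P \<alpha> \<beta>' \<Longrightarrow> P \<alpha> (\<beta> + \<beta>')"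
      "\<And>c \<alpha> \<beta>. \<alpha> \<in> gA \<Longrightarrow> \<beta> \<in> gA \<Longrightarrow> P \<alpha> \<beta> \<Longrightarrow> P \<alpha> (fscale c \<beta>)"
  shows "P \<alpha> \<beta>"
  using \<alpha>
proof (induction rule: gA_induct)
  case (tens u f)
  show ?case using \<beta>
    by (induction rule: gA_induct) (blast intro: assms(3) right tens_in_gA)+
qed (blast intro: left \<beta>)+

lemma X_rat_linear: "x \<in> X_rat \<Longrightarrow> Vector_Spaces.linear scA (*) x"
  by (simp add: X_rat_def)

lemma fscale_sum_list:
  "fscale c (\<Sum>(u, f)\<leftarrow>ps. tens u f) = (\<Sum>(u, f)\<leftarrow>map (\<lambda>(u, f). (u, scA c f)) ps. tens u f)"
proof (induction ps)
  case Nil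
  show ?case by (simp only: list.map sum_list.Nil fM.scale_zero_right)
next
  case (Cons p ps)
  obtain u f where "p = (u, f)" by (cases p)
  then show ?case
    by (simp only: list.map sum_list.Cons split_conv fM.scale_right_distrib Cons.IH tens_bilinear)
qed

lemma gA_as_list:
  assumes "\<alpha> \<in> gA"
  shows "\<exists>ps. \<alpha> = (\<Sum>(u, f)\<leftarrow>ps. tens u f)"
  using assms
proof (induction rule: gA_induct)
  case (tens u f)
  have "tens u f = (\<Sum>(u, f)\<leftarrow>[(u, f)]. tens u f)" by (simp only: list.map sum_list.Cons sum_list.Nil split_conv add_0_right)
  then show ?case by blast
next
  case (add \<alpha> \<beta>)
  then obtain ps qs where "\<alpha> = (\<Sum>(u, f)\<leftarrow>ps. tens u f)" "\<beta> = (\<Sum>(u, f)\<leftarrow>qs. tens u f)" by blast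
  then have "\<alpha> + \<beta> = (\<Sum>(u, f)\<leftarrow>ps @ qs. tens u f)" by (simp only: map_append sum_list_append)
  then show ?case by blast
next
  case (scale c \<alpha>)
  then obtain ps where ps: "\<alpha> = (\<Sum>(u, f)\<leftarrow>ps. tens u f)" by blast
  show ?case unfolding ps fscale_sum_list by blast
qed

text \<open>
  By \<open>ev_at_sum\<close> the value does not depend on the expression of the tensor as a sum, so sums and multiples may be
  computed on suitable expressions.
\<close>

lemma ev_at_linear:
  assumes x: "x \<in> X_rat"
  shows "ev_at x (tens u f) = scg (x f) u"
    and "\<alpha> \<in> gA \<Longrightarrow> \<beta> \<in> gA \<Longrightarrow> ev_at x (\<alpha> + \<beta>) = ev_at x \<alpha> + ev_at x \<beta>"
    and "\<alpha> \<in> gA \<Longrightarrow> ev_at x (fscale c \<alpha>) = scg c (ev_at x \<alpha>)"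
    and "(\<And>i. i \<in> S \<Longrightarrow> \<phi> i \<in> gA) \<Longrightarrow> ev_at x (\<Sum>i\<in>S. \<phi> i) = (\<Sum>i\<in>S. ev_at x (\<phi> i))"
proof -
  interpret x: Vector_Spaces.linear scA "(*)" x using X_rat_linear[OF x] .
  note list = ev_at_sum[OF x]
  show "ev_at x (tens u f) = scg (x f) u" for u f
    using list[of "[(u, f)]"] by (simp only: list.map sum_list.Cons sum_list.Nil split_conv add_0_right)
  show add: "ev_at x (\<alpha> + \<beta>) = ev_at x \<alpha> + ev_at x \<beta>" if "\<alpha> \<in> gA" "\<beta> \<in> gA" for \<alpha> \<beta>
  proof -
    obtain ps qs where "\<alpha> = (\<Sum>(u, f)\<leftarrow>ps. tens u f)" "\<beta> = (\<Sum>(u, f)\<leftarrow>qs. tens u f)"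
      using gA_as_list[OF \<open>\<alpha> \<in> gA\<close>] gA_as_list[OF \<open>\<beta> \<in> gA\<close>] by blast
    then show ?thesis using list[of "ps @ qs"] by (simp only: map_append sum_list_append list)
  qed
  show scale: "ev_at x (fscale c \<alpha>) = scg c (ev_at x \<alpha>)" if "\<alpha> \<in> gA" for c \<alpha>
  proof -
    obtain ps where ps: "\<alpha> = (\<Sum>(u, f)\<leftarrow>ps. tens u f)" using gA_as_list[OF \<open>\<alpha> \<in> gA\<close>] by blast
    have "(\<Sum>(u, f)\<leftarrow>map (\<lambda>(u, f). (u, scA c f)) ps. scg (x f) u) = scg c (\<Sum>(u, f)\<leftarrow>ps. scg (x f) u)"
      by (induction ps) (auto simp: x.scale g.scale_right_distrib)
    then show ?thesis unfolding ps fscale_sum_list list .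
  qed
  have zero: "ev_at x 0 = 0"
    using scale[OF tens_in_gA, of 0] unfolding fM.scale_zero_left g.scale_zero_left .
  show "ev_at x (\<Sum>i\<in>S. \<phi> i) = (\<Sum>i\<in>S. ev_at x (\<phi> i))" if "\<And>i. i \<in> S \<Longrightarrow> \<phi> i \<in> gA"
  proof (cases "finite S")
    case True
    then show ?thesis using that
    proof induction
      case empty
      show ?case unfolding sum.empty by (rule zero)
    next
      case (insert i S)
      have "(\<Sum>i\<in>S. \<phi> i) \<in> gA" by (rule fM.subspace_sum[OF subspace_gA]) (use insert.prems in blast)
      then show ?case
        using insert by (simp only: sum.insert[OF insert.hyps] add insert_iff simp_thms)
    qed
  next
    case False
    show ?thesis unfolding sum.infinite[OF False] by (rule zero)
  qed
qed

lemma actgA_in_gA: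
  assumes \<gamma>: "\<gamma> \<in> carrier \<Gamma>" and "\<alpha> \<in> gA"
  shows "actgA \<gamma> \<alpha> \<in> gA"
  using assms(2)
proof (induction rule: gA_induct)
  case (tens u f)
  show ?case unfolding actgA_tens[OF \<gamma>] by (rule tens_in_gA)
next
  case (add \<alpha> \<beta>)
  then show ?case unfolding actgA_linear by (intro fM.subspace_add subspace_gA)
next
  case (scale c \<alpha>)
  then show ?case unfolding actgA_linear by (intro fM.subspace_scale subspace_gA)
qed

lemma brA_in_gA:
  assumes "\<alpha> \<in> gA" "\<beta> \<in> gA"
  shows "brA \<alpha> \<beta> \<in> gA"
  using assms
proof (induction rule: gA_induct2)
  case (tens u f v h)
  show ?case unfolding brA_tens by (rule tens_in_gA)
next
  case (add_left \<alpha> \<alpha>' \<beta>)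
  then show ?case unfolding brA_bilinear(1)[OF add_left(1,3,3)] by (intro fM.subspace_add subspace_gA)
next
  case (scale_left c \<alpha> \<beta>)
  then show ?case unfolding brA_bilinear(2)[OF scale_left(1,2,2)] by (intro fM.subspace_scale subspace_gA)
next
  case (add_right \<alpha> \<beta> \<beta>')
  then show ?case unfolding brA_bilinear(3)[OF add_right(1-3)] by (intro fM.subspace_add subspace_gA)
next
  case (scale_right c \<alpha> \<beta>)
  then show ?case unfolding brA_bilinear(4)[OF scale_right(1,2,2)] by (intro fM.subspace_scale subspace_gA)
qed

lemma ev_at_br:
  assumes x: "x \<in> X_rat" and "\<alpha> \<in> gA" "\<beta> \<in> gA"
  shows "ev_at x (brA \<alpha> \<beta>) = br (ev_at x \<alpha>) (ev_at x \<beta>)"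
  using assms(2,3)
proof (induction rule: gA_induct2)
  case (tens u f v h)
  have "x (f * h) = x f * x h" using x by (simp add: X_rat_def)
  then show ?case by (simp add: brA_tens ev_at_linear(1)[OF x] br_bilinear mult.commute)
next
  case (add_left \<alpha> \<alpha>' \<beta>)
  then show ?case
    unfolding brA_bilinear(1)[OF add_left(1,3,3)] ev_at_linear(2)[OF x add_left(1,2)]
      ev_at_linear(2)[OF x brA_in_gA[OF add_left(1,3)] brA_in_gA[OF add_left(2,3)]] br_bilinear by simp
next
  case (scale_left c \<alpha> \<beta>)
  then show ?case
    unfolding brA_bilinear(2)[OF scale_left(1,2,2)] ev_at_linear(3)[OF x scale_left(1)]
      ev_at_linear(3)[OF x brA_in_gA[OF scale_left(1,2)]] br_bilinear by simp
next
  case (add_right \<alpha> \<beta> \<beta>')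
  then show ?case
    unfolding brA_bilinear(3)[OF add_right(1-3)] ev_at_linear(2)[OF x add_right(2,3)]
      ev_at_linear(2)[OF x brA_in_gA[OF add_right(1,2)] brA_in_gA[OF add_right(1,3)]] br_bilinear by simp
next
  case (scale_right c \<alpha> \<beta>)
  then show ?case
    unfolding brA_bilinear(4)[OF scale_right(1,2,2)] ev_at_linear(3)[OF x scale_right(2)]
      ev_at_linear(3)[OF x brA_in_gA[OF scale_right(1,2)]] br_bilinear by simp
qed

lemma actgA_br:
  assumes \<gamma>: "\<gamma> \<in> carrier \<Gamma>" and "\<alpha> \<in> gA" "\<beta> \<in> gA"
  shows "actgA \<gamma> (brA \<alpha> \<beta>) = brA (actgA \<gamma> \<alpha>) (actgA \<gamma> \<beta>)"
  using assms(2,3)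
proof (induction rule: gA_induct2)
  case (tens u f v h)
  show ?case unfolding actgA_tens[OF \<gamma>] brA_tens actg_br[OF \<gamma>] actA_mult[OF \<gamma>] ..
next
  case (add_left \<alpha> \<alpha>' \<beta>)
  note a = add_left(1-3)[THEN actgA_in_gA[OF \<gamma>]]
  show ?case
    unfolding brA_bilinear(1)[OF add_left(1,3,3)] actgA_linear brA_bilinear(1)[OF a(1,3,3)] add_left(4,5) ..
next
  case (scale_left c \<alpha> \<beta>)
  note a = scale_left(1,2)[THEN actgA_in_gA[OF \<gamma>]]
  show ?case
    unfolding brA_bilinear(2)[OF scale_left(1,2,2)] actgA_linear brA_bilinear(2)[OF a(1,2,2)] scale_left(3) ..
next
  case (add_right \<alpha> \<beta> \<beta>')
  note a = add_right(1-3)[THEN actgA_in_gA[OF \<gamma>]]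
  show ?case
    unfolding brA_bilinear(3)[OF add_right(1-3)] actgA_linear brA_bilinear(3)[OF a(1-3)] add_right(4,5) ..
next
  case (scale_right c \<alpha> \<beta>)
  note a = scale_right(1,2)[THEN actgA_in_gA[OF \<gamma>]]
  show ?case
    unfolding brA_bilinear(4)[OF scale_right(1,2,2)] actgA_linear brA_bilinear(4)[OF a(1,2,2)] scale_right(3) ..
qed

lemma MM_gA: "\<alpha> \<in> MM \<Longrightarrow> \<alpha> \<in> gA"
  by (simp add: MM_def)

lemma MM_closed:
  "\<alpha> \<in> MM \<Longrightarrow> \<beta> \<in> MM \<Longrightarrow> \<alpha> + \<beta> \<in> MM" "\<alpha> \<in> MM \<Longrightarrow> fscale c \<alpha> \<in> MM"
  "\<alpha> \<in> MM \<Longrightarrow> \<beta> \<in> MM \<Longrightarrow> brA \<alpha> \<beta> \<in> MM"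
proof -
  assume \<alpha>: "\<alpha> \<in> MM"
  show "fscale c \<alpha> \<in> MM" using \<alpha> fM.subspace_scale[OF subspace_gA]
    unfolding MM_def mem_Collect_eq actgA_linear by metis
  assume \<beta>: "\<beta> \<in> MM"
  show "\<alpha> + \<beta> \<in> MM" using \<alpha> \<beta> fM.subspace_add[OF subspace_gA]
    unfolding MM_def mem_Collect_eq actgA_linear by metis
  show "brA \<alpha> \<beta> \<in> MM" using \<alpha> \<beta> brA_in_gA actgA_br
    unfolding MM_def mem_Collect_eq by metis
qed


subsection \<open>The action on rational points\<close>

text \<open>
  The image of the unit under a surjective multiplicative map is again a unit, and units are unique.
\<close>

lemma actA_unit:
  assumes \<gamma>: "\<gamma> \<in> carrier \<Gamma>"
  shows "actA \<gamma> unitA = unitA"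
proof -
  have "bij_betw (actA \<gamma>) UNIV UNIV" using actA.bij_prop0 \<gamma> by (auto simp: Bij_def)
  then obtain f where f: "unitA = actA \<gamma> f" by (metis bij_pointE)
  have "actA \<gamma> unitA * unitA = actA \<gamma> (unitA * f)" unfolding actA_mult[OF \<gamma>] f[symmetric] ..
  also have "\<dots> = unitA" unfolding unitA by (rule f[symmetric])
  finally have "actA \<gamma> unitA * unitA = unitA" .
  then show ?thesis by (metis mult.commute unitA)
qed

lemma actX_X_rat:
  assumes \<gamma>: "\<gamma> \<in> carrier \<Gamma>" and x: "x \<in> X_rat"
  shows "actX \<gamma> x \<in> X_rat"
proof -
  have \<gamma>': "inv\<^bsub>\<Gamma>\<^esub> \<gamma> \<in> carrier \<Gamma>" using \<gamma> by simp
  have "Vector_Spaces.linear scA (*) (actX \<gamma> x)"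
    using Vector_Spaces.linear_compose[OF actA_linear[OF \<gamma>'] X_rat_linear[OF x]]
    by (simp add: actX_def o_def)
  then show ?thesis using x by (simp add: X_rat_def actX_def actA_mult[OF \<gamma>'] actA_unit[OF \<gamma>'])
qed

lemma actX_actA: "\<gamma> \<in> carrier \<Gamma> \<Longrightarrow> x (actA \<gamma> f) = actX (inv\<^bsub>\<Gamma>\<^esub> \<gamma>) x f"
  by (simp add: actX_def)

lemma orbit_refl: "x \<in> orbit \<Gamma> actX x"
proof -
  have "actX \<one>\<^bsub>\<Gamma>\<^esub> x = x" using actX_inv(1)[of "\<one>\<^bsub>\<Gamma>\<^esub>" x] by (simp add: actX_actX)
  then show ?thesis unfolding orbit_def by (metis (mono_tags, lifting) mem_Collect_eq one_closed)
qed

lemma orbit_sym: "y \<in> orbit \<Gamma> actX x \<Longrightarrow> x \<in> orbit \<Gamma> actX y"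
  unfolding orbit_def using actX_inv(2) inv_closed by (smt (verit) mem_Collect_eq)

lemma orbit_trans: "y \<in> orbit \<Gamma> actX x \<Longrightarrow> z \<in> orbit \<Gamma> actX y \<Longrightarrow> z \<in> orbit \<Gamma> actX x"
  unfolding orbit_def using actX_actX m_closed by (smt (verit) mem_Collect_eq)

lemma ev_at_act:
  assumes \<gamma>: "\<gamma> \<in> carrier \<Gamma>" and x: "x \<in> X_rat" and "\<alpha> \<in> gA"
  shows "ev_at (actX \<gamma> x) (actgA \<gamma> \<alpha>) = actg \<gamma> (ev_at x \<alpha>)"
  using assms(3)
proof (induction rule: gA_induct)
  interpret a: Vector_Spaces.linear scg scg "actg \<gamma>" by (rule actg_linear[OF \<gamma>])
  note x' = actX_X_rat[OF \<gamma> x]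
  case (tens u f)
  have "actX \<gamma> x (actA \<gamma> f) = x f" using \<gamma> by (simp add: actX_actA actX_inv)
  then show ?case by (simp add: actgA_tens[OF \<gamma>] ev_at_linear(1)[OF x'] ev_at_linear(1)[OF x] a.scale)
next
  interpret a: Vector_Spaces.linear scg scg "actg \<gamma>" by (rule actg_linear[OF \<gamma>])
  note x' = actX_X_rat[OF \<gamma> x]
  case (add \<alpha> \<beta>)
  note a = add(1,2)[THEN actgA_in_gA[OF \<gamma>]]
  show ?case unfolding actgA_linear ev_at_linear(2)[OF x' a] ev_at_linear(2)[OF x add(1,2)] a.add add(3,4) ..
next
  interpret a: Vector_Spaces.linear scg scg "actg \<gamma>" by (rule actg_linear[OF \<gamma>])
  note x' = actX_X_rat[OF \<gamma> x]
  case (scale c \<alpha>)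
  note a = scale(1)[THEN actgA_in_gA[OF \<gamma>]]
  show ?case unfolding actgA_linear ev_at_linear(3)[OF x' a] ev_at_linear(3)[OF x scale(1)] a.scale scale(2) ..
qed

lemma ev_at_MM_act:
  assumes "\<gamma> \<in> carrier \<Gamma>" "x \<in> X_rat" "\<alpha> \<in> MM"
  shows "ev_at (actX \<gamma> x) \<alpha> = actg \<gamma> (ev_at x \<alpha>)"
  using ev_at_act[OF assms(1,2) MM_gA[OF assms(3)]] assms(1,3) by (simp add: MM_def)

lemma ev_at_gfix:
  assumes x: "x \<in> X_rat" and \<alpha>: "\<alpha> \<in> MM"
  shows "ev_at x \<alpha> \<in> gfix x"
  unfolding gfix_def stabilizer_def
  using ev_at_MM_act[OF _ x \<alpha>] by (auto, metis)


subsection \<open>Equivariant maps with prescribed values\<close>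

text \<open>
  Two points differ at some \<open>h\<close>; subtract the constant \<open>z h\<close> and normalize.
\<close>

lemma separating_function:
  assumes x: "x \<in> X_rat" and z: "z \<in> X_rat" and ne: "x \<noteq> z"
  shows "\<exists>f. x f = 1 \<and> z f = 0"
proof -
  obtain h where h: "x h \<noteq> z h" using ne by blast
  interpret x: Vector_Spaces.linear scA "(*)" x using X_rat_linear[OF x] .
  interpret z: Vector_Spaces.linear scA "(*)" z using X_rat_linear[OF z] .
  let ?f = "scA (1 / (x h - z h)) (h - scA (z h) unitA)"
  have "x unitA = 1" "z unitA = 1" using x z by (simp_all add: X_rat_def)
  then have "x ?f = 1" "z ?f = 0" using h by (simp_all add: x.scale z.scale x.diff z.diff)
  then show ?thesis by blast
qed

text \<open>
  Points are multiplicative, so the functions separating \<open>x\<close> from the single points of \<open>Z\<close> can be multiplied.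
\<close>

lemma bump_function:
  assumes x: "x \<in> X_rat" and Z: "finite Z" "Z \<subseteq> X_rat" "x \<notin> Z"
  shows "\<exists>f. x f = 1 \<and> (\<forall>z\<in>Z. z f = 0)"
  using Z
proof (induction rule: finite_induct)
  case empty
  show ?case using x by (auto simp: X_rat_def)
next
  case (insert z Z)
  then obtain f where f: "x f = 1" "\<forall>z\<in>Z. z f = 0" by auto
  obtain h where h: "x h = 1" "z h = 0" using separating_function[OF x, of z] insert.prems by auto
  have "y (f * h) = y f * y h" if "y \<in> X_rat" for y using that by (simp add: X_rat_def)
  note mult = this
  have "x (f * h) = 1" using mult[OF x] f(1) h(1) by simp
  moreover have "y (f * h) = 0" if "y \<in> insert z Z" for y
  proof -
    have "y \<in> X_rat" using that insert.prems by auto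
    from mult[OF this] show ?thesis using that f(2) h(2) by auto
  qed
  ultimately show ?case by blast
qed

text \<open>
  The required element is the sum of the translates of \<open>u \<otimes> f\<close>, divided by the order of the stabilizer, where \<open>f\<close> is
  \<open>1\<close> at \<open>x\<close> and vanishes at all other points of the orbits of \<open>x\<close> and of \<open>S\<close>. At \<open>x\<close> only the translates by the
  stabilizer contribute, each of them \<open>u\<close>.
\<close>

lemma equivariant_interpolation:
  assumes x: "x \<in> X_rat" and u: "u \<in> gfix x"
    and S: "finite S" "S \<subseteq> X_rat" "\<And>y. y \<in> S \<Longrightarrow> y \<notin> orbit \<Gamma> actX x"
  shows "\<exists>\<alpha>\<in>MM. ev_at x \<alpha> = u \<and> (\<forall>y\<in>S. ev_at y \<alpha> = 0)"
proof -
  let ?Z = "(\<lambda>(\<gamma>, y). actX \<gamma> y) ` (carrier \<Gamma> \<times> insert x S) - {x}"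
  have "finite ?Z" using finite_group S(1) by auto
  moreover have "?Z \<subseteq> X_rat" using actX_X_rat x S(2) by auto
  ultimately obtain f where f: "x f = 1" "\<And>z. z \<in> ?Z \<Longrightarrow> z f = 0" using bump_function[OF x, of ?Z] by blast
  let ?St = "stabilizer \<Gamma> actX x"
  define N where "N = (of_nat (card ?St) :: 'k)"
  have St: "?St \<subseteq> carrier \<Gamma>" by (auto simp: stabilizer_def)
  have "actX \<one>\<^bsub>\<Gamma>\<^esub> x = x" using actX_inv(1)[of "\<one>\<^bsub>\<Gamma>\<^esub>" x] by (simp add: actX_actX)
  then have "\<one>\<^bsub>\<Gamma>\<^esub> \<in> ?St" by (simp add: stabilizer_def)
  then have "card ?St \<noteq> 0" using finite_subset[OF St finite_group] by auto
  then have N: "N \<noteq> 0" by (simp add: N_def)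
  let ?t = "\<lambda>\<gamma>. tens (actg \<gamma> u) (actA \<gamma> f)"
  let ?\<sigma> = "\<Sum>\<gamma>\<in>carrier \<Gamma>. ?t \<gamma>"
  have \<sigma>gA: "?\<sigma> \<in> gA" by (intro fM.subspace_sum subspace_gA tens_in_gA)
  have inv: "actgA \<delta> ?\<sigma> = ?\<sigma>" if \<delta>: "\<delta> \<in> carrier \<Gamma>" for \<delta>
  proof -
    have lin: "Vector_Spaces.linear fscale fscale (actgA \<delta>)"
      by (rule linear_intro) (auto intro: vector_space_fscale simp: actgA_linear)
    have "actgA \<delta> ?\<sigma> = (\<Sum>\<gamma>\<in>carrier \<Gamma>. actgA \<delta> (?t \<gamma>))" by (rule linear_map_sum[OF lin])
    also have "\<dots> = (\<Sum>\<gamma>\<in>carrier \<Gamma>. ?t (\<delta> \<otimes>\<^bsub>\<Gamma>\<^esub> \<gamma>))"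
      by (rule sum.cong) (simp_all add: actgA_tens \<delta> actg.composition_rule actA.composition_rule)
    also have "\<dots> = ?\<sigma>"
    proof (rule sum.reindex_bij_betw)
      show "bij_betw (\<lambda>\<gamma>. \<delta> \<otimes>\<^bsub>\<Gamma>\<^esub> \<gamma>) (carrier \<Gamma>) (carrier \<Gamma>)"
        by (rule bij_betw_byWitness[where f' = "\<lambda>\<gamma>. inv\<^bsub>\<Gamma>\<^esub> \<delta> \<otimes>\<^bsub>\<Gamma>\<^esub> \<gamma>"])
           (auto simp: \<delta> m_assoc[symmetric])
    qed
    finally show ?thesis .
  qed
  have ev\<sigma>: "ev_at y ?\<sigma> = (\<Sum>\<gamma>\<in>carrier \<Gamma>. scg (actX (inv\<^bsub>\<Gamma>\<^esub> \<gamma>) y f) (actg \<gamma> u))"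
    if "y \<in> X_rat" for y
    unfolding ev_at_linear(4)[OF that tens_in_gA]
    by (rule sum.cong) (simp_all add: ev_at_linear(1)[OF that] actX_actA)
  have "ev_at x ?\<sigma> = (\<Sum>\<gamma>\<in>carrier \<Gamma>. if \<gamma> \<in> ?St then u else 0)"
    unfolding ev\<sigma>[OF x]
  proof (rule sum.cong[OF refl])
    fix \<gamma> assume \<gamma>: "\<gamma> \<in> carrier \<Gamma>"
    show "scg (actX (inv\<^bsub>\<Gamma>\<^esub> \<gamma>) x f) (actg \<gamma> u) = (if \<gamma> \<in> ?St then u else 0)"
    proof (cases "\<gamma> \<in> ?St")
      case True
      then have "actX \<gamma> x = x" by (simp add: stabilizer_def)
      then have "actX (inv\<^bsub>\<Gamma>\<^esub> \<gamma>) x = x" using actX_inv(2)[OF \<gamma>, of x] by simp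
      then show ?thesis using True u f(1) by (simp add: gfix_def)
    next
      case False
      have "actX (inv\<^bsub>\<Gamma>\<^esub> \<gamma>) x \<noteq> x"
        using False actX_inv(1)[OF \<gamma>, of x] \<gamma> by (auto simp: stabilizer_def)
      then have "actX (inv\<^bsub>\<Gamma>\<^esub> \<gamma>) x \<in> ?Z" using \<gamma> by force
      then show ?thesis using False f(2) by simp
    qed
  qed
  also have "\<dots> = (\<Sum>\<gamma>\<in>?St. u)"
    using St finite_group by (simp add: sum.If_cases Int_absorb1)
  also have "\<dots> = scg N u" unfolding N_def by (rule g.sum_constant_scale)
  finally have evx: "ev_at x ?\<sigma> = scg N u" .
  have evy: "ev_at y ?\<sigma> = 0" if y: "y \<in> S" for y
  proof -
    have yX: "y \<in> X_rat" using y S(2) by auto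
    have "actX (inv\<^bsub>\<Gamma>\<^esub> \<gamma>) y f = 0" if \<gamma>: "\<gamma> \<in> carrier \<Gamma>" for \<gamma>
    proof -
      have "y = actX \<gamma> (actX (inv\<^bsub>\<Gamma>\<^esub> \<gamma>) y)" using actX_inv(1)[OF \<gamma>] by simp
      then have "actX (inv\<^bsub>\<Gamma>\<^esub> \<gamma>) y \<noteq> x" using S(3)[OF y] \<gamma> unfolding orbit_def by force
      then have "actX (inv\<^bsub>\<Gamma>\<^esub> \<gamma>) y \<in> ?Z" using \<gamma> y by force
      then show ?thesis by (rule f(2))
    qed
    then show ?thesis unfolding ev\<sigma>[OF yX] by simp
  qed
  have "?\<sigma> \<in> MM" unfolding MM_def using \<sigma>gA inv by blast
  then have "fscale (inverse N) ?\<sigma> \<in> MM" by (rule MM_closed)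
  moreover have "ev_at x (fscale (inverse N) ?\<sigma>) = u"
    unfolding ev_at_linear(3)[OF x \<sigma>gA] evx using N by simp
  moreover have "ev_at y (fscale (inverse N) ?\<sigma>) = 0" if "y \<in> S" for y
    using evy[OF that] ev_at_linear(3)[OF _ \<sigma>gA] that S(2) by (simp add: subset_iff)
  ultimately show ?thesis by blast
qed

end


section \<open>Evaluation representations\<close>

context equivariant_map_algebra
begin

lemma orbit_transversal_exists: "\<exists>xs. orbit_transversal Y xs"
proof -
  define rp where "rp x = (SOME y. y \<in> Y \<and> y \<in> orbit \<Gamma> actX x)" for x
  have rp: "rp x \<in> Y \<and> rp x \<in> orbit \<Gamma> actX x" if "x \<in> Y" for x
    unfolding rp_def by (rule someI[of _ x]) (simp add: that orbit_refl)
  have same: "rp x = rp y" if "y \<in> orbit \<Gamma> actX x" for x y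
  proof -
    have "z \<in> orbit \<Gamma> actX x \<longleftrightarrow> z \<in> orbit \<Gamma> actX y" for z
      using orbit_trans orbit_sym that by blast
    then show ?thesis by (simp add: rp_def)
  qed
  have "orbit_transversal Y (rp ` Y)"
    unfolding orbit_transversal_def
  proof (intro conjI ballI ex1I)
    show "rp ` Y \<subseteq> Y" using rp by blast
    fix x assume x: "x \<in> Y"
    show "rp x \<in> rp ` Y" "rp x \<in> orbit \<Gamma> actX x" using rp[OF x] x by auto
    fix y assume y: "y \<in> rp ` Y \<and> y \<in> orbit \<Gamma> actX x"
    then obtain x' where x': "x' \<in> Y" "y = rp x'" by blast
    then have "y \<in> orbit \<Gamma> actX x'" using rp by blast
    then show "y = rp x" using same[of y x'] same[of y x] y x' by simp
  qed
  then show ?thesis by blast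
qed

end

text \<open>
  The representation attached to \<open>\<Psi>\<close> depends on choices of orbit representatives and of members of isomorphism
  classes. With these as parameters, the constructions for two functions can be compared.
\<close>

locale evaluation_data = equivariant_map_algebra \<Gamma> scA unitA scg br actA actg
  for \<Gamma> :: "'c monoid"
    and scA :: "'k::{alg_closed_field,field_char_0} \<Rightarrow> 'a::comm_ring \<Rightarrow> 'a" and unitA :: 'a
    and scg :: "'k \<Rightarrow> 'g::ab_group_add \<Rightarrow> 'g" and br :: "'g \<Rightarrow> 'g \<Rightarrow> 'g"
    and actA :: "'c \<Rightarrow> 'a \<Rightarrow> 'a" and actg :: "'c \<Rightarrow> 'g \<Rightarrow> 'g" +
  fixes \<Psi> :: "('a \<Rightarrow> 'k) \<Rightarrow> ('g, 'k) rep set" and xs :: "('a \<Rightarrow> 'k) set"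
    and V :: "('a \<Rightarrow> 'k) \<Rightarrow> (nat \<Rightarrow> 'k) set" and \<rho> :: "('a \<Rightarrow> 'k) \<Rightarrow> 'g \<Rightarrow> (nat \<Rightarrow> 'k) \<Rightarrow> nat \<Rightarrow> 'k"
  assumes \<Psi>: "\<Psi> \<in> EE"
    and transversal: "orbit_transversal (supp \<Psi>) xs"
    and reps: "x \<in> xs \<Longrightarrow> (V x, \<rho> x) \<in> \<Psi> x"
begin

lemma xs_supp: "xs \<subseteq> supp \<Psi>"
  using transversal by (simp add: orbit_transversal_def)

lemma xs_X_rat: "x \<in> xs \<Longrightarrow> x \<in> X_rat"
  using xs_supp by (auto simp: supp_def)

lemma finite_xs: "finite xs"
  using xs_supp \<Psi> by (auto simp: EE_def intro: finite_subset)

lemma \<Psi>_irr: "x \<in> X_rat \<Longrightarrow> \<Psi> x \<in> irr_classes scg br (gfix x)"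
  using \<Psi> by (auto simp: EE_def RR_def)

lemma \<Psi>_equivariant: "\<gamma> \<in> carrier \<Gamma> \<Longrightarrow> x \<in> X_rat \<Longrightarrow> \<Psi> (actX \<gamma> x) = act_class \<gamma> (\<Psi> x)"
  using \<Psi> by (auto simp: EE_def)

lemma xs_orbit_unique: "x \<in> xs \<Longrightarrow> y \<in> xs \<Longrightarrow> y \<in> orbit \<Gamma> actX x \<Longrightarrow> y = x"
  using transversal xs_supp orbit_refl unfolding orbit_transversal_def by blast

lemma ev_xs: "x \<in> xs \<Longrightarrow> ev xs \<alpha> x = ev_at x \<alpha>"
  by (simp add: ev_def)

sublocale t: irreducible_tensor_product fscale xs V scg br gfix \<rho> fscale brA MM "ev xs"
proof (unfold_locales; (simp only: ev_xs)?)
  show "finite xs" by (rule finite_xs)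
  fix x assume x: "x \<in> xs"
  note r = irr_classes_member[OF \<Psi>_irr[OF xs_X_rat[OF x]] reps[OF x]]
  show "module.subspace fscale (V x)" by (rule lie_rep_closed(4)[OF vector_space_fscale r(1)])
  show "lie_rep scg br (gfix x) fscale (V x) (\<rho> x)" by (rule r(1))
  show "irreducible_rep (gfix x) fscale (V x) (\<rho> x)" by (rule r(3))
  show "\<exists>B. finite B \<and> V x = module.span fscale B" by (rule r(2))
  note lin = ev_at_linear[OF xs_X_rat[OF x]]
  show "ev_at x \<alpha> \<in> gfix x" if "\<alpha> \<in> MM" for \<alpha> by (rule ev_at_gfix[OF xs_X_rat[OF x] that])
  show "ev_at x (\<alpha> + \<beta>) = ev_at x \<alpha> + ev_at x \<beta>" if "\<alpha> \<in> MM" "\<beta> \<in> MM" for \<alpha> \<beta>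
    by (rule lin(2)[OF that[THEN MM_gA]])
  show "ev_at x (fscale c \<alpha>) = scg c (ev_at x \<alpha>)" if "\<alpha> \<in> MM" for c \<alpha>
    by (rule lin(3)[OF that[THEN MM_gA]])
  show "ev_at x (brA \<alpha> \<beta>) = br (ev_at x \<alpha>) (ev_at x \<beta>)" if "\<alpha> \<in> MM" "\<beta> \<in> MM" for \<alpha> \<beta>
    by (rule ev_at_br[OF xs_X_rat[OF x] that[THEN MM_gA]])
  show "\<exists>\<alpha>\<in>MM. ev_at x \<alpha> = u \<and> (\<forall>y\<in>xs - {x}. ev xs \<alpha> y = 0)" if u: "u \<in> gfix x" for u
  proof -
    have "\<exists>\<alpha>\<in>MM. ev_at x \<alpha> = u \<and> (\<forall>y\<in>xs - {x}. ev_at y \<alpha> = 0)"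
      by (rule equivariant_interpolation[OF xs_X_rat[OF x] u])
         (use finite_xs xs_X_rat xs_orbit_unique[OF x] in auto)
    then show ?thesis using x by (auto simp: ev_xs)
  qed
qed ((rule MM_closed; assumption) | simp add: fscale_def fun_eq_iff algebra_simps)+

lemma ev_rep_eq: "ev_rep xs fscale V \<rho> = t.\<tau>"
  by (rule ext) (simp only: ev_rep_def)

lemma ev_rep_lie_rep: "lie_rep fscale brA MM fscale (tensor_space xs fscale V) (ev_rep xs fscale V \<rho>)"
  unfolding ev_rep_eq by (rule t.lie_rep_tensor)

lemma ev_rep_irreducible: "irreducible_rep MM fscale (tensor_space xs fscale V) (ev_rep xs fscale V \<rho>)"
  unfolding ev_rep_eq by (rule t.irreducible_tensor)

lemma ev_rep_finite_dim: "\<exists>C. finite C \<and> tensor_space xs fscale V = module.span fscale C"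
proof -
  have "\<forall>x\<in>xs. \<exists>B. finite B \<and> V x = module.span fscale B" using t.fd by blast
  from bchoice[OF this] obtain B where "\<forall>x\<in>xs. finite (B x) \<and> V x = module.span fscale (B x)" ..
  then show ?thesis by (intro t.finite_dim_T) blast
qed

lemma ev_rep_copy:
  "\<exists>W \<sigma>. (W, \<sigma>) \<in> fd_reps fscale brA MM \<and>
     rep_iso MM fscale (tensor_space xs fscale V) (ev_rep xs fscale V \<rho>) fscale W \<sigma>"
proof -
  obtain C where "finite C" "tensor_space xs fscale V = module.span fscale C" using ev_rep_finite_dim by blast
  from fd_copy[OF vector_space_fscale ev_rep_lie_rep MM_closed this] show ?thesis .
qed

lemma ev_rep_class:
  "iso_class fscale brA MM fscale (tensor_space xs fscale V) (ev_rep xs fscale V \<rho>) \<in> SS"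
proof -
  obtain W \<sigma> where W: "(W, \<sigma>) \<in> fd_reps fscale brA MM"
    "rep_iso MM fscale (tensor_space xs fscale V) (ev_rep xs fscale V \<rho>) fscale W \<sigma>"
    using ev_rep_copy by blast
  note rep = ev_rep_lie_rep and irr = ev_rep_irreducible
  have "irreducible_rep MM fscale W \<sigma>"
    by (rule irreducible_rep_iso[OF vector_space_fscale t.subspace_T lie_repD(1)[OF rep] irr vector_space_fscale W(2)])
  moreover have "iso_class fscale brA MM fscale (tensor_space xs fscale V) (ev_rep xs fscale V \<rho>) =
      iso_class fscale brA MM fscale W \<sigma>"
    by (rule iso_class_cong[OF W(2)]) (rule lie_rep_closed(1-3)[OF vector_space_fscale rep]; assumption)+
  ultimately show ?thesis using W(1) unfolding SS_def irr_classes_def by blast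
qed

text \<open>
  The point \<open>x\<close> need not be the chosen representative \<open>\<gamma> x\<close> of its orbit, but equivariance of \<open>\<Psi>\<close> identifies
  \<open>\<Psi>(x)\<close>, up to the twist by \<open>\<gamma>\<close>, with the factor at \<open>\<gamma> x\<close>.
\<close>

lemma transport_to_transversal:
  assumes x: "x \<in> X_rat" and \<gamma>: "\<gamma> \<in> carrier \<Gamma>" and y: "actX \<gamma> x \<in> xs" and r: "(U, \<tau>) \<in> \<Psi> x"
  shows "\<exists>\<theta>. bij_betw \<theta> (V (actX \<gamma> x)) U \<and> linear_between fscale (V (actX \<gamma> x)) fscale U \<theta> \<and>
    (\<forall>w\<in>gfix x. \<forall>v\<in>V (actX \<gamma> x). \<theta> (\<rho> (actX \<gamma> x) (actg \<gamma> w) v) = \<tau> w (\<theta> v))"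
proof -
  let ?y = "actX \<gamma> x"
  have "(U, \<lambda>u. \<tau> (actg (inv\<^bsub>\<Gamma>\<^esub> \<gamma>) u)) \<in> \<Psi> ?y"
    unfolding \<Psi>_equivariant[OF \<gamma> x] act_class_def using r by force
  from irr_classes_member_iso[OF \<Psi>_irr[OF xs_X_rat[OF y]] reps[OF y] this]
  obtain \<theta> where \<theta>: "bij_betw \<theta> (V ?y) U" "linear_between fscale (V ?y) fscale U \<theta>"
    "\<forall>u\<in>gfix ?y. \<forall>v\<in>V ?y. \<theta> (\<rho> ?y u v) = \<tau> (actg (inv\<^bsub>\<Gamma>\<^esub> \<gamma>) u) (\<theta> v)"
    unfolding rep_iso_iff_linear_between by blast
  have "\<theta> (\<rho> ?y (actg \<gamma> w) v) = \<tau> w (\<theta> v)" if "w \<in> gfix x" "v \<in> V ?y" for w v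
    using \<theta>(3) actg_gfix[OF \<gamma> that(1)] that(2) actg_inv(2)[OF \<gamma>] by simp
  with \<theta>(1,2) show ?thesis by blast
qed

lemma outside_support:
  assumes x: "x \<in> X_rat" and no: "\<And>\<gamma>. \<gamma> \<in> carrier \<Gamma> \<Longrightarrow> actX \<gamma> x \<notin> xs" and r: "(U, \<tau>) \<in> \<Psi> x"
  shows "\<exists>\<theta>. bij_betw \<theta> (UNIV :: 'k set) U \<and> linear_between (*) (UNIV :: 'k set) fscale U \<theta> \<and>
    (\<forall>w\<in>gfix x. \<forall>v\<in>U. \<tau> w v = 0)"
proof -
  have "x \<notin> supp \<Psi>" using no transversal unfolding orbit_transversal_def orbit_def by blast
  then have "\<Psi> x = trivial_class scg br (gfix x)" using x by (simp add: supp_def)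
  with r have "rep_iso (gfix x) (*) (UNIV :: 'k set) (\<lambda>u v. 0) fscale U \<tau>"
    by (simp add: trivial_class_def iso_class_def)
  then obtain \<theta> where \<theta>: "bij_betw \<theta> (UNIV :: 'k set) U" "linear_between (*) (UNIV :: 'k set) fscale U \<theta>"
    "\<forall>u\<in>gfix x. \<forall>v. \<theta> 0 = \<tau> u (\<theta> v)"
    unfolding rep_iso_iff_linear_between by blast
  have "\<theta> 0 = 0" by (rule linear_between_zero[OF \<theta>(2)]) simp
  moreover have "U = range \<theta>" using \<theta>(1) by (simp add: bij_betw_def)
  ultimately have "\<forall>w\<in>gfix x. \<forall>v\<in>U. \<tau> w v = 0" using \<theta>(3) by force
  with \<theta>(1,2) show ?thesis by blast
qed

lemma ev_rep_one_orbit: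
  assumes \<alpha>: "\<alpha> \<in> MM" "\<And>z. z \<in> xs \<Longrightarrow> z \<notin> orbit \<Gamma> actX x \<Longrightarrow> ev_at z \<alpha> = 0"
    and t: "t \<in> tensor_space xs fscale V"
  shows "y \<in> xs \<Longrightarrow> y \<in> orbit \<Gamma> actX x \<Longrightarrow>
      ev_rep xs fscale V \<rho> \<alpha> t = factor_op xs fscale V y (\<rho> y (ev_at y \<alpha>)) t"
    and "xs \<inter> orbit \<Gamma> actX x = {} \<Longrightarrow> ev_rep xs fscale V \<rho> \<alpha> t = 0"
proof -
  assume y: "y \<in> xs" "y \<in> orbit \<Gamma> actX x"
  have "ev xs \<alpha> z = 0" if z: "z \<in> xs" "z \<noteq> y" for z
  proof -
    have "z \<notin> orbit \<Gamma> actX x"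
      using z y xs_orbit_unique[OF y(1) z(1)] orbit_trans[OF orbit_sym[OF y(2)], of z] by blast
    then show ?thesis using \<alpha>(2)[OF z(1)] z(1) by (simp add: ev_xs)
  qed
  from t.tensor_rep_single[OF \<alpha>(1) t y(1) this]
  show "ev_rep xs fscale V \<rho> \<alpha> t = factor_op xs fscale V y (\<rho> y (ev_at y \<alpha>)) t"
    unfolding ev_rep_def ev_xs[OF y(1)] .
next
  assume "xs \<inter> orbit \<Gamma> actX x = {}"
  then have "ev xs \<alpha> z = 0" if "z \<in> xs" for z using \<alpha>(2) that by (auto simp: ev_xs)
  from t.tensor_rep_vanish[OF \<alpha>(1) t this] show "ev_rep xs fscale V \<rho> \<alpha> t = 0"
    unfolding ev_rep_def .
qed

text \<open>
  If the orbit of \<open>x\<close> meets \<open>xs\<close> in \<open>y\<close>, then \<open>\<phi>\<close> contracts all factors except the one at \<open>y\<close>. Otherwise \<open>U\<close> is a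
  line on which, as on the tensor product, the \<open>\<alpha>\<close> in question act by zero, and \<open>\<phi>\<close> is any nonzero linear functional.
\<close>

lemma local_quotient:
  assumes x: "x \<in> X_rat" and r: "(U, \<tau>) \<in> \<Psi> x"
  shows "\<exists>\<phi>. linear_between fscale (tensor_space xs fscale V) fscale U \<phi> \<and>
    (\<exists>t\<in>tensor_space xs fscale V. \<phi> t \<noteq> 0) \<and>
    (\<forall>\<alpha>\<in>MM. (\<forall>z\<in>xs. z \<notin> orbit \<Gamma> actX x \<longrightarrow> ev_at z \<alpha> = 0) \<longrightarrow>
      (\<forall>t\<in>tensor_space xs fscale V. \<phi> (ev_rep xs fscale V \<rho> \<alpha> t) = \<tau> (ev_at x \<alpha>) (\<phi> t)))"
proof (cases "\<exists>\<gamma>\<in>carrier \<Gamma>. actX \<gamma> x \<in> xs")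
  case True
  then obtain \<gamma> where \<gamma>: "\<gamma> \<in> carrier \<Gamma>" and y: "actX \<gamma> x \<in> xs" by blast
  let ?y = "actX \<gamma> x"
  have y_orb: "?y \<in> orbit \<Gamma> actX x" using \<gamma> by (auto simp: orbit_def)
  from transport_to_transversal[OF x \<gamma> y r] obtain \<theta> where
    \<theta>: "bij_betw \<theta> (V ?y) U" "linear_between fscale (V ?y) fscale U \<theta>"
      "\<And>w v. w \<in> gfix x \<Longrightarrow> v \<in> V ?y \<Longrightarrow> \<theta> (\<rho> ?y (actg \<gamma> w) v) = \<tau> w (\<theta> v)" by blast
  have "\<forall>z\<in>xs. \<exists>v. v \<in> V z \<and> v \<noteq> 0"
    using t.irr t.subspace_0[OF t.subspace_V] unfolding irreducible_rep_def by blast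
  from bchoice[OF this] obtain w0 where w0: "\<forall>z\<in>xs. w0 z \<in> V z \<and> w0 z \<noteq> 0" by blast
  let ?w = "restrict w0 xs"
  have w: "?w \<in> Pi\<^sub>E xs V" "\<And>z. z \<in> xs \<Longrightarrow> z \<noteq> ?y \<Longrightarrow> ?w z \<noteq> 0" using w0 by auto
  from t.factor_projection[OF y w] obtain F where
    F: "Vector_Spaces.linear fscale fscale F" "\<forall>t\<in>tensor_space xs fscale V. F t \<in> V ?y"
      "\<forall>a\<in>V ?y. F (pure_tensor xs fscale V (?w(?y := a))) = a"
      "\<forall>E t. linear_between fscale (V ?y) fscale (V ?y) E \<longrightarrow> t \<in> tensor_space xs fscale V \<longrightarrow>
         F (factor_op xs fscale V ?y E t) = E (F t)" by blast
  have lin: "linear_between fscale (tensor_space xs fscale V) fscale U (\<lambda>t. \<theta> (F t))"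
    by (rule linear_between_comp[OF linear_between_linear[OF F(1)] \<theta>(2)]) (use F(2) in auto)
  moreover have "\<exists>t\<in>tensor_space xs fscale V. \<theta> (F t) \<noteq> 0"
  proof
    have "?w(?y := w0 ?y) \<in> Pi\<^sub>E xs V" using t.PiE_upd[OF w(1) y] w0 y by blast
    then show "pure_tensor xs fscale V (?w(?y := w0 ?y)) \<in> tensor_space xs fscale V" by (rule t.pure_in_T)
    have "\<theta> (w0 ?y) \<noteq> \<theta> 0"
      using \<theta>(1) w0 y t.subspace_0[OF t.subspace_V[OF y]] by (metis bij_betw_imp_inj_on inj_onD)
    then show "\<theta> (F (pure_tensor xs fscale V (?w(?y := w0 ?y)))) \<noteq> 0"
      using F(3) w0 y linear_between_zero[OF \<theta>(2) t.subspace_0[OF t.subspace_V[OF y]]] by metis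
  qed
  moreover have "\<theta> (F (ev_rep xs fscale V \<rho> \<alpha> t)) = \<tau> (ev_at x \<alpha>) (\<theta> (F t))"
    if \<alpha>: "\<alpha> \<in> MM" "\<forall>z\<in>xs. z \<notin> orbit \<Gamma> actX x \<longrightarrow> ev_at z \<alpha> = 0" and t: "t \<in> tensor_space xs fscale V"
    for \<alpha> t
  proof -
    have "F (ev_rep xs fscale V \<rho> \<alpha> t) = \<rho> ?y (ev_at ?y \<alpha>) (F t)"
      using ev_rep_one_orbit(1)[OF \<alpha>(1) _ t y y_orb] \<alpha>(2) F(4) t t.endo_rep[OF \<alpha>(1) y]
      by (simp add: ev_xs[OF y])
    then show ?thesis
      using \<theta>(3)[OF ev_at_gfix[OF x \<alpha>(1)]] F(2) t by (simp add: ev_at_MM_act[OF \<gamma> x \<alpha>(1)])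
  qed
  ultimately show ?thesis by blast
next
  case False
  then have no: "\<And>\<gamma>. \<gamma> \<in> carrier \<Gamma> \<Longrightarrow> actX \<gamma> x \<notin> xs" by blast
  from outside_support[OF x no r] obtain \<theta> where
    \<theta>: "bij_betw \<theta> (UNIV :: 'k set) U" "linear_between (*) (UNIV :: 'k set) fscale U \<theta>"
      "\<And>w v. w \<in> gfix x \<Longrightarrow> v \<in> U \<Longrightarrow> \<tau> w v = 0" by blast
  have disj: "xs \<inter> orbit \<Gamma> actX x = {}" using no by (auto simp: orbit_def)
  obtain t0 where t0: "t0 \<in> tensor_space xs fscale V" "t0 \<noteq> 0"
    using t.irreducible_tensor t.f.subspace_0[OF t.subspace_T] unfolding irreducible_rep_def by blast
  obtain l where l: "Vector_Spaces.linear fscale (*) l" "l t0 = 1" using t.f.functional_exists[OF t0(2)] by blast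
  interpret l: Vector_Spaces.linear fscale "(*)" l by (rule l(1))
  have \<theta>0: "\<theta> 0 = 0" by (rule linear_between_zero[OF \<theta>(2)]) simp
  have "linear_between fscale (tensor_space xs fscale V) fscale U (\<lambda>t. \<theta> (l t))"
    by (rule linear_between_comp[OF linear_between_linear[OF l(1)] \<theta>(2)]) simp
  moreover have "\<exists>t\<in>tensor_space xs fscale V. \<theta> (l t) \<noteq> 0"
  proof
    have "\<theta> 1 \<noteq> \<theta> 0" using \<theta>(1) by (metis UNIV_I bij_betw_imp_inj_on inj_onD zero_neq_one)
    then show "\<theta> (l t0) \<noteq> 0" using \<theta>0 l(2) by metis
  qed (rule t0(1))
  moreover have "\<theta> (l (ev_rep xs fscale V \<rho> \<alpha> t)) = \<tau> (ev_at x \<alpha>) (\<theta> (l t))"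
    if \<alpha>: "\<alpha> \<in> MM" "\<forall>z\<in>xs. z \<notin> orbit \<Gamma> actX x \<longrightarrow> ev_at z \<alpha> = 0" and t: "t \<in> tensor_space xs fscale V"
    for \<alpha> t
  proof -
    have "ev_rep xs fscale V \<rho> \<alpha> t = 0" using ev_rep_one_orbit(2)[OF \<alpha>(1) _ t disj] \<alpha>(2) by blast
    then have "\<theta> (l (ev_rep xs fscale V \<rho> \<alpha> t)) = 0" using l.zero \<theta>0 by metis
    moreover have "\<tau> (ev_at x \<alpha>) (\<theta> (l t)) = 0"
      by (rule \<theta>(3)[OF ev_at_gfix[OF x \<alpha>(1)] linear_betweenD(1)[OF \<theta>(2)]]) simp
    ultimately show ?thesis by simp
  qed
  ultimately show ?thesis by blast
qed

text \<open>
  Here \<open>\<psi>\<close> inserts vectors into \<open>v\<close> at the point of \<open>xs\<close> in the orbit of \<open>x\<close>; if there is none, it maps the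
  line \<open>U\<close> to the line spanned by the pure tensor.
\<close>

lemma local_insertion:
  assumes x: "x \<in> X_rat" and r: "(U, \<tau>) \<in> \<Psi> x" and v: "v \<in> Pi\<^sub>E xs V"
  shows "\<exists>\<psi>. linear_between fscale U fscale (tensor_space xs fscale V) \<psi> \<and>
    pure_tensor xs fscale V v \<in> \<psi> ` U \<and>
    (\<forall>\<alpha>\<in>MM. (\<forall>z\<in>xs. z \<notin> orbit \<Gamma> actX x \<longrightarrow> ev_at z \<alpha> = 0) \<longrightarrow>
      (\<forall>a\<in>U. \<psi> (\<tau> (ev_at x \<alpha>) a) = ev_rep xs fscale V \<rho> \<alpha> (\<psi> a)))"
proof (cases "\<exists>\<gamma>\<in>carrier \<Gamma>. actX \<gamma> x \<in> xs")
  case True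
  then obtain \<gamma> where \<gamma>: "\<gamma> \<in> carrier \<Gamma>" and y: "actX \<gamma> x \<in> xs" by blast
  let ?y = "actX \<gamma> x"
  have y_orb: "?y \<in> orbit \<Gamma> actX x" using \<gamma> by (auto simp: orbit_def)
  from transport_to_transversal[OF x \<gamma> y r] obtain \<theta> where
    \<theta>: "bij_betw \<theta> (V ?y) U" "linear_between fscale (V ?y) fscale U \<theta>"
      "\<And>w v. w \<in> gfix x \<Longrightarrow> v \<in> V ?y \<Longrightarrow> \<theta> (\<rho> ?y (actg \<gamma> w) v) = \<tau> w (\<theta> v)" by blast
  let ?G = "\<lambda>a. pure_tensor xs fscale V (v(?y := a))" and ?\<theta>' = "inv_into (V ?y) \<theta>"
  have \<theta>': "linear_between fscale U fscale (V ?y) ?\<theta>'"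
    by (rule linear_between_inv_into[OF \<theta>(1,2) vector_space_fscale t.subspace_V[OF y]])
  have l: "?\<theta>' (\<theta> a) = a" if "a \<in> V ?y" for a
    using \<theta>(1) that by (simp add: bij_betw_def)
  have r': "\<theta> (?\<theta>' a) = a" if "a \<in> U" for a
    using bij_betw_inv_into_right[OF \<theta>(1) that] .
  have lin: "linear_between fscale U fscale (tensor_space xs fscale V) (\<lambda>a. ?G (?\<theta>' a))"
    by (rule linear_between_comp[OF \<theta>' t.pure_upd_linear[OF v y]])
  moreover have "pure_tensor xs fscale V v \<in> (\<lambda>a. ?G (?\<theta>' a)) ` U"
  proof
    have vy: "v ?y \<in> V ?y" using v y by auto
    then show "\<theta> (v ?y) \<in> U" by (rule linear_betweenD(1)[OF \<theta>(2)])
    show "pure_tensor xs fscale V v = ?G (?\<theta>' (\<theta> (v ?y)))" unfolding l[OF vy] by simp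
  qed
  moreover have "?G (?\<theta>' (\<tau> (ev_at x \<alpha>) a)) = ev_rep xs fscale V \<rho> \<alpha> (?G (?\<theta>' a))"
    if \<alpha>: "\<alpha> \<in> MM" "\<forall>z\<in>xs. z \<notin> orbit \<Gamma> actX x \<longrightarrow> ev_at z \<alpha> = 0" and a: "a \<in> U" for \<alpha> a
  proof -
    let ?b = "?\<theta>' a"
    have b: "?b \<in> V ?y" using linear_betweenD(1)[OF \<theta>' a] .
    have E: "linear_between fscale (V ?y) fscale (V ?y) (\<rho> ?y (ev_at ?y \<alpha>))"
      using t.endo_rep[OF \<alpha>(1) y] by (simp add: ev_xs[OF y])
    have vb: "v(?y := ?b) \<in> Pi\<^sub>E xs V" using t.PiE_upd[OF v y b] .
    have "?G (?\<theta>' (\<tau> (ev_at x \<alpha>) a)) = ?G (?\<theta>' (\<theta> (\<rho> ?y (ev_at ?y \<alpha>) ?b)))"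
      using \<theta>(3)[OF ev_at_gfix[OF x \<alpha>(1)] b] r'[OF a] by (simp add: ev_at_MM_act[OF \<gamma> x \<alpha>(1)])
    also have "\<dots> = ?G (\<rho> ?y (ev_at ?y \<alpha>) ?b)" by (simp only: l[OF linear_betweenD(1)[OF E b]])
    also have "\<dots> = factor_op xs fscale V ?y (\<rho> ?y (ev_at ?y \<alpha>)) (?G ?b)"
      unfolding t.factor_op_pure[OF vb y E] by simp
    also have "\<dots> = ev_rep xs fscale V \<rho> \<alpha> (?G ?b)"
      using \<alpha>(2) by (intro ev_rep_one_orbit(1)[symmetric, OF \<alpha>(1) _ t.pure_in_T[OF vb] y y_orb]) blast
    finally show ?thesis .
  qed
  ultimately show ?thesis by blast
next
  case False
  then have no: "\<And>\<gamma>. \<gamma> \<in> carrier \<Gamma> \<Longrightarrow> actX \<gamma> x \<notin> xs" by blast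
  from outside_support[OF x no r] obtain \<theta> where
    \<theta>: "bij_betw \<theta> (UNIV :: 'k set) U" "linear_between (*) (UNIV :: 'k set) fscale U \<theta>"
      "\<And>w v. w \<in> gfix x \<Longrightarrow> v \<in> U \<Longrightarrow> \<tau> w v = 0" by blast
  have disj: "xs \<inter> orbit \<Gamma> actX x = {}" using no by (auto simp: orbit_def)
  let ?p = "pure_tensor xs fscale V v" and ?\<theta>' = "inv_into UNIV \<theta>"
  interpret k: vector_space "(*) :: 'k \<Rightarrow> 'k \<Rightarrow> 'k" by (rule vector_space_mult)
  have \<theta>': "linear_between fscale U (*) UNIV ?\<theta>'"
    by (rule linear_between_inv_into[OF \<theta>(1,2) vector_space_mult k.subspace_UNIV])
  have p: "?p \<in> tensor_space xs fscale V" by (rule t.pure_in_T[OF v])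
  have sp: "fscale c ?p \<in> tensor_space xs fscale V" for c by (rule t.f.subspace_scale[OF t.subspace_T p])
  have "linear_between (*) UNIV fscale (tensor_space xs fscale V) (\<lambda>c. fscale c ?p)"
    by (rule linear_betweenI) (simp_all only: sp t.f.scale_left_distrib t.f.scale_scale)
  from linear_between_comp[OF \<theta>' this]
  have "linear_between fscale U fscale (tensor_space xs fscale V) (\<lambda>a. fscale (?\<theta>' a) ?p)" .
  moreover have "?p \<in> (\<lambda>a. fscale (?\<theta>' a) ?p) ` U"
  proof
    show "\<theta> 1 \<in> U" by (rule linear_betweenD(1)[OF \<theta>(2)]) simp
    have "?\<theta>' (\<theta> 1) = 1" using \<theta>(1) by (simp add: bij_betw_def)
    then show "?p = fscale (?\<theta>' (\<theta> 1)) ?p" by (simp only: t.f.scale_one)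
  qed
  moreover have "fscale (?\<theta>' (\<tau> (ev_at x \<alpha>) a)) ?p = ev_rep xs fscale V \<rho> \<alpha> (fscale (?\<theta>' a) ?p)"
    if \<alpha>: "\<alpha> \<in> MM" "\<forall>z\<in>xs. z \<notin> orbit \<Gamma> actX x \<longrightarrow> ev_at z \<alpha> = 0" and a: "a \<in> U" for \<alpha> a
  proof -
    have "0 \<in> U" using linear_between_zero[OF \<theta>(2)] linear_betweenD(1)[OF \<theta>(2), of 0] by simp
    then have "?\<theta>' 0 = 0" by (rule linear_between_zero[OF \<theta>'])
    then have "fscale (?\<theta>' (\<tau> (ev_at x \<alpha>) a)) ?p = 0"
      unfolding \<theta>(3)[OF ev_at_gfix[OF x \<alpha>(1)] a] by (simp only: t.f.scale_zero_left)
    moreover have "ev_rep xs fscale V \<rho> \<alpha> (fscale (?\<theta>' a) ?p) = 0"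
      using ev_rep_one_orbit(2)[OF \<alpha>(1) _ sp disj] \<alpha>(2) by blast
    ultimately show ?thesis by (simp only:)
  qed
  ultimately show ?thesis by blast
qed

end

context equivariant_map_algebra
begin

lemma evaluation_data_exists:
  assumes \<Psi>: "\<Psi> \<in> EE"
  shows "\<exists>xs V \<rho>. evaluation_data \<Gamma> scA unitA scg br actA actg \<Psi> xs V \<rho> \<and>
    ev_class \<Psi> = iso_class fscale brA MM fscale (tensor_space xs fscale V) (ev_rep xs fscale V \<rho>)"
proof -
  define xs where "xs = (SOME xs. orbit_transversal (supp \<Psi>) xs)"
  define V where "V = (\<lambda>x. fst (SOME r. r \<in> \<Psi> x))"
  define \<rho> where "\<rho> = (\<lambda>x. snd (SOME r. r \<in> \<Psi> x))"
  have xs: "orbit_transversal (supp \<Psi>) xs"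
    unfolding xs_def by (rule someI_ex[OF orbit_transversal_exists])
  have "(V x, \<rho> x) \<in> \<Psi> x" if "x \<in> xs" for x
  proof -
    have "x \<in> X_rat" using that xs by (auto simp: orbit_transversal_def supp_def)
    then have "\<Psi> x \<in> irr_classes scg br (gfix x)" using \<Psi> by (auto simp: EE_def RR_def)
    from someI_ex[OF irr_classes_nonempty[OF this]] show ?thesis by (simp add: V_def \<rho>_def)
  qed
  with \<Psi> xs have "evaluation_data \<Gamma> scA unitA scg br actA actg \<Psi> xs V \<rho>"
    by unfold_locales
  moreover have "ev_class \<Psi> = iso_class fscale brA MM fscale (tensor_space xs fscale V) (ev_rep xs fscale V \<rho>)"
    by (simp add: ev_class_def Let_def xs_def V_def \<rho>_def)
  ultimately show ?thesis by blast
qed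

lemma ev_class_in_SS:
  assumes "\<Psi> \<in> EE"
  shows "ev_class \<Psi> \<in> SS"
proof -
  obtain xs V \<rho> where d: "evaluation_data \<Gamma> scA unitA scg br actA actg \<Psi> xs V \<rho>"
    and eq: "ev_class \<Psi> = iso_class fscale brA MM fscale (tensor_space xs fscale V) (ev_rep xs fscale V \<rho>)"
    using evaluation_data_exists[OF assms] by blast
  show ?thesis unfolding eq by (rule evaluation_data.ev_rep_class[OF d])
qed

text \<open>
  Since \<open>\<phi>\<close> is not zero on \<open>T\<close>, it is not zero on the image of some pure tensor of \<open>T'\<close>; the map from
  \<open>\<Psi>'(x)\<close> to \<open>T'\<close> through this pure tensor gives a nonzero composite \<open>\<chi>\<close>.
\<close>

lemma ev_class_determines:
  assumes \<Psi>: "\<Psi> \<in> EE" and \<Psi>': "\<Psi>' \<in> EE" and eq: "ev_class \<Psi> = ev_class \<Psi>'" and x: "x \<in> X_rat"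
  shows "\<Psi> x = \<Psi>' x"
proof -
  obtain xs V \<rho> where "evaluation_data \<Gamma> scA unitA scg br actA actg \<Psi> xs V \<rho>"
    and cls: "ev_class \<Psi> = iso_class fscale brA MM fscale (tensor_space xs fscale V) (ev_rep xs fscale V \<rho>)"
    using evaluation_data_exists[OF \<Psi>] by blast
  then interpret d: evaluation_data \<Gamma> scA unitA scg br actA actg \<Psi> xs V \<rho> by simp
  obtain xs' V' \<rho>' where "evaluation_data \<Gamma> scA unitA scg br actA actg \<Psi>' xs' V' \<rho>'"
    and cls': "ev_class \<Psi>' = iso_class fscale brA MM fscale (tensor_space xs' fscale V') (ev_rep xs' fscale V' \<rho>')"
    using evaluation_data_exists[OF \<Psi>'] by blast
  then interpret d': evaluation_data \<Gamma> scA unitA scg br actA actg \<Psi>' xs' V' \<rho>' by simp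
  let ?T = "tensor_space xs fscale V" and ?T' = "tensor_space xs' fscale V'"
  let ?a = "ev_rep xs fscale V \<rho>" and ?a' = "ev_rep xs' fscale V' \<rho>'"
  note rep = d.ev_rep_lie_rep
  obtain W \<sigma> where W: "(W, \<sigma>) \<in> fd_reps fscale brA MM" "rep_iso MM fscale ?T ?a fscale W \<sigma>"
    using d.ev_rep_copy by blast
  then have "(W, \<sigma>) \<in> ev_class \<Psi>'" unfolding eq[symmetric] cls iso_class_def by blast
  then have W': "rep_iso MM fscale ?T' ?a' fscale W \<sigma>" unfolding cls' iso_class_def by blast
  have "rep_iso MM fscale W \<sigma> fscale ?T ?a"
    by (rule rep_iso_sym[OF W(2)]) (rule lie_rep_closed(1-3)[OF vector_space_fscale rep]; assumption)+
  from rep_iso_trans[OF W' this] obtain \<Phi> where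
    \<Phi>: "bij_betw \<Phi> ?T' ?T" "linear_between fscale ?T' fscale ?T \<Phi>"
      "\<And>\<alpha> t. \<alpha> \<in> MM \<Longrightarrow> t \<in> ?T' \<Longrightarrow> \<Phi> (?a' \<alpha> t) = ?a \<alpha> (\<Phi> t)"
    unfolding rep_iso_iff_linear_between by blast
  obtain U \<tau> where r: "(U, \<tau>) \<in> \<Psi> x" using irr_classes_nonempty[OF d.\<Psi>_irr[OF x]] by auto
  obtain U' \<tau>' where r': "(U', \<tau>') \<in> \<Psi>' x" using irr_classes_nonempty[OF d'.\<Psi>_irr[OF x]] by auto
  note m = irr_classes_member[OF d.\<Psi>_irr[OF x] r]
  note m' = irr_classes_member[OF d'.\<Psi>_irr[OF x] r']
  from d.local_quotient[OF x r] obtain \<phi> where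
    \<phi>: "linear_between fscale ?T fscale U \<phi>" "\<exists>t\<in>?T. \<phi> t \<noteq> 0"
      "\<And>\<alpha> t. \<alpha> \<in> MM \<Longrightarrow> \<forall>z\<in>xs. z \<notin> orbit \<Gamma> actX x \<longrightarrow> ev_at z \<alpha> = 0 \<Longrightarrow> t \<in> ?T \<Longrightarrow>
         \<phi> (?a \<alpha> t) = \<tau> (ev_at x \<alpha>) (\<phi> t)" by blast
  note \<phi>\<Phi> = linear_between_comp[OF \<Phi>(2) \<phi>(1)]
  have "\<exists>v\<in>Pi\<^sub>E xs' V'. \<phi> (\<Phi> (pure_tensor xs' fscale V' v)) \<noteq> 0"
  proof (rule ccontr)
    assume *: "\<not> ?thesis"
    have "\<phi> (\<Phi> t) = 0" if "t \<in> ?T'" for t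
      using that
    proof (induction rule: d'.t.T_induct)
      case zero
      show ?case by (rule linear_between_zero[OF \<phi>\<Phi> d.t.f.subspace_0[OF d'.t.subspace_T]])
    next
      case (step c v y)
      let ?p = "pure_tensor xs' fscale V' v"
      have p: "?p \<in> ?T'" by (rule d'.t.pure_in_T[OF step(1)])
      have sp: "fscale c ?p \<in> ?T'" by (rule d.t.f.subspace_scale[OF d'.t.subspace_T p])
      have "\<phi> (\<Phi> ?p) = 0" using * step(1) by blast
      then show ?case
        unfolding linear_betweenD(2)[OF \<phi>\<Phi> sp step(2)] linear_betweenD(3)[OF \<phi>\<Phi> p] step.IH
        by (simp add: fscale_def fun_eq_iff)
    qed
    moreover obtain t where "t \<in> ?T" "\<phi> t \<noteq> 0" using \<phi>(2) by blast
    moreover have "\<exists>t'\<in>?T'. t = \<Phi> t'" using \<open>t \<in> ?T\<close> \<Phi>(1) unfolding bij_betw_def by blast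
    ultimately show False by blast
  qed
  then obtain v where v: "v \<in> Pi\<^sub>E xs' V'" "\<phi> (\<Phi> (pure_tensor xs' fscale V' v)) \<noteq> 0" by blast
  from d'.local_insertion[OF x r' v(1)] obtain \<psi> where
    \<psi>: "linear_between fscale U' fscale ?T' \<psi>" "pure_tensor xs' fscale V' v \<in> \<psi> ` U'"
      "\<And>\<alpha> a. \<alpha> \<in> MM \<Longrightarrow> \<forall>z\<in>xs'. z \<notin> orbit \<Gamma> actX x \<longrightarrow> ev_at z \<alpha> = 0 \<Longrightarrow> a \<in> U' \<Longrightarrow>
         \<psi> (\<tau>' (ev_at x \<alpha>) a) = ?a' \<alpha> (\<psi> a)" by blast
  let ?\<chi> = "\<lambda>a. \<phi> (\<Phi> (\<psi> a))"
  have "rep_iso (gfix x) fscale U' \<tau>' fscale U \<tau>"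
  proof (rule schur_rep_iso[where \<phi> = ?\<chi>])
    show "linear_between fscale U' fscale U ?\<chi>" by (rule linear_between_comp[OF \<psi>(1) \<phi>\<Phi>])
    show "\<exists>a\<in>U'. ?\<chi> a \<noteq> 0" using \<psi>(2) v(2) by force
    fix u a assume u: "u \<in> gfix x" and a: "a \<in> U'"
    let ?S = "{z \<in> xs \<union> xs'. z \<notin> orbit \<Gamma> actX x}"
    have "\<exists>\<alpha>\<in>MM. ev_at x \<alpha> = u \<and> (\<forall>y\<in>?S. ev_at y \<alpha> = 0)"
      by (rule equivariant_interpolation[OF x u])
         (use d.finite_xs d'.finite_xs d.xs_X_rat d'.xs_X_rat in auto)
    then obtain \<alpha> where \<alpha>: "\<alpha> \<in> MM" "ev_at x \<alpha> = u" "\<forall>y\<in>?S. ev_at y \<alpha> = 0" by blast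
    have \<psi>a: "\<psi> a \<in> ?T'" by (rule linear_betweenD(1)[OF \<psi>(1) a])
    have "?\<chi> (\<tau>' u a) = \<phi> (\<Phi> (?a' \<alpha> (\<psi> a)))" using \<psi>(3)[OF \<alpha>(1) _ a] \<alpha>(2,3) by simp
    also have "\<dots> = \<phi> (?a \<alpha> (\<Phi> (\<psi> a)))" by (simp only: \<Phi>(3)[OF \<alpha>(1) \<psi>a])
    also have "\<dots> = \<tau> u (?\<chi> a)"
      using \<phi>(3)[OF \<alpha>(1) _ linear_betweenD(1)[OF \<Phi>(2) \<psi>a]] \<alpha>(2,3) by simp
    finally show "?\<chi> (\<tau>' u a) = \<tau> u (?\<chi> a)" .
  qed (use m(3) m'(3) lie_repD(1)[OF m'(1)] lie_rep_closed(4)[OF vector_space_fscale m(1)]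
      lie_rep_closed(4)[OF vector_space_fscale m'(1)] in \<open>auto intro: vector_space_fscale\<close>)
  then have "\<Psi>' x = \<Psi> x" unfolding m(4) m'(4) by (rule iso_class_eqI[OF m'(1)])
  then show ?thesis ..
qed

end

theorem proposition4p15:
  fixes \<Gamma> :: "'c monoid"
    and scA :: "'k::{alg_closed_field,field_char_0} \<Rightarrow> 'a::comm_ring \<Rightarrow> 'a" and unitA :: 'a
    and scg :: "'k \<Rightarrow> 'g::ab_group_add \<Rightarrow> 'g" and br :: "'g \<Rightarrow> 'g \<Rightarrow> 'g"
    and actA :: "'c \<Rightarrow> 'a \<Rightarrow> 'a" and actg :: "'c \<Rightarrow> 'g \<Rightarrow> 'g"
  assumes "equivariant_map_algebra \<Gamma> scA unitA scg br actA actg"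
  shows "equivariant_map_algebra.ev_class \<Gamma> scA unitA scg br actA actg
           \<in> equivariant_map_algebra.EE \<Gamma> scA unitA scg br actA actg
             \<rightarrow> equivariant_map_algebra.SS \<Gamma> scA scg br actA actg
         \<and> inj_on (equivariant_map_algebra.ev_class \<Gamma> scA unitA scg br actA actg)
           (equivariant_map_algebra.EE \<Gamma> scA unitA scg br actA actg)"
proof -
  interpret equivariant_map_algebra \<Gamma> scA unitA scg br actA actg by fact
  have "inj_on ev_class EE"
  proof (rule inj_onI)
    fix \<Psi> \<Psi>' assume \<Psi>: "\<Psi> \<in> EE" "\<Psi>' \<in> EE" "ev_class \<Psi> = ev_class \<Psi>'"
    then have "\<Psi> \<in> Pi\<^sub>E X_rat RR" "\<Psi>' \<in> Pi\<^sub>E X_rat RR" by (simp_all add: EE_def)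
    then show "\<Psi> = \<Psi>'" by (rule PiE_ext) (rule ev_class_determines[OF \<Psi>])
  qed
  then show ?thesis using ev_class_in_SS by blast
qed

end
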